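(* (Frobenius Integral Formula.) Let $p$ be a prime and $k$ a finite field with $q=p^r$ elements. Let $n$ be a positive integer, let $V$ be a nonzero finite-dimensional $k$-vector space of dimension $\delta(V)$, and let $1\le m\le\delta(V)-1$ be an integer. For each linear subspace $W\in\mathrm{Gr}(\delta(V)-m,V)$ (i.e. of dimension $\delta(V)-m$), let $i_W:W\hookrightarrow V$ be the inclusion. Then $$\frac1{|\mathrm{Gr}_k(m,\delta(V)-1)|}\sum_{W\in\mathrm{Gr}(\delta(V)-m,V)}\underline\Omega(i_W)\circ\underline T(i_W)=\mathrm{Frob}^{mr},$$ as $\mathbf W(k)$-linear maps $\underline\Omega^{n+mr}(V)\to\underline\Omega^n(V)$.
   Context: $\mathbf W_j(k)=\mathbf W(k)/p^j$ (Witt vectors); $V^*=\mathrm{Hom}_k(V,k)$. Small Omega powers: $\Gamma^j_A(M)$ is the degree $j$ part of the divided power algebra; linear maps out of it correspond to polynomial laws on $M$ homogeneous of degree $j$. For $n\ge0$ let $\overline\tau_n:k\to\mathbf W_{n+1}(k)$, $\overline\tau_n(x)=\tilde x^{p^n}$ for any lift $\tilde x$ of $x$ (a polynomial law of degree $p^n$). The law $(v,\phi)\mapsto\overline\tau_n(\phi(v))$ induces a bilinear pairing $\Delta$ of $\Gamma^{p^n}_{\mathbf W_{n+1}(k)}(V)$ with $\Gamma^{p^n}_{\mathbf W_{n+1}(k)}(V^* )$, valued in $\mathbf W_{n+1}(k)$, with $\langle[v]_{p^n},[\phi]_{p^n}\rangle=\overline\tau_n(\phi(v))$. Put $\Omega^n(V)=\Gamma^{p^n}_{\mathbf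 W_{n+1}(k)}(V)/\mathrm{Ker}(\Delta)$, let $(v)_n$ be the class of $[v]_{p^n}$, and let $\underline\Omega^n(V)\subset\Omega^n(V)$ be the $\mathbf W_{n+1}(k)$-submodule spanned by all $(v)_n$, $v\in V$. A $k$-linear map $f:V\to V'$ induces $\underline\Omega(f)=\underline\Omega^n(f):\underline\Omega^n(V)\to\underline\Omega^n(V')$, $(v)_n\mapsto(f(v))_n$. Frobenius: since $|k|=p^r$, $V^{(r)}=V\otimes_{k,x\mapsto x^{p^r}}k$ is identified with $V$, and $\mathrm{Frob}^{mr}:\underline\Omega^{n+mr}(V)\to\underline\Omega^n(V)$ is the $\mathbf W(k)$-linear map with $(v)_{n+mr}\mapsto(v)_n$. Transfer: for a subspace $W\subset V$ of codimension $m$, $\underline T(i_W):\underline\Omega^{n+mr}(V)\to\underline\Omega^n(W)$ is the descending transfer, the unique $\mathbf W(k)$-linear map with $(v)_{n+mr}\mapsto(v)_n$ if $v\in W$ and $(v)_{n+mr}\mapsto0$ if $v\in V$, $v\notin W$ (such a map exists). $\mathrm{Gr}_k(a,b)$ denotes the finite set of $a$-dimensional $k$-subspaces of $k^b$; its cardinality is congruent to $1$ mod $p$ (for $0\le a\le b$), hence invertible in $\mathbf W(k)$. *)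

theory Defs
  imports
    Complex_Main
    "HOL-Library.Poly_Mapping"
    "HOL-Library.Function_Algebras"
    "HOL-Library.Cardinality"
    "HOL-Library.Multiset"
    "HOL-Computational_Algebra.Primes"
    "HOL-Algebra.QuotRing"
    "HOL-Algebra.Module"
begin

section \<open>Witt vectors\<close>

text \<open>
  Integer polynomials in the variables \<open>X\<^sub>i\<close> (\<^term>\<open>Inl i\<close>) and \<open>Y\<^sub>i\<close> (\<^term>\<open>Inr i\<close>);
  multisets of variables serve as monomials, here and below.
\<close>

type_synonym int_poly = "(nat + nat) multiset \<Rightarrow>\<^sub>0 int"

definition poly_var :: "nat + nat \<Rightarrow> int_poly" where
  "poly_var v = Poly_Mapping.single {#v#} 1"

definition eval_poly :: "int_poly \<Rightarrow> (nat + nat \<Rightarrow> 'a::comm_ring_1) \<Rightarrow> 'a" where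
  "eval_poly f x =
     (\<Sum>\<mu>\<in>Poly_Mapping.keys f. of_int (Poly_Mapping.lookup f \<mu>) * prod_mset (image_mset x \<mu>))"

definition ghost :: "nat \<Rightarrow> (nat \<Rightarrow> 'a::comm_ring_1) \<Rightarrow> nat \<Rightarrow> 'a" where
  "ghost p z n = (\<Sum>i\<le>n. of_nat (p ^ i) * z i ^ (p ^ (n - i)))"

definition witt_sum_polys :: "nat \<Rightarrow> nat \<Rightarrow> int_poly" where
  "witt_sum_polys p = (THE S. \<forall>n. ghost p S n =
     ghost p (\<lambda>i. poly_var (Inl i)) n + ghost p (\<lambda>i. poly_var (Inr i)) n)"

definition witt_prod_polys :: "nat \<Rightarrow> nat \<Rightarrow> int_poly" where
  "witt_prod_polys p = (THE P. \<forall>n. ghost p P n =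
     ghost p (\<lambda>i. poly_var (Inl i)) n * ghost p (\<lambda>i. poly_var (Inr i)) n)"

definition witt :: "nat \<Rightarrow> (nat \<Rightarrow> 'k::comm_ring_1) ring" where
  "witt p =
     \<lparr>carrier = UNIV,
      mult = (\<lambda>x y n. eval_poly (witt_prod_polys p n) (case_sum x y)),
      one = (\<lambda>n. if n = 0 then 1 else 0),
      zero = (\<lambda>n. 0),
      add = (\<lambda>x y n. eval_poly (witt_sum_polys p n) (case_sum x y))\<rparr>"

definition witt_ideal :: "nat \<Rightarrow> nat \<Rightarrow> (nat \<Rightarrow> 'k::comm_ring_1) set" where
  "witt_ideal p j = PIdl\<^bsub>witt p\<^esub> (add_pow (witt p) (p ^ j) \<one>\<^bsub>witt p\<^esub>)"

definition witt_proj :: "nat \<Rightarrow> nat \<Rightarrow> (nat \<Rightarrow> 'k::comm_ring_1) \<Rightarrow> (nat \<Rightarrow> 'k) set" where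
  "witt_proj p j a = witt_ideal p j +>\<^bsub>witt p\<^esub> a"

definition witt_quot :: "nat \<Rightarrow> nat \<Rightarrow> ((nat \<Rightarrow> 'k::comm_ring_1) set) ring" where
  "witt_quot p j = witt p Quot witt_ideal p j"

text \<open>
  The residue map \<open>W\<^sub>j(k) \<rightarrow> W(k)/p = k\<close> for \<open>j \<ge> 1\<close> (over a perfect field \<open>k\<close> of
  characteristic \<open>p\<close> the 0th component is constant on residue classes), and its
  multiplicative section.
\<close>

definition residue :: "(nat \<Rightarrow> 'k) set \<Rightarrow> 'k" where
  "residue w = the_elem ((\<lambda>a. a 0) ` w)"

definition teichmueller :: "nat \<Rightarrow> nat \<Rightarrow> 'k::comm_ring_1 \<Rightarrow> (nat \<Rightarrow> 'k) set" where
  "teichmueller p j x = witt_proj p j (\<lambda>i. if i = 0 then x else 0)"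


section \<open>Modules and polynomial rings\<close>

definition linear_maps ::
    "('a, 'b) ring_scheme \<Rightarrow> ('a, 'm, 'c) module_scheme \<Rightarrow> ('a, 'n, 'd) module_scheme \<Rightarrow> ('m \<Rightarrow> 'n) set"
  where "linear_maps R M N = {h \<in> carrier M \<rightarrow>\<^sub>E carrier N.
     (\<forall>x\<in>carrier M. \<forall>y\<in>carrier M. h (x \<oplus>\<^bsub>M\<^esub> y) = h x \<oplus>\<^bsub>N\<^esub> h y) \<and>
     (\<forall>a\<in>carrier R. \<forall>x\<in>carrier M. h (a \<odot>\<^bsub>M\<^esub> x) = a \<odot>\<^bsub>N\<^esub> h x)}"

definition self_module :: "('a, 'b) ring_scheme \<Rightarrow> ('a, 'a) module" where
  "self_module R = \<lparr>carrier = carrier R, mult = mult R, one = one R, zero = zero R, add = add R,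
     smult = mult R\<rparr>"

definition bilinear_forms ::
    "('a, 'b) ring_scheme \<Rightarrow> ('a, 'm, 'c) module_scheme \<Rightarrow> ('a, 'n, 'd) module_scheme
      \<Rightarrow> ('m \<Rightarrow> 'n \<Rightarrow> 'a) set"
  where "bilinear_forms R M N = {B \<in> extensional (carrier M).
     (\<forall>x\<in>carrier M. B x \<in> linear_maps R N (self_module R)) \<and>
     (\<forall>y\<in>carrier N. (\<lambda>x\<in>carrier M. B x y) \<in> linear_maps R M (self_module R))}"

text \<open>In the module records built below, \<open>mult\<close> and \<open>one\<close> are irrelevant.\<close>

definition quotient_module ::
    "('a, 'm, 'c) module_scheme \<Rightarrow> 'm set \<Rightarrow> ('a, 'm set) module" where
  "quotient_module M N =
     \<lparr>carrier = a_rcosets\<^bsub>M\<^esub> N, mult = undefined, one = undefined, zero = N, add = set_add M,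
      smult = (\<lambda>a C. \<Union>x\<in>C. N +>\<^bsub>M\<^esub> (a \<odot>\<^bsub>M\<^esub> x))\<rparr>"

definition mpoly_ring :: "('a, 'b) ring_scheme \<Rightarrow> 'i set \<Rightarrow> ('i multiset \<Rightarrow> 'a) ring" where
  "mpoly_ring R I =
     \<lparr>carrier = {f. (\<forall>\<mu>. f \<mu> \<in> carrier R) \<and> finite {\<mu>. f \<mu> \<noteq> \<zero>\<^bsub>R\<^esub>} \<and>
        (\<forall>\<mu>. f \<mu> \<noteq> \<zero>\<^bsub>R\<^esub> \<longrightarrow> set_mset \<mu> \<subseteq> I)},
      mult = (\<lambda>f g \<mu>. \<Oplus>\<^bsub>R\<^esub>\<nu>\<in>{\<nu>. \<nu> \<subseteq># \<mu>}. f \<nu> \<otimes>\<^bsub>R\<^esub> g (\<mu> - \<nu>)),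
      one = (\<lambda>\<mu>. if \<mu> = {#} then \<one>\<^bsub>R\<^esub> else \<zero>\<^bsub>R\<^esub>),
      zero = (\<lambda>\<mu>. \<zero>\<^bsub>R\<^esub>),
      add = (\<lambda>f g \<mu>. f \<mu> \<oplus>\<^bsub>R\<^esub> g \<mu>)\<rparr>"

definition mpoly_const :: "('a, 'b) ring_scheme \<Rightarrow> 'a \<Rightarrow> 'i multiset \<Rightarrow> 'a" where
  "mpoly_const R a = (\<lambda>\<mu>. if \<mu> = {#} then a else \<zero>\<^bsub>R\<^esub>)"

definition mpoly_monom :: "('a, 'b) ring_scheme \<Rightarrow> 'i multiset \<Rightarrow> 'i multiset \<Rightarrow> 'a" where
  "mpoly_monom R \<nu> = (\<lambda>\<mu>. if \<mu> = \<nu> then \<one>\<^bsub>R\<^esub> else \<zero>\<^bsub>R\<^esub>)"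


section \<open>Divided powers\<close>

text \<open>
  \<open>\<Gamma>\<^sub>R(M)\<close> is the quotient of the polynomial ring on the symbols \<open>[x]\<^sub>i\<close>
  (the variables \<open>(x, i)\<close>, of degree \<open>i\<close>) by the ideal generated by Roby's relations.
\<close>

definition dp_polys ::
    "('a, 'b) ring_scheme \<Rightarrow> ('a, 'm, 'c) module_scheme \<Rightarrow> (('m \<times> nat) multiset \<Rightarrow> 'a) ring" where
  "dp_polys R M = mpoly_ring R (carrier M \<times> UNIV)"

definition dp_var :: "('a, 'b) ring_scheme \<Rightarrow> 'm \<Rightarrow> nat \<Rightarrow> ('m \<times> nat) multiset \<Rightarrow> 'a" where
  "dp_var R x i = mpoly_monom R {#(x, i)#}"

definition dp_relations ::
    "('a, 'b) ring_scheme \<Rightarrow> ('a, 'm, 'c) module_scheme \<Rightarrow> (('m \<times> nat) multiset \<Rightarrow> 'a) set" where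
  "dp_relations R M = (let P = dp_polys R M; X = dp_var R in
     {X x 0 \<ominus>\<^bsub>P\<^esub> \<one>\<^bsub>P\<^esub> | x. x \<in> carrier M} \<union>
     {X (a \<odot>\<^bsub>M\<^esub> x) i \<ominus>\<^bsub>P\<^esub> mpoly_const R (a [^]\<^bsub>R\<^esub> i) \<otimes>\<^bsub>P\<^esub> X x i | a x i.
        a \<in> carrier R \<and> x \<in> carrier M} \<union>
     {X x i \<otimes>\<^bsub>P\<^esub> X x j \<ominus>\<^bsub>P\<^esub> add_pow P ((i + j) choose i) (X x (i + j)) | x i j. x \<in> carrier M} \<union>
     {X (x \<oplus>\<^bsub>M\<^esub> y) i \<ominus>\<^bsub>P\<^esub> (\<Oplus>\<^bsub>P\<^esub>j\<in>{..i}. X x j \<otimes>\<^bsub>P\<^esub> X y (i - j)) | x y i.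
        x \<in> carrier M \<and> y \<in> carrier M})"

definition dp_ideal ::
    "('a, 'b) ring_scheme \<Rightarrow> ('a, 'm, 'c) module_scheme \<Rightarrow> (('m \<times> nat) multiset \<Rightarrow> 'a) set" where
  "dp_ideal R M = Idl\<^bsub>dp_polys R M\<^esub> (dp_relations R M)"

definition dp_algebra ::
    "('a, 'b) ring_scheme \<Rightarrow> ('a, 'm, 'c) module_scheme
      \<Rightarrow> ((('m \<times> nat) multiset \<Rightarrow> 'a) set) ring" where
  "dp_algebra R M = dp_polys R M Quot dp_ideal R M"

definition dp_class ::
    "('a, 'b) ring_scheme \<Rightarrow> ('a, 'm, 'c) module_scheme
      \<Rightarrow> (('m \<times> nat) multiset \<Rightarrow> 'a) \<Rightarrow> (('m \<times> nat) multiset \<Rightarrow> 'a) set" where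
  "dp_class R M f = dp_ideal R M +>\<^bsub>dp_polys R M\<^esub> f"

text \<open>The degree \<open>d\<close> part, as an \<open>R\<close>-module.\<close>

definition dp_part ::
    "('a, 'b) ring_scheme \<Rightarrow> ('a, 'm, 'c) module_scheme \<Rightarrow> nat
      \<Rightarrow> ('a, (('m \<times> nat) multiset \<Rightarrow> 'a) set) module" where
  "dp_part R M d =
     \<lparr>carrier = dp_class R M ` {f \<in> carrier (dp_polys R M).
        \<forall>\<mu>. f \<mu> \<noteq> \<zero>\<^bsub>R\<^esub> \<longrightarrow> sum_mset (image_mset snd \<mu>) = d},
      mult = undefined, one = undefined,
      zero = zero (dp_algebra R M), add = add (dp_algebra R M),
      smult = (\<lambda>a C. dp_class R M (mpoly_const R a) \<otimes>\<^bsub>dp_algebra R M\<^esub> C)\<rparr>"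

text \<open>The product of the \<open>[x]\<^sub>i\<close> for \<open>(x, i)\<close> in a list.\<close>

definition dp_monom ::
    "('a, 'b) ring_scheme \<Rightarrow> ('a, 'm, 'c) module_scheme \<Rightarrow> ('m \<times> nat) list
      \<Rightarrow> (('m \<times> nat) multiset \<Rightarrow> 'a) set" where
  "dp_monom R M xs = dp_class R M (mpoly_monom R (mset xs))"


section \<open>Vector spaces as modules over truncated Witt vectors\<close>

definition witt_module ::
    "('k::field \<Rightarrow> 'v::ab_group_add \<Rightarrow> 'v) \<Rightarrow> 'v set \<Rightarrow> ((nat \<Rightarrow> 'k) set, 'v) module" where
  "witt_module scale V =
     \<lparr>carrier = V, mult = undefined, one = undefined, zero = 0, add = (+),
      smult = (\<lambda>w. scale (residue w))\<rparr>"

definition dual_space ::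
    "('k::field \<Rightarrow> 'v::ab_group_add \<Rightarrow> 'v) \<Rightarrow> 'v set \<Rightarrow> ('v \<Rightarrow> 'k) set" where
  "dual_space scale V = {\<phi> \<in> extensional V.
     (\<forall>x\<in>V. \<forall>y\<in>V. \<phi> (x + y) = \<phi> x + \<phi> y) \<and> (\<forall>c. \<forall>x\<in>V. \<phi> (scale c x) = c * \<phi> x)}"

definition witt_dual ::
    "('k::field \<Rightarrow> 'v::ab_group_add \<Rightarrow> 'v) \<Rightarrow> 'v set \<Rightarrow> ((nat \<Rightarrow> 'k) set, 'v \<Rightarrow> 'k) module" where
  "witt_dual scale V =
     \<lparr>carrier = dual_space scale V, mult = undefined, one = undefined,
      zero = (\<lambda>x\<in>V. 0), add = (\<lambda>\<phi> \<psi>. \<lambda>x\<in>V. \<phi> x + \<psi> x),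
      smult = (\<lambda>w \<phi>. \<lambda>x\<in>V. residue w * \<phi> x)\<rparr>"


section \<open>The pairing and the small Omega powers\<close>

text \<open>
  The polynomial law \<open>\<tau>\<^sub>n\<close>, evaluated over the polynomial algebra \<open>W\<^sub>n\<^sub>+\<^sub>1(k)[I]\<close>: it sends
  \<open>f \<in> k[I]\<close> to the \<open>p^n\<close>-th power of a lift of \<open>f\<close>. The result does not depend on the
  lift; we take the coefficientwise Teichmueller lift. Without variables this is
  the map \<open>k \<rightarrow> W\<^sub>n\<^sub>+\<^sub>1(k)\<close>.
\<close>

definition tau_law ::
    "nat \<Rightarrow> nat \<Rightarrow> ('i multiset \<Rightarrow> 'k::field) \<Rightarrow> 'i multiset \<Rightarrow> (nat \<Rightarrow> 'k) set" where
  "tau_law p n f =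
     (\<lambda>\<mu>. teichmueller p (n + 1) (f \<mu>)) [^]\<^bsub>mpoly_ring (witt_quot p (n + 1)) UNIV\<^esub> (p ^ n)"

text \<open>
  The value \<open>\<phi>(v) \<in> k[s, t]\<close> for \<open>v = \<Sum>\<^sub>i s\<^sub>i v\<^sub>i\<close> and \<open>\<phi> = \<Sum>\<^sub>j t\<^sub>j \<phi>\<^sub>j\<close>,
  with \<^term>\<open>Inl i\<close> and \<^term>\<open>Inr j\<close> standing for \<open>s\<^sub>i\<close> and \<open>t\<^sub>j\<close>.
\<close>

definition generic_value ::
    "'v list \<Rightarrow> ('v \<Rightarrow> 'k::field) list \<Rightarrow> (nat + nat) multiset \<Rightarrow> 'k" where
  "generic_value vs fs \<mu> =
     (\<Sum>i<length vs. \<Sum>j<length fs. if \<mu> = {#Inl i, Inr j#} then (fs ! j) (vs ! i) else 0)"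

definition exponents :: "nat list \<Rightarrow> nat list \<Rightarrow> (nat + nat) multiset" where
  "exponents as bs =
     (\<Sum>i<length as. replicate_mset (as ! i) (Inl i)) + (\<Sum>j<length bs. replicate_mset (bs ! j) (Inr j))"

text \<open>
  The linear map on \<open>\<Gamma>\<^sup>d(M)\<close> corresponding to a homogeneous law \<open>F\<close> of degree \<open>d\<close> sends
  \<open>\<Prod>\<^sub>i [v\<^sub>i]\<^sub>a\<^sub>(\<^sub>i\<^sub>)\<close> to the coefficient of \<open>\<Prod>\<^sub>i s\<^sub>i^a(i)\<close> in \<open>F(\<Sum>\<^sub>i s\<^sub>i v\<^sub>i)\<close>, because
  \<open>[\<Sum>\<^sub>i s\<^sub>i v\<^sub>i]\<^sub>d = \<Sum>\<^sub>a \<Prod>\<^sub>i s\<^sub>i^a(i) [v\<^sub>i]\<^sub>a\<^sub>(\<^sub>i\<^sub>)\<close>. The pairing is induced in this way, in both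
  variables, by the law \<open>(v, \<phi>) \<mapsto> \<tau>\<^sub>n(\<phi>(v))\<close>.
\<close>

definition pairing ::
    "nat \<Rightarrow> nat \<Rightarrow> ('k::field \<Rightarrow> 'v::ab_group_add \<Rightarrow> 'v) \<Rightarrow> 'v set
      \<Rightarrow> (('v \<times> nat) multiset \<Rightarrow> (nat \<Rightarrow> 'k) set) set
      \<Rightarrow> ((('v \<Rightarrow> 'k) \<times> nat) multiset \<Rightarrow> (nat \<Rightarrow> 'k) set) set \<Rightarrow> (nat \<Rightarrow> 'k) set" where
  "pairing p n scale V =
     (let R = witt_quot p (n + 1); M = witt_module scale V; N = witt_dual scale V; d = p ^ n in
      THE B. B \<in> bilinear_forms R (dp_part R M d) (dp_part R N d) \<and>
        (\<forall>xs ys. set xs \<subseteq> carrier M \<times> UNIV \<longrightarrow> set ys \<subseteq> carrier N \<times> UNIV \<longrightarrow>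
           sum_list (map snd xs) = d \<longrightarrow> sum_list (map snd ys) = d \<longrightarrow>
           B (dp_monom R M xs) (dp_monom R N ys) =
             tau_law p n (generic_value (map fst xs) (map fst ys))
               (exponents (map snd xs) (map snd ys))))"

abbreviation dp_space ::
    "nat \<Rightarrow> nat \<Rightarrow> ('k::field \<Rightarrow> 'v::ab_group_add \<Rightarrow> 'v) \<Rightarrow> 'v set
      \<Rightarrow> ((nat \<Rightarrow> 'k) set, (('v \<times> nat) multiset \<Rightarrow> (nat \<Rightarrow> 'k) set) set) module" where
  "dp_space p n scale V \<equiv> dp_part (witt_quot p (n + 1)) (witt_module scale V) (p ^ n)"

abbreviation dp_dual ::
    "nat \<Rightarrow> nat \<Rightarrow> ('k::field \<Rightarrow> 'v::ab_group_add \<Rightarrow> 'v) \<Rightarrow> 'v set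
      \<Rightarrow> ((nat \<Rightarrow> 'k) set, ((('v \<Rightarrow> 'k) \<times> nat) multiset \<Rightarrow> (nat \<Rightarrow> 'k) set) set) module" where
  "dp_dual p n scale V \<equiv> dp_part (witt_quot p (n + 1)) (witt_dual scale V) (p ^ n)"

definition pairing_kernel ::
    "nat \<Rightarrow> nat \<Rightarrow> ('k::field \<Rightarrow> 'v::ab_group_add \<Rightarrow> 'v) \<Rightarrow> 'v set
      \<Rightarrow> (('v \<times> nat) multiset \<Rightarrow> (nat \<Rightarrow> 'k) set) set set" where
  "pairing_kernel p n scale V =
     {x \<in> carrier (dp_space p n scale V). \<forall>y \<in> carrier (dp_dual p n scale V).
        pairing p n scale V x y = \<zero>\<^bsub>witt_quot p (n + 1)\<^esub>}"

definition Omega ::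
    "nat \<Rightarrow> nat \<Rightarrow> ('k::field \<Rightarrow> 'v::ab_group_add \<Rightarrow> 'v) \<Rightarrow> 'v set
      \<Rightarrow> ((nat \<Rightarrow> 'k) set, (('v \<times> nat) multiset \<Rightarrow> (nat \<Rightarrow> 'k) set) set set) module" where
  "Omega p n scale V = quotient_module (dp_space p n scale V) (pairing_kernel p n scale V)"

definition omega_elem ::
    "nat \<Rightarrow> nat \<Rightarrow> ('k::field \<Rightarrow> 'v::ab_group_add \<Rightarrow> 'v) \<Rightarrow> 'v set \<Rightarrow> 'v
      \<Rightarrow> (('v \<times> nat) multiset \<Rightarrow> (nat \<Rightarrow> 'k) set) set set" where
  "omega_elem p n scale V v = pairing_kernel p n scale V +>\<^bsub>dp_space p n scale V\<^esub>
     dp_monom (witt_quot p (n + 1)) (witt_module scale V) [(v, p ^ n)]"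

text \<open>
  The submodule spanned by the \<open>(v)\<^sub>n\<close>, as a module over \<open>W(k)\<close> via \<open>W(k) \<rightarrow> W\<^sub>n\<^sub>+\<^sub>1(k)\<close>.
\<close>

definition Omega_small ::
    "nat \<Rightarrow> nat \<Rightarrow> ('k::field \<Rightarrow> 'v::ab_group_add \<Rightarrow> 'v) \<Rightarrow> 'v set
      \<Rightarrow> (nat \<Rightarrow> 'k, (('v \<times> nat) multiset \<Rightarrow> (nat \<Rightarrow> 'k) set) set set) module" where
  "Omega_small p n scale V =
     \<lparr>carrier = (\<lambda>N. submodule N (witt_quot p (n + 1)) (Omega p n scale V)) hull
        (omega_elem p n scale V ` V),
      mult = undefined, one = undefined,
      zero = zero (Omega p n scale V), add = add (Omega p n scale V),
      smult = (\<lambda>a x. witt_proj p (n + 1) a \<odot>\<^bsub>Omega p n scale V\<^esub> x)\<rparr>"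


section \<open>Functoriality, Frobenius and descending transfer\<close>

definition omega_map ::
    "nat \<Rightarrow> nat \<Rightarrow> ('k::field \<Rightarrow> 'v::ab_group_add \<Rightarrow> 'v) \<Rightarrow> ('k \<Rightarrow> 'u::ab_group_add \<Rightarrow> 'u)
      \<Rightarrow> 'v set \<Rightarrow> 'u set \<Rightarrow> ('v \<Rightarrow> 'u)
      \<Rightarrow> (('v \<times> nat) multiset \<Rightarrow> (nat \<Rightarrow> 'k) set) set set
      \<Rightarrow> (('u \<times> nat) multiset \<Rightarrow> (nat \<Rightarrow> 'k) set) set set" where
  "omega_map p n scale scale' V V' f =
     (THE h. h \<in> linear_maps (witt p) (Omega_small p n scale V) (Omega_small p n scale' V') \<and>
        (\<forall>v\<in>V. h (omega_elem p n scale V v) = omega_elem p n scale' V' (f v)))"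

text \<open>
  The last number in the next two definitions is the drop in level, \<open>m * r\<close> in the
  notation \<open>Frob\<^sup>m\<^sup>r\<close> for \<open>|k| = p^r\<close>.
\<close>

definition omega_frob ::
    "nat \<Rightarrow> nat \<Rightarrow> nat \<Rightarrow> ('k::field \<Rightarrow> 'v::ab_group_add \<Rightarrow> 'v) \<Rightarrow> 'v set
      \<Rightarrow> (('v \<times> nat) multiset \<Rightarrow> (nat \<Rightarrow> 'k) set) set set
      \<Rightarrow> (('v \<times> nat) multiset \<Rightarrow> (nat \<Rightarrow> 'k) set) set set" where
  "omega_frob p n c scale V =
     (THE h. h \<in> linear_maps (witt p) (Omega_small p (n + c) scale V) (Omega_small p n scale V) \<and>
        (\<forall>v\<in>V. h (omega_elem p (n + c) scale V v) = omega_elem p n scale V v))"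

definition descending_transfer ::
    "nat \<Rightarrow> nat \<Rightarrow> nat \<Rightarrow> ('k::field \<Rightarrow> 'v::ab_group_add \<Rightarrow> 'v) \<Rightarrow> 'v set \<Rightarrow> 'v set
      \<Rightarrow> (('v \<times> nat) multiset \<Rightarrow> (nat \<Rightarrow> 'k) set) set set
      \<Rightarrow> (('v \<times> nat) multiset \<Rightarrow> (nat \<Rightarrow> 'k) set) set set" where
  "descending_transfer p n c scale V W =
     (THE h. h \<in> linear_maps (witt p) (Omega_small p (n + c) scale V) (Omega_small p n scale W) \<and>
        (\<forall>v\<in>V. h (omega_elem p (n + c) scale V v) =
           (if v \<in> W then omega_elem p n scale W v else \<zero>\<^bsub>Omega_small p n scale W\<^esub>)))"


section \<open>Grassmannians\<close>

definition Grassmannian ::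
    "('k::field \<Rightarrow> 'v::ab_group_add \<Rightarrow> 'v) \<Rightarrow> nat \<Rightarrow> 'v set \<Rightarrow> 'v set set" where
  "Grassmannian scale a V =
     {U. Modules.module.subspace scale U \<and> U \<subseteq> V \<and> vector_space.dim scale U = a}"

text \<open>\<open>Gr\<^sub>k(a, b)\<close>, with \<open>k\<^sup>b\<close> as the sequences vanishing from index \<open>b\<close> on.\<close>

definition Gr :: "'k::field itself \<Rightarrow> nat \<Rightarrow> nat \<Rightarrow> (nat \<Rightarrow> 'k) set set" where
  "Gr _ a b = Grassmannian (\<lambda>c x i. c * x i) a {x. \<forall>i\<ge>b. x i = 0}"

end

theory Submission
  imports Defs
begin

text \<open>
  Unwinding the pairing, a combination \<open>\<Sum>\<^sub>v a\<^sub>v (v)\<^sub>n\<close> vanishes if and only if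
  \<open>\<Sum>\<^sub>v a\<^sub>v c(b) \<Prod>\<^sub>i [\<phi>\<^sub>i(v)]^b\<^sub>i = 0\<close> modulo \<open>p^(n+1)\<close> for all functionals \<open>\<phi>\<^sub>i\<close> and all exponents
  \<open>b\<^sub>i\<close> with sum \<open>p^n\<close>, where \<open>[x]\<close> is the Teichmueller lift and \<open>c(b)\<close> the multinomial
  coefficient. With \<open>q = |k|\<close>, replacing \<open>b\<close> by \<open>q b\<close> changes neither the \<open>p\<close>-adic valuation of \<open>c(b)\<close>
  nor the function \<open>[\<phi>]^b\<close>, so the Frobenius respects the relations. The indicator function of
  \<open>\<psi> \<noteq> 0\<close> is \<open>[\<psi>]^(q-1)\<close>, and moving \<open>(q-1) p^e\<close> of an exponent \<open>q b\<close> from \<open>\<phi>\<close> to \<open>\<psi>\<close>, where \<open>e\<close> is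
  the valuation of \<open>b\<close>, costs only a factor \<open>q\<close>; iterating this over \<open>m\<close> functionals that cut out \<open>W\<close>
  gives the descending transfer. The formula then only says that each \<open>v \<noteq> 0\<close> lies in
  \<open>|Gr(m, \<delta> - 1)|\<close> subspaces of codimension \<open>m\<close>, while \<open>(0)\<^sub>n = 0\<close>.
\<close>

section \<open>Congruences in commutative rings\<close>

text \<open>The pairing is a definite description on classes of polynomials modulo Roby's relations,
  so its existence has to be proved although \<open>[\<phi>(v)]\<close> is bilinear only modulo
  \<open>p\<close>. This works because the degree is \<open>p^n\<close>: replacing \<open>u\<close>
  by \<open>w\<close> with \<open>u = w\<close> modulo \<open>p\<close> changes
  \<open>(p^n choose i) u^i\<close> only by multiples of \<open>p^(n+1)\<close>, the binomial
  coefficient supplying the factors \<open>p\<close> that \<open>u^i - w^i\<close> lacks. Reading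
  the coefficients of the \<open>p^n\<close>-th power of a generic bilinear form in two orders shows
  that the values respect the relations in either argument. Small Omega powers enter the formula
  only as modules with generators and relations; functoriality, Frobenius and transfer are all
  induced by maps of coefficient functions. In the transfer, the exponent \<open>(q-1) p^e\<close>
  is the one for which \<open>(q b choose (q-1) p^e)\<close> has valuation exactly \<open>r\<close>;
  moving \<open>q-1\<close> alone would cost \<open>e\<close> more factors \<open>p\<close>. The
  factor \<open>p^r\<close> can be divided out again because the relation is given at level
  \<open>n + r\<close> and W(k) has no \<open>p\<close>-torsion.\<close>

lemma dvd_diff_sym:
  fixes a b :: "'a::comm_ring_1"
  shows "d dvd a - b \<Longrightarrow> d dvd b - a"
  by (metis dvd_minus_iff minus_diff_eq)

lemma dvd_diff_mult:
  fixes a b c d :: "'a::comm_ring_1"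
  assumes "m dvd a - b" "m dvd c - d"
  shows "m dvd a * c - b * d"
proof -
  have "a * c - b * d = (a - b) * c + b * (c - d)"
    by (simp add: algebra_simps)
  then show ?thesis
    using assms by simp
qed

lemma dvd_diff_power:
  fixes a b :: "'a::comm_ring_1"
  assumes "m dvd a - b"
  shows "m dvd a ^ n - b ^ n"
  by (induction n) (auto intro: dvd_diff_mult assms)

text \<open>\<open>x^p - y^p\<close> is \<open>x - y\<close> times a sum of \<open>p\<close>
  products, each congruent to \<open>y^(p-1)\<close> modulo \<open>p\<close>, so that sum
  contributes one more factor \<open>p\<close>.\<close>

lemma dvd_diff_power_step:
  fixes x y :: "'a::comm_ring_1"
  assumes "of_nat p ^ Suc k dvd x - y"
  shows "of_nat p ^ Suc (Suc k) dvd x ^ p - y ^ p"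
proof (cases p)
  case (Suc n)
  have 1: "of_nat p dvd x - y"
    by (rule dvd_trans[OF _ assms]) simp
  have "x ^ p - y ^ p = (x - y) * (\<Sum>i<Suc n. x ^ i * y ^ (n - i))"
    unfolding Suc by (rule diff_power_eq_sum)
  moreover have "of_nat p dvd (\<Sum>i<Suc n. x ^ i * y ^ (n - i))"
  proof -
    have "of_nat p dvd x ^ i * y ^ (n - i) - y ^ n" if "i < Suc n" for i
    proof -
      have "of_nat p dvd x ^ i * y ^ (n - i) - y ^ i * y ^ (n - i)"
        by (intro dvd_diff_mult dvd_diff_power 1) simp
      then show ?thesis
        using that by (simp flip: power_add)
    qed
    then have "of_nat p dvd (\<Sum>i<Suc n. x ^ i * y ^ (n - i) - y ^ n)"
      by (intro dvd_sum) auto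
    then have "of_nat p dvd (\<Sum>i<Suc n. x ^ i * y ^ (n - i)) - of_nat p * y ^ n"
      by (simp add: sum_subtractf Suc)
    then show ?thesis
      using dvd_add[of "of_nat p" _ "of_nat p * y ^ n"] by fastforce
  qed
  ultimately show ?thesis
    using mult_dvd_mono[OF assms, of "of_nat p" "\<Sum>i<Suc n. x ^ i * y ^ (n - i)"]
    by (simp only: power_Suc mult_ac)
qed simp

lemma dvd_diff_prime_power:
  fixes x y :: "'a::comm_ring_1"
  assumes "of_nat p dvd x - y"
  shows "of_nat p ^ Suc k dvd x ^ (p ^ k) - y ^ (p ^ k)"
proof (induction k)
  case (Suc k)
  from dvd_diff_power_step[OF Suc] show ?case
    by (simp add: power_mult mult.commute[of p])
qed (use assms in simp)

text \<open>Only the \<open>p\<close>-part of the exponent raises the modulus: for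
  \<open>i = p^e j\<close> the \<open>p^e\<close>-th powers already agree modulo
  \<open>p^(e+1)\<close>.\<close>

lemma dvd_diff_power_multiplicity:
  fixes x y :: "'a::comm_ring_1"
  assumes "of_nat p dvd x - y"
  shows "of_nat p ^ Suc (multiplicity p i) dvd x ^ i - y ^ i"
proof -
  obtain j where j: "i = p ^ multiplicity p i * j"
    using multiplicity_dvd[of p i] by blast
  have "x ^ i - y ^ i = (x ^ (p ^ multiplicity p i)) ^ j - (y ^ (p ^ multiplicity p i)) ^ j"
    by (metis j power_mult)
  then show ?thesis
    using dvd_diff_power[OF dvd_diff_prime_power[OF assms], of "multiplicity p i" j] by simp
qed

lemma prime_dvd_add_power_diff:
  fixes x y :: "'a::comm_ring_1"
  assumes "prime p"
  shows "of_nat p dvd (x + y) ^ p - (x ^ p + y ^ p)"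
proof -
  have p: "p > 0" using assms by (simp add: prime_gt_0_nat)
  have "(x + y) ^ p = (\<Sum>k\<le>p. of_nat (p choose k) * x ^ k * y ^ (p - k))"
    by (rule binomial_ring)
  also have "{..p} = insert 0 (insert p {0<..<p})"
    by auto
  also have "(\<Sum>k\<in>insert 0 (insert p {0<..<p}). of_nat (p choose k) * x ^ k * y ^ (p - k))
      = y ^ p + (x ^ p + (\<Sum>k\<in>{0<..<p}. of_nat (p choose k) * x ^ k * y ^ (p - k)))"
    using p by (subst sum.insert; simp)+
  finally have "(x + y) ^ p - (x ^ p + y ^ p) = (\<Sum>k\<in>{0<..<p}. of_nat (p choose k) * x ^ k * y ^ (p - k))"
    by simp
  moreover have "of_nat p dvd (of_nat (p choose k) :: 'a)" if "k \<in> {0<..<p}" for k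
  proof -
    have "p dvd p choose k"
      using that assms by (intro dvd_choose_prime) auto
    then show ?thesis
      by (auto elim!: dvdE)
  qed
  ultimately show ?thesis
    by (auto intro!: dvd_sum dvd_mult2)
qed


section \<open>Polynomial mappings\<close>

alias pm_single = Poly_Mapping.single
alias pm_lookup = Poly_Mapping.lookup
alias pm_keys = Poly_Mapping.keys

type_synonym ('i, 'a) mpoly = "'i multiset \<Rightarrow>\<^sub>0 'a"

text \<open>One format for additive functionals on polynomials: \<open>h\<close> transports
  coefficients, \<open>w\<close> gives the values on monomials. Evaluation of integer polynomials
  takes \<open>h = of_int\<close>, functionals over W(k) take \<open>h = id\<close>, and functionals
  with polynomial values take \<open>h = pm_single 0\<close>.\<close>

definition pm_sum :: "('b \<Rightarrow> 'c) \<Rightarrow> ('a \<Rightarrow> 'c) \<Rightarrow> ('a \<Rightarrow>\<^sub>0 'b::zero) \<Rightarrow> 'c::comm_ring_1" where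
  "pm_sum h w f = (\<Sum>\<mu>\<in>pm_keys f. h (pm_lookup f \<mu>) * w \<mu>)"

lemma pm_sum_superset:
  assumes "h 0 = 0" "finite A" "pm_keys f \<subseteq> A"
  shows "pm_sum h w f = (\<Sum>\<mu>\<in>A. h (pm_lookup f \<mu>) * w \<mu>)"
  unfolding pm_sum_def using assms
  by (intro sum.mono_neutral_left) (auto simp: in_keys_iff)

lemma pm_sum_add:
  assumes "\<And>a b. h (a + b) = h a + h b" "h 0 = 0"
  shows "pm_sum h w (f + g) = pm_sum h w f + pm_sum h w (g :: _ \<Rightarrow>\<^sub>0 _::comm_monoid_add)"
proof -
  let ?A = "pm_keys f \<union> pm_keys g"
  have "pm_sum h w (f + g) = (\<Sum>\<mu>\<in>?A. h (pm_lookup (f + g) \<mu>) * w \<mu>)"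
    using keys_add[of f g] by (intro pm_sum_superset assms) auto
  moreover have "pm_sum h w f = (\<Sum>\<mu>\<in>?A. h (pm_lookup f \<mu>) * w \<mu>)"
    by (intro pm_sum_superset assms) auto
  moreover have "pm_sum h w g = (\<Sum>\<mu>\<in>?A. h (pm_lookup g \<mu>) * w \<mu>)"
    by (intro pm_sum_superset assms) auto
  ultimately show ?thesis
    by (simp add: lookup_add assms algebra_simps sum.distrib)
qed

lemma pm_sum_0 [simp]: "pm_sum h w 0 = 0"
  by (simp add: pm_sum_def)

lemma pm_sum_single: "h 0 = 0 \<Longrightarrow> pm_sum h w (pm_single \<mu> c) = h c * w \<mu>"
  by (simp add: pm_sum_def)

lemma pm_sum_minus:
  fixes f g :: "_ \<Rightarrow>\<^sub>0 _::ab_group_add"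
  assumes "\<And>a b. h (a + b) = h a + h b" "h 0 = 0"
  shows "pm_sum h w (f - g) = pm_sum h w f - pm_sum h w g"
  using pm_sum_add[of h w "f - g" g] assms by simp

lemma pm_sum_sum:
  assumes "\<And>a b. h (a + b) = h a + h b" "h 0 = 0"
  shows "pm_sum h w (\<Sum>x\<in>A. f x) = (\<Sum>x\<in>A. pm_sum h w (f x :: _ \<Rightarrow>\<^sub>0 _::comm_monoid_add))"
  using assms by (induction A rule: infinite_finite_induct) (auto simp: pm_sum_add)

lemma keys_induct [consumes 1, case_names zero single add]:
  assumes "pm_keys f \<subseteq> A" "P 0" "\<And>k c. k \<in> A \<Longrightarrow> P (pm_single k c)"
    "\<And>f g. pm_keys f \<subseteq> A \<Longrightarrow> pm_keys g \<subseteq> A \<Longrightarrow> P f \<Longrightarrow> P g \<Longrightarrow> P (f + g)"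
  shows "P (f :: 'a \<Rightarrow>\<^sub>0 'b::comm_monoid_add)"
  using assms(1)
proof (induction f rule: update_induct)
  case (update f a b)
  have eq: "Poly_Mapping.update a b f = f + pm_single a b"
    using update(1)
    by (intro poly_mapping_eqI) (auto simp: lookup_update lookup_add lookup_single when_def in_keys_iff)
  have "pm_keys f \<subseteq> A" "a \<in> A"
    using update by (auto simp: keys_update split: if_splits)
  then show ?case
    unfolding eq using update assms(3)[of a b] by (intro assms(4)) auto
qed (use assms in simp)

lemma poly_mapping_add_induct [case_names zero single add]:
  assumes "P 0" "\<And>k c. P (pm_single k c)" "\<And>f g. P f \<Longrightarrow> P g \<Longrightarrow> P (f + g)"
  shows "P (f :: 'a \<Rightarrow>\<^sub>0 'b::comm_monoid_add)"
  by (rule keys_induct[OF subset_UNIV]) (use assms in auto)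

lemma of_nat_mult_lookup:
  fixes f :: "('i, 'a::comm_ring_1) mpoly"
  shows "pm_lookup (of_nat c * f) \<mu> = of_nat c * pm_lookup f \<mu>"
  by (induction c) (auto simp: lookup_add algebra_simps)

lemma lookup_single_mult:
  fixes g :: "('i, 'a::comm_ring_1) mpoly"
  shows "pm_lookup (pm_single \<kappa> a * g) \<mu> =
    (if \<kappa> \<subseteq># \<mu> then a * pm_lookup g (\<mu> - \<kappa>) else 0)"
proof (induction g rule: poly_mapping_add_induct)
  case (single k c)
  then show ?case
    by (auto simp: mult_single lookup_single when_def)
      (metis mset_subset_eq_add_left)
qed (auto simp: algebra_simps lookup_add)

lemma lookup_const_mult:
  fixes g :: "('i, 'a::comm_ring_1) mpoly"
  shows "pm_lookup (pm_single 0 a * g) \<mu> = a * pm_lookup g \<mu>"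
  by (simp add: lookup_single_mult)

lemma finite_submultisets: "finite {\<nu>. \<nu> \<subseteq># (\<mu> :: 'a multiset)}"
proof (induction \<mu>)
  case (add a \<mu>)
  have "\<nu> \<in> {\<nu>. \<nu> \<subseteq># \<mu>} \<union> add_mset a ` {\<nu>. \<nu> \<subseteq># \<mu>}" if "\<nu> \<subseteq># add_mset a \<mu>" for \<nu>
  proof (cases "a \<in># \<nu>")
    case True
    then obtain \<nu>' where "\<nu> = add_mset a \<nu>'"
      by (metis insert_DiffM)
    then show ?thesis
      using that by auto
  next
    case False
    then have "\<nu> \<subseteq># \<mu>"
      using that by (metis diff_single_trivial subset_eq_diff_conv add_mset_add_single)
    then show ?thesis
      by simp
  qed
  then show ?case
    using add by (intro finite_subset[of "{\<nu>. \<nu> \<subseteq># add_mset a \<mu>}" "{\<nu>. \<nu> \<subseteq># \<mu>} \<union> add_mset a ` {\<nu>. \<nu> \<subseteq># \<mu>}"]) blast+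
qed simp


section \<open>Witt vectors\<close>

subsection \<open>Integer polynomials\<close>

definition ieval :: "('i, int) mpoly \<Rightarrow> ('i \<Rightarrow> 'a::comm_ring_1) \<Rightarrow> 'a" where
  "ieval f x = pm_sum of_int (\<lambda>\<mu>. prod_mset (image_mset x \<mu>)) f"

lemma eval_poly_eq_ieval: "eval_poly f x = ieval f x"
  by (simp add: eval_poly_def ieval_def pm_sum_def)

lemma ieval_0 [simp]: "ieval 0 x = 0"
  by (simp add: ieval_def)

lemma ieval_add: "ieval (f + g) x = ieval f x + ieval g x"
  by (simp add: ieval_def pm_sum_add)

lemma ieval_single: "ieval (pm_single \<mu> c) x = of_int c * prod_mset (image_mset x \<mu>)"
  by (simp add: ieval_def pm_sum_single)

lemma ieval_1 [simp]: "ieval 1 x = 1"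
  using ieval_single[of 0 1 x] by simp

lemma ieval_mult: "ieval (f * g) x = ieval f x * ieval g x"
proof (induction f rule: poly_mapping_add_induct)
  case (single k c)
  show ?case
    by (induction g rule: poly_mapping_add_induct)
      (simp_all add: mult_single ieval_single ieval_add distrib_left mult.assoc mult.left_commute)
qed (simp_all add: ieval_add distrib_right)

lemma ieval_minus: "ieval (f - g) x = ieval f x - ieval g x"
  using ieval_add[of "f - g" g x] by simp

lemma ieval_uminus: "ieval (- f) x = - ieval f x"
  using ieval_minus[of 0 f x] by simp

lemma ieval_of_nat [simp]: "ieval (of_nat n) x = of_nat n"
  by (induction n) (simp_all add: ieval_add)

lemma ieval_of_int [simp]: "ieval (of_int n) x = of_int n"
  by (cases n) (simp_all add: ieval_uminus ieval_minus)

lemma ieval_power: "ieval (f ^ n) x = ieval f x ^ n"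
  by (induction n) (simp_all add: ieval_mult)

lemma ieval_sum: "ieval (\<Sum>i\<in>A. f i) x = (\<Sum>i\<in>A. ieval (f i) x)"
  by (induction A rule: infinite_finite_induct) (simp_all add: ieval_add)

lemma ieval_prod_mset: "ieval (prod_mset M) x = prod_mset (image_mset (\<lambda>f. ieval f x) M)"
  by (induction M) (simp_all add: ieval_mult)

lemma ieval_ieval: "ieval (ieval f z) y = ieval f (\<lambda>i. ieval (z i) y)"
  by (induction f rule: poly_mapping_add_induct)
    (simp_all add: ieval_add ieval_single ieval_mult ieval_prod_mset image_mset.compositionality o_def)

definition ivar :: "'i \<Rightarrow> ('i, int) mpoly" where
  "ivar i = pm_single {#i#} 1"

lemma ieval_ivar [simp]: "ieval (ivar i) x = x i"
  by (simp add: ivar_def ieval_single)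

lemma int_poly_cancel:
  fixes f g :: "('i, int) mpoly"
  assumes "of_nat c * f = of_nat c * g" "c > 0"
  shows "f = g"
proof (rule poly_mapping_eqI)
  fix \<mu>
  have "pm_lookup (of_nat c * f) \<mu> = pm_lookup (of_nat c * g) \<mu>"
    using assms by simp
  then show "pm_lookup f \<mu> = pm_lookup g \<mu>"
    using assms(2) by (simp add: of_nat_mult_lookup)
qed

definition frob_lift :: "nat \<Rightarrow> ('i, int) mpoly \<Rightarrow> ('i, int) mpoly" where
  "frob_lift p f = ieval f (\<lambda>i. ivar i ^ p)"

lemma frob_lift_dvd:
  assumes "prime p"
  shows "of_nat p dvd frob_lift p f - f ^ p"
proof (induction f rule: poly_mapping_add_induct)
  case zero
  then show ?case
    using assms by (simp add: frob_lift_def power_0_left prime_gt_0_nat)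
next
  case (single k c)
  have mono: "prod_mset (image_mset (\<lambda>i. ivar i ^ p) k) = pm_single k (1::int) ^ p"
    by (induction k) (simp_all add: ivar_def power_mult_distrib mult_single flip: power_mult_distrib)
  have "pm_single k c = of_int c * pm_single k 1"
    using single_of_int[of c, where ?'a = "'a multiset"] by (simp add: mult_single flip: single_of_int)
  then have "frob_lift p (pm_single k c) - pm_single k c ^ p
      = (of_int (c - c ^ p)) * pm_single k 1 ^ p"
    unfolding frob_lift_def ieval_single mono
    by (simp only: power_mult_distrib of_int_diff of_int_power left_diff_distrib)
  \<comment> \<open>Fermat's little theorem, by induction upwards and downwards from 0; each step
    uses that \<open>p\<close>-th powers are additive modulo \<open>p\<close>.\<close>
  moreover have "int p dvd c - c ^ p"
  proof (induction c rule: int_induct[of _ 0])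
    case (step1 i)
    have eq: "(i + 1) - (i + 1) ^ p = (i - i ^ p) - ((i + 1) ^ p - (i ^ p + 1 ^ p))"
      by simp
    show ?case
      unfolding eq by (intro dvd_diff step1(2) prime_dvd_add_power_diff assms)
  next
    case (step2 i)
    have eq: "(i - 1) - (i - 1) ^ p = (i - i ^ p) + ((i - 1 + 1) ^ p - ((i - 1) ^ p + 1 ^ p))"
      by simp
    show ?case
      unfolding eq by (intro dvd_add step2(2) prime_dvd_add_power_diff assms)
  qed (use assms in \<open>simp add: prime_gt_0_nat power_0_left\<close>)
  then obtain d where "c - c ^ p = int p * d" ..
  then have "(of_int (c - c ^ p) :: ('a, int) mpoly) = of_nat p * of_int d"
    by (metis of_int_mult of_int_of_nat_eq)
  ultimately show ?case
    by simp
next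
  case (add f g)
  have eq: "frob_lift p (f + g) - (f + g) ^ p
     = (frob_lift p f - f ^ p) + (frob_lift p g - g ^ p) - ((f + g) ^ p - (f ^ p + g ^ p))"
    by (simp add: frob_lift_def ieval_add)
  show ?case
    unfolding eq by (intro dvd_add dvd_diff add prime_dvd_add_power_diff assms)
qed


subsection \<open>Ghost components\<close>

text \<open>Dwork's lemma: \<open>w\<close> is a sequence of ghost components if and only if
  \<open>w (n + 1)\<close> is congruent to the Frobenius lift of \<open>w n\<close> modulo \<open>p ^ (n + 1)\<close>.\<close>

lemma ghost_Suc_dvd:
  fixes z :: "nat \<Rightarrow> ('i, int) mpoly"
  assumes "prime p"
  shows "of_nat p ^ Suc n dvd ghost p z (Suc n) - frob_lift p (ghost p z n)"
proof -
  have eq: "frob_lift p (ghost p z n) = (\<Sum>i\<le>n. of_nat p ^ i * frob_lift p (z i) ^ (p ^ (n - i)))"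
    by (simp add: frob_lift_def ghost_def ieval_sum ieval_mult ieval_power del: of_nat_power flip: of_nat_power)
  have "ghost p z (Suc n) - frob_lift p (ghost p z n) = of_nat p ^ Suc n * z (Suc n) +
    (\<Sum>i\<le>n. of_nat p ^ i * (z i ^ (p ^ (Suc n - i)) - frob_lift p (z i) ^ (p ^ (n - i))))"
    unfolding eq by (simp add: ghost_def right_diff_distrib sum_subtractf)
  moreover have "of_nat p ^ Suc n dvd of_nat p ^ i * (z i ^ (p ^ (Suc n - i)) - frob_lift p (z i) ^ (p ^ (n - i)))"
    if "i \<le> n" for i
  proof -
    have "of_nat p dvd z i ^ p - frob_lift p (z i)"
      using frob_lift_dvd[OF assms, of "z i"] by (rule dvd_diff_sym)
    from dvd_diff_prime_power[OF this, of "n - i"]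
    have "of_nat p ^ Suc (n - i) dvd z i ^ (p ^ (Suc n - i)) - frob_lift p (z i) ^ (p ^ (n - i))"
      using that by (simp add: Suc_diff_le flip: power_mult)
    from mult_dvd_mono[OF dvd_refl this, of "of_nat p ^ i"] show ?thesis
      using that by (simp del: power_Suc flip: power_add)
  qed
  ultimately show ?thesis
    by (auto intro!: dvd_add dvd_sum)
qed

text \<open>Integer polynomials have no torsion, so \<open>p^n\<close> can be cancelled from
  \<open>p^n z_n\<close> once the earlier entries agree. Comparing only the indices up to
  \<open>n\<close> is what makes the \<open>n\<close>-th entry of a Witt sum depend on the entries
  up to \<open>n\<close> alone.\<close>

lemma ghost_inj:
  fixes z z' :: "nat \<Rightarrow> ('i, int) mpoly"
  assumes "p > 0" "\<And>i. i \<le> n \<Longrightarrow> ghost p z i = ghost p z' i"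
  shows "z n = z' n"
  using assms(2)
proof (induction n rule: less_induct)
  case (less n)
  have "z i = z' i" if "i < n" for i
    using less that by auto
  then have "(\<Sum>i<n. of_nat (p ^ i) * z i ^ (p ^ (n - i))) = (\<Sum>i<n. of_nat (p ^ i) * z' i ^ (p ^ (n - i)))"
    by simp
  then have "of_nat (p ^ n) * z n = of_nat (p ^ n) * z' n"
    using less(2)[of n] by (simp add: ghost_def lessThan_Suc_atMost[symmetric] del: of_nat_power)
  then show ?case
    by (rule int_poly_cancel) (use assms in auto)
qed

lemma ghost_inj':
  fixes z z' :: "nat \<Rightarrow> ('i, int) mpoly"
  assumes "p > 0" "\<And>i. ghost p z i = ghost p z' i"
  shows "z = z'"
  using ghost_inj[OF assms(1)] assms(2) by blast

text \<open>Once the earlier entries agree modulo \<open>p\<close>, their ghost terms agree modulo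
  \<open>p^(n+1)\<close>, and what remains is \<open>p^n (z_n - z'_n)\<close>. This computes Witt
  vectors in characteristic \<open>p\<close> from approximate ghost components.\<close>

lemma ghost_dvd_imp_dvd:
  fixes z z' :: "nat \<Rightarrow> ('i, int) mpoly"
  assumes "p > 0" "\<And>n. of_nat p ^ Suc n dvd ghost p z n - ghost p z' n"
  shows "of_nat p dvd z n - z' n"
proof (induction n rule: less_induct)
  case (less n)
  have "of_nat p ^ Suc n dvd of_nat (p ^ i) * (z i ^ (p ^ (n - i)) - z' i ^ (p ^ (n - i)))" if "i < n" for i
  proof -
    have "of_nat p ^ Suc n = (of_nat p ^ i * of_nat p ^ Suc (n - i) :: ('i, int) mpoly)"
      using that by (simp del: power_Suc flip: power_add)
    then show ?thesis
      using mult_dvd_mono[OF dvd_refl dvd_diff_prime_power[OF less[OF that], of "n - i"], of "of_nat p ^ i"]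
      by simp
  qed
  then have "of_nat p ^ Suc n dvd (\<Sum>i<n. of_nat (p ^ i) * (z i ^ (p ^ (n - i)) - z' i ^ (p ^ (n - i))))"
    by (auto intro: dvd_sum)
  moreover have "ghost p z n - ghost p z' n =
      (\<Sum>i<n. of_nat (p ^ i) * (z i ^ (p ^ (n - i)) - z' i ^ (p ^ (n - i)))) + of_nat (p ^ n) * (z n - z' n)"
    by (simp add: ghost_def lessThan_Suc_atMost[symmetric] right_diff_distrib sum_subtractf)
  ultimately have "of_nat p ^ Suc n dvd of_nat (p ^ n) * (z n - z' n)"
    using assms(2)[of n] by (simp only: dvd_add_right_iff)
  then obtain c where "of_nat (p ^ n) * (z n - z' n) = of_nat p ^ Suc n * c"
    by blast
  then have "of_nat (p ^ n) * (z n - z' n) = of_nat (p ^ n) * (of_nat p * c)"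
    by (simp add: mult_ac)
  then have "z n - z' n = of_nat p * c"
    by (rule int_poly_cancel) (use assms in auto)
  then show ?case
    by simp
qed

lemma ghost_surj:
  fixes w :: "nat \<Rightarrow> ('i, int) mpoly"
  assumes "prime p" "\<And>n. of_nat p ^ Suc n dvd w (Suc n) - frob_lift p (w n)"
  shows "\<exists>z. \<forall>n. ghost p z n = w n"
proof -
  have "\<exists>z. \<forall>n. of_nat (p ^ n) * z n = w n - (\<Sum>i<n. of_nat (p ^ i) * z i ^ (p ^ (n - i)))"
  proof (rule dependent_wf_choice[OF wf_less])
    fix z :: "nat \<Rightarrow> ('i, int) mpoly" and n
    assume z: "\<And>m. (m, n) \<in> {(x, y). x < y} \<Longrightarrow> of_nat (p ^ m) * z m = w m - (\<Sum>i<m. of_nat (p ^ i) * z i ^ (p ^ (m - i)))"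
    have "of_nat (p ^ n) dvd w n - (\<Sum>i<n. of_nat (p ^ i) * z i ^ (p ^ (n - i)))"
    proof (cases n)
      case (Suc m)
      have "ghost p z m = w m"
        using z[of m] Suc by (simp add: ghost_def lessThan_Suc_atMost[symmetric])
      \<comment> \<open>\<open>z (Suc m)\<close> is unconstrained at this point; its term is added
        and subtracted only to reach a full ghost component, and it is a multiple of
        \<open>p^n\<close> in any case.\<close>
      moreover have "(\<Sum>i<n. of_nat (p ^ i) * z i ^ (p ^ (n - i))) = ghost p z (Suc m) - of_nat (p ^ Suc m) * z (Suc m)"
        by (simp add: ghost_def Suc lessThan_Suc_atMost[symmetric])
      ultimately have eq: "w n - (\<Sum>i<n. of_nat (p ^ i) * z i ^ (p ^ (n - i))) =
          (w (Suc m) - frob_lift p (w m)) - (ghost p z (Suc m) - frob_lift p (ghost p z m)) + of_nat p ^ Suc m * z (Suc m)"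
        using Suc by simp
      show ?thesis
        unfolding eq unfolding Suc of_nat_power
        by (intro dvd_add dvd_diff assms ghost_Suc_dvd dvd_triv_left)
    qed simp
    then show "\<exists>r. of_nat (p ^ n) * r = w n - (\<Sum>i<n. of_nat (p ^ i) * z i ^ (p ^ (n - i)))"
      unfolding dvd_def by (elim exE, intro exI) (erule sym)
  qed simp
  then obtain z where z: "\<And>n. of_nat (p ^ n) * z n = w n - (\<Sum>i<n. of_nat (p ^ i) * z i ^ (p ^ (n - i)))"
    by blast
  have "ghost p z n = w n" for n
    using z[of n] by (simp add: ghost_def lessThan_Suc_atMost[symmetric])
  then show ?thesis
    by blast
qed

lemma ieval_ghost: "ieval (ghost p z n) x = ghost p (\<lambda>i. ieval (z i) x) n"
  by (simp add: ghost_def ieval_sum ieval_mult ieval_power flip: of_nat_power)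

lemma ghost_first: 
  assumes "p > 0"
  shows "ghost p (\<lambda>i. if i = 0 then a else 0) n = a ^ (p ^ n)"
proof -
  have "ghost p (\<lambda>i. if i = 0 then a else 0) n = (\<Sum>i\<in>{0}. of_nat (p ^ i) * (if i = 0 then a else 0) ^ (p ^ (n - i)))"
    unfolding ghost_def using assms by (intro sum.mono_neutral_right) (auto simp: power_0_left)
  then show ?thesis
    by simp
qed

lemma ghost_0 [simp]: "p > 0 \<Longrightarrow> ghost p (\<lambda>i. 0) n = 0"
  by (simp add: ghost_def power_0_left)

text \<open>The Frobenius lift is a ring homomorphism, so the sequences satisfying Dwork's
  congruences form a ring; this yields Witt sums, products and negatives.\<close>

lemma frob_lift_dvd_ops:
  fixes w w' :: "nat \<Rightarrow> ('i, int) mpoly"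
  assumes "of_nat p ^ Suc n dvd w (Suc n) - frob_lift p (w n)"
    "of_nat p ^ Suc n dvd w' (Suc n) - frob_lift p (w' n)"
  shows "of_nat p ^ Suc n dvd (w (Suc n) + w' (Suc n)) - frob_lift p (w n + w' n)"
    "of_nat p ^ Suc n dvd (w (Suc n) * w' (Suc n)) - frob_lift p (w n * w' n)"
    "of_nat p ^ Suc n dvd (- w (Suc n)) - frob_lift p (- w n)"
proof -
  show "of_nat p ^ Suc n dvd (w (Suc n) + w' (Suc n)) - frob_lift p (w n + w' n)"
    using dvd_add[OF assms] by (simp add: frob_lift_def ieval_add algebra_simps)
  show "of_nat p ^ Suc n dvd (w (Suc n) * w' (Suc n)) - frob_lift p (w n * w' n)"
    using dvd_diff_mult[OF assms] by (simp add: frob_lift_def ieval_mult)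
  have "(- w (Suc n)) - frob_lift p (- w n) = - (w (Suc n) - frob_lift p (w n))"
    by (simp add: frob_lift_def ieval_uminus)
  then show "of_nat p ^ Suc n dvd (- w (Suc n)) - frob_lift p (- w n)"
    using assms(1) by (metis dvd_minus_iff)
qed


subsection \<open>The ring of Witt vectors\<close>

definition wadd :: "nat \<Rightarrow> (nat \<Rightarrow> 'a::comm_ring_1) \<Rightarrow> (nat \<Rightarrow> 'a) \<Rightarrow> nat \<Rightarrow> 'a" where
  "wadd p x y n = ieval (witt_sum_polys p n) (case_sum x y)"

definition wmul :: "nat \<Rightarrow> (nat \<Rightarrow> 'a::comm_ring_1) \<Rightarrow> (nat \<Rightarrow> 'a) \<Rightarrow> nat \<Rightarrow> 'a" where
  "wmul p x y n = ieval (witt_prod_polys p n) (case_sum x y)"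

definition wone :: "nat \<Rightarrow> 'a::comm_ring_1" where
  "wone n = (if n = 0 then 1 else 0)"

lemma witt_eq: "witt p = \<lparr>carrier = UNIV, mult = wmul p, one = wone, zero = (\<lambda>n. 0), add = wadd p\<rparr>"
  by (auto simp: witt_def eval_poly_eq_ieval wadd_def wmul_def wone_def fun_eq_iff)

lemma ghost_witt_polys:
  assumes "prime p"
  shows "ghost p (witt_sum_polys p) n =
      ghost p (\<lambda>i. poly_var (Inl i)) n + ghost p (\<lambda>i. poly_var (Inr i)) n"
    and "ghost p (witt_prod_polys p) n =
      ghost p (\<lambda>i. poly_var (Inl i)) n * ghost p (\<lambda>i. poly_var (Inr i)) n"
proof -
  have p: "p > 0" using assms by (rule prime_gt_0_nat)
  have the: "ghost p (THE S. \<forall>n. ghost p S n = w n) n = w n" 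
    if w: "\<And>n. of_nat p ^ Suc n dvd w (Suc n) - frob_lift p (w n)" for w :: "nat \<Rightarrow> int_poly"
  proof -
    have "\<exists>!S. \<forall>n. ghost p S n = w n"
    proof (rule ex_ex1I)
      show "\<exists>S. \<forall>n. ghost p S n = w n"
        by (rule ghost_surj[OF assms w])
    qed (use ghost_inj'[OF p] in metis)
    from theI'[OF this] show ?thesis
      by blast
  qed
  show "ghost p (witt_sum_polys p) n =
      ghost p (\<lambda>i. poly_var (Inl i)) n + ghost p (\<lambda>i. poly_var (Inr i)) n"
    unfolding witt_sum_polys_def
    by (intro the frob_lift_dvd_ops(1) ghost_Suc_dvd assms)
  show "ghost p (witt_prod_polys p) n =
      ghost p (\<lambda>i. poly_var (Inl i)) n * ghost p (\<lambda>i. poly_var (Inr i)) n"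
    unfolding witt_prod_polys_def
    by (intro the frob_lift_dvd_ops(2) ghost_Suc_dvd assms)
qed

lemma ghost_wadd:
  assumes "prime p"
  shows "ghost p (wadd p x y) n = ghost p x n + ghost p y n"
proof -
  have "ghost p (wadd p x y) n = ieval (ghost p (witt_sum_polys p) n) (case_sum x y)"
    by (simp add: ieval_ghost wadd_def[abs_def])
  then show ?thesis
    by (simp add: ghost_witt_polys[OF assms] ieval_add ieval_ghost poly_var_def flip: ivar_def)
qed

lemma ghost_wmul:
  assumes "prime p"
  shows "ghost p (wmul p x y) n = ghost p x n * ghost p y n"
proof -
  have "ghost p (wmul p x y) n = ieval (ghost p (witt_prod_polys p) n) (case_sum x y)"
    by (simp add: ieval_ghost wmul_def[abs_def])
  then show ?thesis
    by (simp add: ghost_witt_polys[OF assms] ieval_mult ieval_ghost poly_var_def flip: ivar_def)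
qed

lemma ghost_wone: "p > 0 \<Longrightarrow> ghost p wone n = 1"
  using ghost_first[of p 1 n] by (simp add: wone_def[abs_def])

text \<open>Identities between Witt vectors over an arbitrary ring follow from those over a
  polynomial ring over the integers, where the ghost components determine the vector.\<close>

definition ilift :: "(nat \<Rightarrow> 'a) \<Rightarrow> nat \<Rightarrow> ('a, int) mpoly" where
  "ilift x n = ivar (x n)"

definition idown :: "(nat \<Rightarrow> ('a, int) mpoly) \<Rightarrow> nat \<Rightarrow> 'a::comm_ring_1" where
  "idown X n = ieval (X n) (\<lambda>a. a)"

lemma idown_ilift [simp]: "idown (ilift x) = x"
  by (simp add: idown_def ilift_def fun_eq_iff)

lemma idown_wadd: "idown (wadd p X Y) = wadd p (idown X) (idown Y)"
proof -
  have "(\<lambda>i. ieval (case_sum X Y i) (\<lambda>a. a)) = case_sum (idown X) (idown Y)"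
    by (auto simp: fun_eq_iff idown_def split: sum.split)
  then show ?thesis
    by (simp add: idown_def[abs_def] wadd_def[abs_def] ieval_ieval)
qed

lemma idown_wmul: "idown (wmul p X Y) = wmul p (idown X) (idown Y)"
proof -
  have "(\<lambda>i. ieval (case_sum X Y i) (\<lambda>a. a)) = case_sum (idown X) (idown Y)"
    by (auto simp: fun_eq_iff idown_def split: sum.split)
  then show ?thesis
    by (simp add: idown_def[abs_def] wmul_def[abs_def] ieval_ieval)
qed

lemma idown_wone: "idown wone = wone"
  by (auto simp: idown_def wone_def fun_eq_iff)

lemma idown_zero: "idown (\<lambda>n. 0) = (\<lambda>n. 0)"
  by (auto simp: idown_def fun_eq_iff)

context
  fixes p :: nat
  assumes p: "prime p"
begin

lemma p_pos: "p > 0"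
  using p by (rule prime_gt_0_nat)

lemmas ghost_ops = ghost_wadd[OF p] ghost_wmul[OF p] ghost_wone[OF p_pos] ghost_0[OF p_pos]

lemma
  fixes x y z :: "nat \<Rightarrow> 'a::comm_ring_1"
  shows wadd_assoc: "wadd p (wadd p x y) z = wadd p x (wadd p y z)"
    and wadd_commute: "wadd p x y = wadd p y x"
    and wadd_0: "wadd p (\<lambda>n. 0) x = x"
    and wmul_assoc: "wmul p (wmul p x y) z = wmul p x (wmul p y z)"
    and wmul_commute: "wmul p x y = wmul p y x"
    and wmul_1: "wmul p wone x = x"
    and wmul_wadd: "wmul p (wadd p x y) z = wadd p (wmul p x z) (wmul p y z)"
proof -
  note T = arg_cong[where f = idown, OF ghost_inj'[OF p_pos]]
  note D = idown_wadd idown_wmul idown_wone idown_zero idown_ilift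
  show "wadd p (wadd p x y) z = wadd p x (wadd p y z)"
    using T[of "wadd p (wadd p (ilift x) (ilift y)) (ilift z)" "wadd p (ilift x) (wadd p (ilift y) (ilift z))"]
    by (simp add: ghost_ops D add_ac)
  show "wadd p x y = wadd p y x"
    using T[of "wadd p (ilift x) (ilift y)" "wadd p (ilift y) (ilift x)"]
    by (simp add: ghost_ops D add_ac)
  show "wadd p (\<lambda>n. 0) x = x"
    using T[of "wadd p (\<lambda>n. 0) (ilift x)" "ilift x"]
    by (simp add: ghost_ops D)
  show "wmul p (wmul p x y) z = wmul p x (wmul p y z)"
    using T[of "wmul p (wmul p (ilift x) (ilift y)) (ilift z)" "wmul p (ilift x) (wmul p (ilift y) (ilift z))"]
    by (simp add: ghost_ops D mult_ac)
  show "wmul p x y = wmul p y x"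
    using T[of "wmul p (ilift x) (ilift y)" "wmul p (ilift y) (ilift x)"]
    by (simp add: ghost_ops D mult_ac)
  show "wmul p wone x = x"
    using T[of "wmul p wone (ilift x)" "ilift x"]
    by (simp add: ghost_ops D)
  show "wmul p (wadd p x y) z = wadd p (wmul p x z) (wmul p y z)"
    using T[of "wmul p (wadd p (ilift x) (ilift y)) (ilift z)" "wadd p (wmul p (ilift x) (ilift z)) (wmul p (ilift y) (ilift z))"]
    by (simp add: ghost_ops D algebra_simps)
qed

lemma wadd_inverse_ex:
  fixes x :: "nat \<Rightarrow> 'a::comm_ring_1"
  shows "\<exists>y. wadd p x y = (\<lambda>n. 0)"
proof -
  have "\<exists>Y. \<forall>n. ghost p Y n = - ghost p (ilift x) n"
    by (intro ghost_surj p frob_lift_dvd_ops(3)[where w' = "ghost p (ilift x)"] ghost_Suc_dvd)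
  then obtain Y where "\<And>n. ghost p Y n = - ghost p (ilift x) n"
    by blast
  then have "wadd p (ilift x) Y = (\<lambda>n. 0)"
    by (intro ghost_inj'[OF p_pos]) (simp add: ghost_ops)
  then have "wadd p x (idown Y) = (\<lambda>n. 0)"
    by (metis idown_wadd idown_ilift idown_zero)
  then show ?thesis
    by blast
qed

lemma cring_witt: "cring (witt p :: (nat \<Rightarrow> 'a::comm_ring_1) ring)"
proof (intro cringI abelian_groupI comm_monoidI)
  fix x :: "nat \<Rightarrow> 'a"
  show "\<exists>y\<in>carrier (witt p). y \<oplus>\<^bsub>witt p\<^esub> x = \<zero>\<^bsub>witt p\<^esub>"
    using wadd_inverse_ex[of x] by (auto simp: witt_eq wadd_commute)
qed (auto simp: witt_eq wadd_0 wmul_1 wadd_assoc wmul_assoc wmul_wadd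
    intro: wadd_commute wmul_commute)

lemma wadd_cong_less:
  fixes x y :: "nat \<Rightarrow> 'a::comm_ring_1"
  assumes "\<And>i. i \<le> n \<Longrightarrow> x i = x' i" "\<And>i. i \<le> n \<Longrightarrow> y i = y' i"
  shows "wadd p x y n = wadd p x' y' n"
proof -
  have g: "ghost p (ilift x) i = ghost p (ilift x') i" "ghost p (ilift y) i = ghost p (ilift y') i" if "i \<le> n" for i
    using assms that by (auto simp: ghost_def ilift_def)
  have "wadd p (ilift x) (ilift y) n = wadd p (ilift x') (ilift y') n"
    by (rule ghost_inj[OF p_pos]) (simp only: ghost_wadd[OF p] g)
  then have "idown (wadd p (ilift x) (ilift y)) n = idown (wadd p (ilift x') (ilift y')) n"
    by (simp add: idown_def)
  then show ?thesis
    by (simp add: idown_wadd)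
qed

lemma witt_0:
  fixes x y :: "nat \<Rightarrow> 'a::comm_ring_1"
  shows "wadd p x y 0 = x 0 + y 0" "wmul p x y 0 = x 0 * y 0"
  using ghost_wadd[OF p, of x y 0] ghost_wmul[OF p, of x y 0] by (simp_all add: ghost_def)

text \<open>The ghost components of \<open>(a, 0, 0, ...)\<close> are the powers
  \<open>a^(p^n)\<close>, which are multiplicative in \<open>a\<close>. This is the multiplicativity
  of the Teichmueller lift.\<close>

lemma wmul_first:
  fixes a b :: "'a::comm_ring_1"
  shows "wmul p (\<lambda>i. if i = 0 then a else 0) (\<lambda>i. if i = 0 then b else 0) = (\<lambda>i. if i = 0 then a * b else 0)"
proof -
  have "wmul p (\<lambda>i. if i = 0 then ivar a else 0) (\<lambda>i. if i = 0 then ivar b else 0)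
      = (\<lambda>i. if i = 0 then ivar a * ivar b else 0)"
    by (intro ghost_inj'[OF p_pos]) (simp add: ghost_ops ghost_first[OF p_pos] power_mult_distrib)
  then have "idown (wmul p (\<lambda>i. if i = 0 then ivar a else 0) (\<lambda>i. if i = 0 then ivar b else 0))
      = idown (\<lambda>i. if i = 0 then ivar a * ivar b else 0)"
    by simp
  moreover have "idown (\<lambda>i. if i = 0 then f else 0) = (\<lambda>i. if i = 0 then ieval f (\<lambda>a. a) else 0)" 
    for f :: "('a, int) mpoly"
    by (auto simp: idown_def)
  ultimately show ?thesis
    by (simp only: idown_wmul ieval_mult ieval_ivar)
qed

text \<open>The identity \<open>p = V F\<close> in characteristic \<open>p\<close>. Over the
  integers the ghost components of \<open>p X\<close> and of the shifted vector of
  \<open>p\<close>-th powers differ by \<open>p^(n+1) X_n\<close>, so the two vectors agree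
  entrywise modulo \<open>p\<close>.\<close>

lemma wadd_multiple:
  fixes x :: "nat \<Rightarrow> 'a::comm_ring_1"
  assumes "of_nat p = (0::'a)"
  shows "((wadd p x) ^^ p) (\<lambda>n. 0) = (\<lambda>n. if n = 0 then 0 else x (n - 1) ^ p)"
proof -
  define X where "X = ilift x"
  define Z where "Z = ((wadd p X) ^^ p) (\<lambda>n. 0)"
  define Y where "Y n = (if n = 0 then 0 else X (n - 1) ^ p)" for n
  have Zc: "ghost p (((wadd p X) ^^ c) (\<lambda>n. 0)) n = of_nat c * ghost p X n" for c n
    by (induction c) (simp_all add: ghost_ops algebra_simps)
  have Y: "ghost p Y n = of_nat p * (ghost p X n - of_nat (p ^ n) * X n)" for n
  proof (cases n)
    case (Suc m)
    have "ghost p Y n = (\<Sum>i\<le>m. of_nat (p ^ Suc i) * X i ^ (p * p ^ (m - i)))"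
      unfolding ghost_def Suc sum.atMost_Suc_shift using p_pos
      by (simp add: Y_def power_0_left power_mult)
    also have "\<dots> = (\<Sum>i\<le>m. of_nat p * (of_nat (p ^ i) * X i ^ (p ^ (Suc m - i))))"
      by (intro sum.cong) (simp_all add: Suc_diff_le mult_ac)
    also have "\<dots> = of_nat p * (ghost p X n - of_nat (p ^ n) * X n)"
      by (simp add: ghost_def Suc sum_distrib_left)
    finally show ?thesis .
  qed (use p_pos in \<open>simp add: ghost_def Y_def power_0_left\<close>)
  have "of_nat p dvd Z n - Y n" for n
  proof (rule ghost_dvd_imp_dvd[OF p_pos])
    fix n
    have "ghost p Z n - ghost p Y n = of_nat p ^ Suc n * X n"
      unfolding Z_def Zc Y by (simp add: algebra_simps)
    then show "of_nat p ^ Suc n dvd ghost p Z n - ghost p Y n"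
      by simp
  qed
  note dvd = this
  have "ieval (Z n) (\<lambda>a. a) = ieval (Y n) (\<lambda>a. a)" for n
  proof -
    from dvd[of n] obtain c where "Z n - Y n = of_nat p * c" ..
    then have "ieval (Z n - Y n) (\<lambda>a. a) = 0"
      by (simp add: ieval_mult assms)
    then show ?thesis
      by (simp add: ieval_minus)
  qed
  then have "idown Z = idown Y"
    by (simp add: idown_def fun_eq_iff)
  moreover have "idown (((wadd p X) ^^ c) (\<lambda>n. 0)) = ((wadd p x) ^^ c) (\<lambda>n. 0)" for c
    by (induction c) (simp_all add: idown_zero idown_wadd X_def)
  moreover have "idown Y = (\<lambda>n. if n = 0 then 0 else x (n - 1) ^ p)"
    by (auto simp: idown_def Y_def X_def ilift_def ieval_power fun_eq_iff)
  ultimately show ?thesis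
    by (simp add: Z_def)
qed

end


subsection \<open>Witt vectors of a finite field as a type\<close>

text \<open>A copy of the Witt vectors as a type, so that type class algebra, divisibility and
  polynomial mappings apply. The prime is not a parameter of the type; it is recovered as the
  characteristic of the field.\<close>

typedef 'k wv = "UNIV :: (nat \<Rightarrow> 'k) set"
  morphisms wcomp Wv ..

lemmas wv_simps [simp] = Wv_inverse[simplified] wcomp_inverse

lemma wv_eqI: "(\<And>i. wcomp a i = wcomp b i) \<Longrightarrow> a = b"
  by (simp flip: wcomp_inject add: fun_eq_iff)

lemma prime_CHAR_finite: "prime CHAR('k::{field,finite})"
  by (rule prime_CHAR_semidom) (rule finite_imp_CHAR_pos, rule finite)

instantiation wv :: ("{field,finite}") comm_ring_1
begin

definition plus_wv :: "'a wv \<Rightarrow> 'a wv \<Rightarrow> 'a wv" where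
  "plus_wv a b = Wv (wadd CHAR('a) (wcomp a) (wcomp b))"
definition times_wv :: "'a wv \<Rightarrow> 'a wv \<Rightarrow> 'a wv" where
  "times_wv a b = Wv (wmul CHAR('a) (wcomp a) (wcomp b))"
definition zero_wv :: "'a wv" where "zero_wv = Wv (\<lambda>n. 0)"
definition one_wv :: "'a wv" where "one_wv = Wv wone"
definition uminus_wv :: "'a wv \<Rightarrow> 'a wv" where
  "uminus_wv a = Wv (SOME y. wadd CHAR('a) (wcomp a) y = (\<lambda>n. 0))"
definition minus_wv :: "'a wv \<Rightarrow> 'a wv \<Rightarrow> 'a wv" where
  "minus_wv a b = a + - b"

instance
proof
  fix a b c :: "'a wv"
  note p = prime_CHAR_finite[where ?'k = 'a]
  show "a + b + c = a + (b + c)"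
    by (simp add: plus_wv_def wadd_assoc[OF p])
  show "a + b = b + a"
    by (simp add: plus_wv_def wadd_commute[OF p])
  show "0 + a = a"
    by (simp add: plus_wv_def zero_wv_def wadd_0[OF p])
  show "a * b * c = a * (b * c)"
    by (simp add: times_wv_def wmul_assoc[OF p])
  show "a * b = b * a"
    by (simp add: times_wv_def wmul_commute[OF p])
  show "1 * a = a"
    by (simp add: times_wv_def one_wv_def wmul_1[OF p])
  show "(a + b) * c = a * c + b * c"
    by (simp add: times_wv_def plus_wv_def wmul_wadd[OF p])
  have "wadd CHAR('a) (wcomp a) (SOME y. wadd CHAR('a) (wcomp a) y = (\<lambda>n. 0)) = (\<lambda>n. 0)"
    using someI_ex[OF wadd_inverse_ex[OF p, of "wcomp a"]] .
  then have "a + - a = 0"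
    by (simp add: plus_wv_def uminus_wv_def zero_wv_def)
  then show "- a + a = 0"
    by (simp add: plus_wv_def wadd_commute[OF p])
  show "a - b = a + - b"
    by (simp add: minus_wv_def)
  have "(0 :: nat \<Rightarrow> 'a) \<noteq> wone" 
    by (auto simp: wone_def fun_eq_iff intro!: exI[of _ 0])
  then show "(0 :: 'a wv) \<noteq> 1"
    by (simp add: zero_wv_def one_wv_def Wv_inject wone_def fun_eq_iff)
qed

end

definition teich :: "'k::{field,finite} \<Rightarrow> 'k wv" where
  "teich x = Wv (\<lambda>i. if i = 0 then x else 0)"

section \<open>Powers of p, units and Teichmueller lifts in W(k)\<close>

locale witt_char =
  fixes p :: nat and K :: "'k::{field,finite} itself"
  assumes p: "p = CHAR('k)"
begin

lemma prime_p: "prime p"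
  unfolding p by (rule prime_CHAR_finite)

lemma wcomp_0: "wcomp (0 :: 'k wv) i = 0"
  by (simp add: zero_wv_def)

lemma wcomp_add_0: "wcomp (a + b :: 'k wv) 0 = wcomp a 0 + wcomp b 0"
  by (simp add: plus_wv_def witt_0(1)[OF prime_CHAR_finite])

lemma wcomp_mult_0: "wcomp (a * b :: 'k wv) 0 = wcomp a 0 * wcomp b 0"
  by (simp add: times_wv_def witt_0(2)[OF prime_CHAR_finite])

lemma of_nat_p_eq_0: "of_nat p = (0 :: 'k)"
  by (simp add: p)

lemma wcomp_p_mult: "wcomp (of_nat p * a :: 'k wv) n = (if n = 0 then 0 else wcomp a (n - 1) ^ p)"
proof -
  have "wcomp (of_nat c * a) = ((wadd p (wcomp a)) ^^ c) (\<lambda>n. 0)" for c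
  proof (induction c)
    case (Suc c)
    have "of_nat (Suc c) * a = a + of_nat c * a"
      by (simp add: algebra_simps)
    then show ?case
      by (simp add: plus_wv_def Suc flip: p)
  qed (simp, simp add: zero_wv_def)
  then show ?thesis
    using wadd_multiple[OF prime_p of_nat_p_eq_0, of "wcomp a"] by simp
qed

lemma wcomp_p_power_mult:
  "wcomp (of_nat p ^ j * a :: 'k wv) n = (if n < j then 0 else wcomp a (n - j) ^ (p ^ j))"
proof (induction j arbitrary: n)
  case (Suc j)
  have "of_nat p ^ Suc j * a = of_nat p * (of_nat p ^ j * a)"
    by (simp add: mult.assoc)
  then have "wcomp (of_nat p ^ Suc j * a) n = (if n = 0 then 0 else wcomp (of_nat p ^ j * a) (n - 1) ^ p)"
    by (simp only: wcomp_p_mult)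
  also have "\<dots> = (if n < Suc j then 0 else wcomp a (n - Suc j) ^ (p ^ Suc j))"
    using prime_gt_0_nat[OF prime_p]
    by (auto simp: Suc power_0_left mult.commute[of p] simp flip: power_mult)
  finally show ?case .
qed simp

lemma power_p_inj: "inj (\<lambda>x::'k. x ^ p)"
proof (rule injI)
  fix x y :: 'k
  assume xy: "x ^ p = y ^ p"
  have "(x - y + y) ^ p - ((x - y) ^ p + y ^ p) = 0"
    using prime_dvd_add_power_diff[OF prime_p, of "x - y" y] by (simp add: of_nat_p_eq_0)
  then show "x = y"
    using xy by simp
qed

lemma power_p_power_surj: "\<exists>y::'k. y ^ (p ^ j) = x"
proof (induction j arbitrary: x)
  case (Suc j)
  have "surj (\<lambda>x::'k. x ^ p)"
    by (rule finite_UNIV_inj_surj[OF finite power_p_inj])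
  then obtain z where "x = z ^ p"
    by (rule surjE)
  moreover obtain y where "y ^ (p ^ j) = z"
    using Suc by blast
  ultimately show ?case
    by (intro exI[of _ y]) (simp add: power_mult mult.commute[of p])
qed simp

text \<open>Multiplication by \<open>p^j\<close> shifts by \<open>j\<close> places and raises the
  entries to the \<open>p^j\<close>-th power, so dividing needs \<open>p^j\<close>-th roots in
  \<open>k\<close>; these exist since \<open>k\<close> is finite.\<close>

lemma p_power_dvd_iff: "of_nat p ^ j dvd (a :: 'k wv) \<longleftrightarrow> (\<forall>i<j. wcomp a i = 0)"
proof
  assume a: "\<forall>i<j. wcomp a i = 0"
  define b where "b = Wv (\<lambda>i. SOME y. y ^ (p ^ j) = wcomp a (i + j))"
  have "wcomp b i ^ (p ^ j) = wcomp a (i + j)" for i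
    unfolding b_def using someI_ex[OF power_p_power_surj[of j "wcomp a (i + j)"]] by simp
  then have "a = of_nat p ^ j * b"
    using a by (intro wv_eqI) (simp add: wcomp_p_power_mult)
  then show "of_nat p ^ j dvd a"
    by simp
qed (auto elim!: dvdE simp: wcomp_p_power_mult)

lemma wcomp_add_cong:
  fixes a b :: "'k wv"
  assumes "\<And>i. i < j \<Longrightarrow> wcomp a i = wcomp a' i" "\<And>i. i < j \<Longrightarrow> wcomp b i = wcomp b' i" "i < j"
  shows "wcomp (a + b) i = wcomp (a' + b') i"
  using assms by (auto simp: plus_wv_def intro!: wadd_cong_less[OF prime_CHAR_finite])

text \<open>Subtraction of Witt vectors is not componentwise. Adding \<open>b\<close> back turns the
  vanishing of the first \<open>j\<close> entries of \<open>a - b\<close> into an equality of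
  entries.\<close>

lemma p_power_dvd_diff_iff:
  "of_nat p ^ j dvd a - (b :: 'k wv) \<longleftrightarrow> (\<forall>i<j. wcomp a i = wcomp b i)"
proof
  assume "of_nat p ^ j dvd a - b"
  then have "wcomp (a - b) i = wcomp 0 i" if "i < j" for i
    using that by (simp add: p_power_dvd_iff wcomp_0)
  then have "wcomp (a - b + b) i = wcomp (0 + b) i" if "i < j" for i
    using that by (intro wcomp_add_cong[of j]) auto
  then show "\<forall>i<j. wcomp a i = wcomp b i"
    by simp
next
  assume *: "\<forall>i<j. wcomp a i = wcomp b i"
  have "wcomp (a + - b) i = wcomp (b + - b) i" if "i < j" for i
    using that * by (intro wcomp_add_cong[of j]) auto
  then show "of_nat p ^ j dvd a - b"
    by (simp add: p_power_dvd_iff wcomp_0)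
qed

lemma p_dvd_diff_iff: "of_nat p dvd a - (b :: 'k wv) \<longleftrightarrow> wcomp a 0 = wcomp b 0"
  using p_power_dvd_diff_iff[of 1 a b] by simp

text \<open>W(k) has no \<open>p\<close>-torsion: the factor \<open>p^i\<close> shifts the entries
  and raises them to a power, which creates no zeros in a field.\<close>

lemma p_power_mult_cancel:
  assumes "of_nat p ^ (i + j) dvd (of_nat p ^ i * a :: 'k wv)"
  shows "of_nat p ^ j dvd a"
proof -
  have "wcomp a l = 0" if "l < j" for l
  proof -
    have "wcomp (of_nat p ^ i * a) (i + l) = 0"
      using assms that by (simp add: p_power_dvd_iff)
    then show ?thesis
      by (simp add: wcomp_p_power_mult)
  qed
  then show ?thesis
    by (simp add: p_power_dvd_iff)
qed

text \<open>The inverse is a \<open>p\<close>-adic limit: Bezout gives inverses \<open>M j\<close>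
  modulo \<open>p^j\<close>, and \<open>M i\<close>, \<open>M j\<close> agree modulo
  \<open>p^i\<close> for \<open>i \<le> j\<close>. Entry \<open>i\<close> of a Witt vector is
  determined by its class modulo \<open>p^(i+1)\<close>, so it is read off from
  \<open>M (Suc i)\<close>.\<close>

lemma wv_coprime_unit:
  assumes "coprime N p"
  shows "\<exists>y::'k wv. of_nat N * y = 1"
proof -
  have cop: "coprime (int N) (int p ^ j)" for j
    using assms by simp
  have "\<exists>M v. M * int N + v * int p ^ j = 1" for j
    using bezout_int[of "int N" "int p ^ j"] cop[of j] by (simp add: coprime_iff_gcd_eq_1)
  then obtain M v where Mv: "\<And>j. M j * int N + v j * int p ^ j = 1"
    by metis
  have M: "of_nat p ^ j dvd of_nat N * of_int (M j) - (1 :: 'k wv)" for j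
  proof -
    have "of_int (M j * int N + v j * int p ^ j) = (1 :: 'k wv)"
      by (simp only: Mv of_int_1)
    then have "of_nat N * of_int (M j) - (1 :: 'k wv) = of_nat p ^ j * (- of_int (v j))"
      by (simp add: algebra_simps)
    then show ?thesis
      by simp
  qed
  have coh: "of_nat p ^ i dvd of_int (M i) - (of_int (M j) :: 'k wv)" if "i \<le> j" for i j
  proof -
    have "int N * (M i - M j) = int p ^ i * (v j * int p ^ (j - i) - v i)"
      using Mv[of i] Mv[of j] that by (simp add: algebra_simps flip: power_add)
    then have "int p ^ i dvd int N * (M i - M j)"
      by simp
    then have "int p ^ i dvd M i - M j"
      using cop[of i] by (simp add: coprime_dvd_mult_right_iff coprime_commute)
    then obtain c where "M i - M j = int p ^ i * c" ..
    then have "of_int (M i - M j) = (of_nat p ^ i * of_int c :: 'k wv)"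
      by simp
    then show ?thesis
      by simp
  qed
  define y :: "'k wv" where "y = Wv (\<lambda>i. wcomp (of_int (M (Suc i)) :: 'k wv) i)"
  have y: "of_nat p ^ j dvd y - of_int (M j)" for j
    unfolding p_power_dvd_diff_iff
  proof (intro allI impI)
    fix i assume "i < j"
    then have "of_nat p ^ Suc i dvd of_int (M (Suc i)) - (of_int (M j) :: 'k wv)"
      by (intro coh) simp
    then show "wcomp y i = wcomp (of_int (M j) :: 'k wv) i"
      unfolding p_power_dvd_diff_iff by (simp add: y_def)
  qed
  have "of_nat p ^ j dvd of_nat N * y - 1" for j
  proof -
    have eq: "of_nat N * y - 1 = of_nat N * (y - of_int (M j)) + (of_nat N * of_int (M j) - 1)"
      by (simp add: algebra_simps)
    show ?thesis
      unfolding eq using M[of j] y[of j] by (intro dvd_add dvd_mult) auto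
  qed
  then have "wcomp (of_nat N * y - 1) i = wcomp 0 i" for i
    unfolding wcomp_0 p_power_dvd_iff by blast
  then have "of_nat N * y - 1 = 0"
    by (rule wv_eqI)
  then show ?thesis
    by (intro exI[of _ y]) simp
qed

lemma wcomp_teich_0: "wcomp (teich (x :: 'k)) 0 = x"
  by (simp add: teich_def)

lemma teich_0: "teich (0 :: 'k) = 0"
  by (simp add: teich_def zero_wv_def)

lemma teich_1: "teich (1 :: 'k) = 1"
  by (simp add: teich_def one_wv_def wone_def[abs_def])

lemma teich_mult: "teich (x * y :: 'k) = teich x * teich y"
  by (simp add: teich_def times_wv_def wmul_first[OF prime_CHAR_finite])

lemma teich_power: "teich (x ^ n :: 'k) = teich x ^ n"
  by (induction n) (simp_all add: teich_1 teich_mult)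

lemma teich_add_dvd: "of_nat p dvd teich (x + y :: 'k) - (teich x + teich y)"
  by (simp add: p_dvd_diff_iff wcomp_teich_0 wcomp_add_0)

lemma teich_mult_dvd: "of_nat p dvd teich (wcomp a 0 * y :: 'k) - a * teich y"
  by (simp add: p_dvd_diff_iff wcomp_teich_0 wcomp_mult_0)


subsection \<open>Truncated Witt vectors\<close>

lemma witt_ops:
  fixes x y :: "nat \<Rightarrow> 'k"
  shows "carrier (witt p :: (nat \<Rightarrow> 'k) ring) = UNIV"
    "wcomp a \<oplus>\<^bsub>witt p\<^esub> wcomp b = wcomp (a + b :: 'k wv)"
    "wcomp a \<otimes>\<^bsub>witt p\<^esub> wcomp b = wcomp (a * b :: 'k wv)"
    "\<zero>\<^bsub>witt p\<^esub> = wcomp (0 :: 'k wv)"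
    "\<one>\<^bsub>witt p\<^esub> = wcomp (1 :: 'k wv)"
  by (simp_all add: witt_eq plus_wv_def times_wv_def zero_wv_def one_wv_def p)

lemma witt_cring: "cring (witt p :: (nat \<Rightarrow> 'k) ring)"
  by (rule cring_witt[OF prime_p])

lemma witt_minus: "wcomp a \<ominus>\<^bsub>witt p\<^esub> wcomp b = wcomp (a - b :: 'k wv)"
proof -
  interpret cring "witt p :: (nat \<Rightarrow> 'k) ring" by (rule witt_cring)
  have "\<ominus>\<^bsub>witt p\<^esub> wcomp b = wcomp (- b)"
    by (rule minus_equality) (simp_all add: witt_ops)
  then show ?thesis
    by (simp add: a_minus_def witt_ops)
qed

lemma witt_add_pow: "add_pow (witt p) n \<one>\<^bsub>witt p\<^esub> = wcomp (of_nat n :: 'k wv)"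
proof -
  interpret cring "witt p :: (nat \<Rightarrow> 'k) ring" by (rule witt_cring)
  show ?thesis
    by (induction n) (simp_all add: witt_ops add.commute)
qed

lemma witt_ideal_ideal: "ideal (witt_ideal p j) (witt p :: (nat \<Rightarrow> 'k) ring)"
proof -
  interpret cring "witt p :: (nat \<Rightarrow> 'k) ring" by (rule witt_cring)
  show ?thesis
    unfolding witt_ideal_def by (rule cgenideal_ideal) (simp add: witt_ops)
qed

lemma wcomp_in_witt_ideal: "wcomp a \<in> witt_ideal p j \<longleftrightarrow> of_nat p ^ j dvd (a :: 'k wv)"
proof -
  have "witt_ideal p j = {x \<otimes>\<^bsub>witt p\<^esub> wcomp (of_nat (p ^ j) :: 'k wv) | x. x \<in> UNIV}"
    by (simp add: witt_ideal_def cgenideal_def witt_add_pow witt_ops(1))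
  also have "\<dots> = {wcomp (b * of_nat p ^ j :: 'k wv) | b. True}"
    by (auto simp flip: witt_ops(3)) (metis wv_simps(1))
  finally show ?thesis
    by (auto simp: wcomp_inject dvd_def mult.commute)
qed

definition wpr :: "nat \<Rightarrow> 'k wv \<Rightarrow> (nat \<Rightarrow> 'k) set" where
  "wpr j a = witt_proj p j (wcomp a)"

lemma wpr_eq_iff: "wpr j a = wpr j b \<longleftrightarrow> of_nat p ^ j dvd a - b"
proof -
  interpret cring "witt p :: (nat \<Rightarrow> 'k) ring" by (rule witt_cring)
  show ?thesis
    using quotient_eq_iff_same_a_r_cos[OF witt_ideal_ideal[of j], of "wcomp a" "wcomp b"]
    by (simp add: wpr_def witt_proj_def witt_ops witt_minus wcomp_in_witt_ideal)
qed

lemma wpr_ops: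
  "carrier (witt_quot p j) = range (wpr j)"
  "wpr j a \<oplus>\<^bsub>witt_quot p j\<^esub> wpr j b = wpr j (a + b)"
  "wpr j a \<otimes>\<^bsub>witt_quot p j\<^esub> wpr j b = wpr j (a * b)"
  "\<zero>\<^bsub>witt_quot p j\<^esub> = wpr j 0"
  "\<one>\<^bsub>witt_quot p j\<^esub> = wpr j 1"
proof -
  interpret I: ideal "witt_ideal p j" "witt p :: (nat \<Rightarrow> 'k) ring" by (rule witt_ideal_ideal)
  show "carrier (witt_quot p j) = range (wpr j)"
    by (auto simp: witt_quot_def FactRing_def A_RCOSETS_def' wpr_def witt_proj_def witt_ops)
      (metis wv_simps(1) rangeI)
  show "wpr j a \<oplus>\<^bsub>witt_quot p j\<^esub> wpr j b = wpr j (a + b)"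
    by (simp add: wpr_def witt_proj_def witt_quot_def FactRing_def I.a_rcos_sum witt_ops)
  show "wpr j a \<otimes>\<^bsub>witt_quot p j\<^esub> wpr j b = wpr j (a * b)"
    by (simp add: wpr_def witt_proj_def witt_quot_def FactRing_def I.rcoset_mult_add witt_ops)
  show "\<zero>\<^bsub>witt_quot p j\<^esub> = wpr j 0"
    by (simp add: wpr_def witt_proj_def witt_quot_def FactRing_def witt_ops(4) I.a_rcos_const wcomp_in_witt_ideal)
  show "\<one>\<^bsub>witt_quot p j\<^esub> = wpr j 1"
    by (simp add: wpr_def witt_proj_def witt_quot_def FactRing_def witt_ops)
qed

text \<open>For \<open>j > 0\<close> all representatives of a class have the same 0th entry, which
  is what gives \<open>the_elem\<close> in \<open>residue\<close> a meaning.\<close>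

lemma residue_wpr:
  assumes "j > 0"
  shows "residue (wpr j a) = wcomp a 0"
proof -
  interpret I: ideal "witt_ideal p j" "witt p :: (nat \<Rightarrow> 'k) ring" by (rule witt_ideal_ideal)
  have "(\<lambda>x. x 0) ` wpr j a = {wcomp a 0}"
  proof -
    have "x 0 = wcomp a 0" if "x \<in> wpr j a" for x
    proof -
      obtain h where "h \<in> witt_ideal p j" "x = h \<oplus>\<^bsub>witt p\<^esub> wcomp a"
        using \<open>x \<in> wpr j a\<close> by (auto simp: wpr_def witt_proj_def a_r_coset_def r_coset_def)
      then have "x = wcomp (Wv h + a)" "of_nat p ^ j dvd Wv h"
        by (simp_all flip: wcomp_in_witt_ideal witt_ops)
      then show ?thesis
        using assms by (simp add: wcomp_add_0 p_power_dvd_iff)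
    qed
    moreover have "wcomp a \<in> wpr j a"
      unfolding wpr_def witt_proj_def
      by (rule I.a_rcos_self) (simp add: witt_ops)
    ultimately show ?thesis
      by blast
  qed
  then show ?thesis
    by (simp add: residue_def)
qed

lemma teichmueller_eq: "teichmueller p j x = wpr j (teich x)"
  by (simp add: teichmueller_def wpr_def teich_def)

end


section \<open>Images of type class rings\<close>

text \<open>The records in the definitions are images of type class structures: each carrier is
  \<open>h\<close> applied to a set \<open>A\<close> closed under the operations. The laws are
  inherited along the surjection, and \<open>h\<close> may have a kernel, so that quotients are
  covered too.\<close>

locale group_image =
  fixes h :: "'t::ab_group_add \<Rightarrow> 's" and A :: "'t set" and S :: "('s, 'c) ring_scheme" (structure)
  assumes carrier_image: "carrier S = h ` A"
    and zero_mem: "0 \<in> A"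
    and add_mem: "a \<in> A \<Longrightarrow> b \<in> A \<Longrightarrow> a + b \<in> A"
    and uminus_mem: "a \<in> A \<Longrightarrow> - a \<in> A"
    and hom_zero: "\<zero> = h 0"
    and hom_add: "a \<in> A \<Longrightarrow> b \<in> A \<Longrightarrow> h a \<oplus> h b = h (a + b)"
begin

lemma abelian_group_image: "abelian_group S"
proof (rule abelian_groupI)
  fix x assume "x \<in> carrier S"
  then obtain a where "a \<in> A" "x = h a"
    by (auto simp: carrier_image)
  then show "\<exists>y\<in>carrier S. y \<oplus> x = \<zero>"
    by (auto simp: carrier_image hom_zero hom_add uminus_mem intro!: bexI[of _ "- a"])
qed (auto simp: carrier_image hom_zero hom_add zero_mem add_mem add_ac)

lemma minus_mem: "a \<in> A \<Longrightarrow> b \<in> A \<Longrightarrow> a - b \<in> A"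
  using add_mem[of a "- b"] by (simp add: uminus_mem)

lemma hom_a_inv: "a \<in> A \<Longrightarrow> \<ominus> h a = h (- a)"
proof -
  interpret abelian_group S by (rule abelian_group_image)
  show "a \<in> A \<Longrightarrow> \<ominus> h a = h (- a)"
    by (rule minus_equality) (auto simp: carrier_image hom_zero hom_add uminus_mem)
qed

lemma hom_minus: "a \<in> A \<Longrightarrow> b \<in> A \<Longrightarrow> h a \<ominus> h b = h (a - b)"
  by (simp add: a_minus_def hom_a_inv hom_add uminus_mem)

lemma sum_mem: "(\<And>x. x \<in> X \<Longrightarrow> f x \<in> A) \<Longrightarrow> (\<Sum>x\<in>X. f x) \<in> A"
  by (induction X rule: infinite_finite_induct) (auto simp: zero_mem add_mem)

lemma hom_finsum:
  assumes "finite X" "\<And>x. x \<in> X \<Longrightarrow> f x \<in> A"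
  shows "(\<Oplus>x\<in>X. h (f x)) = h (\<Sum>x\<in>X. f x)"
proof -
  interpret abelian_group S by (rule abelian_group_image)
  show ?thesis
    using assms
  proof (induction X rule: finite_induct)
    case (insert x X)
    then have "(\<Oplus>x\<in>insert x X. h (f x)) = h (f x) \<oplus> (\<Oplus>x\<in>X. h (f x))"
      by (intro finsum_insert) (auto simp: carrier_image)
    then show ?case
      using insert by (simp add: hom_add sum_mem)
  qed (simp add: hom_zero)
qed

end

locale ring_image = group_image h A S
  for h :: "'t::comm_ring_1 \<Rightarrow> 's" and A and S :: "('s, 'c) ring_scheme" (structure) +
  assumes one_mem: "1 \<in> A"
    and mult_mem: "a \<in> A \<Longrightarrow> b \<in> A \<Longrightarrow> a * b \<in> A"
    and hom_one: "\<one> = h 1"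
    and hom_mult: "a \<in> A \<Longrightarrow> b \<in> A \<Longrightarrow> h a \<otimes> h b = h (a * b)"
begin

lemma cring_image: "cring S"
  by (intro cringI abelian_group_image comm_monoidI)
    (auto simp: carrier_image hom_one hom_mult hom_add one_mem mult_mem add_mem algebra_simps)

lemma power_mem: "a \<in> A \<Longrightarrow> a ^ n \<in> A"
  by (induction n) (auto simp: one_mem mult_mem)

lemma hom_power: "a \<in> A \<Longrightarrow> h a [^] (n::nat) = h (a ^ n)"
proof -
  interpret cring S by (rule cring_image)
  show "a \<in> A \<Longrightarrow> h a [^] n = h (a ^ n)"
    by (induction n) (simp_all add: hom_one hom_mult power_mem mult.commute)
qed

lemma of_nat_mem: "of_nat n \<in> A"
  by (induction n) (auto simp: zero_mem one_mem add_mem)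

lemma hom_add_pow: "a \<in> A \<Longrightarrow> add_pow S (n::nat) (h a) = h (of_nat n * a)"
proof -
  interpret cring S by (rule cring_image)
  show "a \<in> A \<Longrightarrow> add_pow S n (h a) = h (of_nat n * a)"
    by (induction n) (simp_all add: hom_zero hom_add mult_mem of_nat_mem algebra_simps)
qed

end


section \<open>Polynomials over truncated Witt vectors\<close>

lemma lookup_mult_submultisets:
  fixes f g :: "('i, 'a::comm_ring_1) mpoly"
  shows "pm_lookup (f * g) \<mu> =
    (\<Sum>\<nu>\<in>{\<nu>. \<nu> \<subseteq># \<mu>}. pm_lookup f \<nu> * pm_lookup g (\<mu> - \<nu>))"
proof (induction f rule: poly_mapping_add_induct)
  case (single \<kappa> a)
  have "(\<Sum>\<nu>\<in>{\<nu>. \<nu> \<subseteq># \<mu>}. pm_lookup (pm_single \<kappa> a) \<nu> * pm_lookup g (\<mu> - \<nu>))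
      = (\<Sum>\<nu>\<in>{\<nu>. \<nu> \<subseteq># \<mu>}. if \<nu> = \<kappa> then a * pm_lookup g (\<mu> - \<kappa>) else 0)"
    by (intro sum.cong) (auto simp: lookup_single when_def)
  then show ?case
    by (simp add: lookup_single_mult finite_submultisets sum.delta)
qed (simp_all add: lookup_add algebra_simps sum.distrib)

definition polys :: "'i set \<Rightarrow> ('i, 'a::zero) mpoly set" where
  "polys I = {f. \<forall>\<mu>\<in>pm_keys f. set_mset \<mu> \<subseteq> I}"

lemma polys_0: "0 \<in> polys I"
  by (simp add: polys_def)

lemma polys_single: "set_mset \<mu> \<subseteq> I \<Longrightarrow> pm_single \<mu> a \<in> polys I"
  by (simp add: polys_def)

lemma polys_add: "f \<in> polys I \<Longrightarrow> g \<in> polys I \<Longrightarrow> f + g \<in> polys I"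
  using keys_add[of f g] by (auto simp: polys_def)

lemma polys_uminus: "f \<in> polys I \<Longrightarrow> - f \<in> (polys I :: ('i, 'a::ab_group_add) mpoly set)"
  by (simp add: polys_def in_keys_iff)

lemma polys_mult: "f \<in> polys I \<Longrightarrow> g \<in> polys I \<Longrightarrow> f * g \<in> (polys I :: ('i, 'a::comm_ring_1) mpoly set)"
  using keys_mult[of f g] by (force simp: polys_def)

lemma polys_1: "1 \<in> (polys I :: ('i, 'a::comm_ring_1) mpoly set)"
  by (simp add: polys_def)

lemma of_nat_dvd_poly_iff:
  fixes f :: "('i, 'a::comm_ring_1) mpoly"
  shows "of_nat c dvd f \<longleftrightarrow> (\<forall>\<mu>. of_nat c dvd pm_lookup f \<mu>)"
proof
  assume *: "\<forall>\<mu>. of_nat c dvd pm_lookup f \<mu>"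
  \<comment> \<open>Zero coefficients get the quotient 0, which gives the chosen quotients finite
    support.\<close>
  define g where "g \<mu> = (if pm_lookup f \<mu> = 0 then 0 else SOME x. pm_lookup f \<mu> = of_nat c * x)" for \<mu>
  have g: "pm_lookup f \<mu> = of_nat c * g \<mu>" for \<mu>
    using * someI_ex[of "\<lambda>x. pm_lookup f \<mu> = of_nat c * x"] by (auto simp: g_def dvd_def)
  have "finite {\<mu>. g \<mu> \<noteq> 0}"
    by (rule finite_subset[OF _ finite_keys[of f]]) (auto simp: g_def in_keys_iff)
  then have "f = of_nat c * Abs_poly_mapping g"
    by (intro poly_mapping_eqI) (simp add: of_nat_mult_lookup g)
  then show "of_nat c dvd f"
    by simp
qed (auto elim!: dvdE simp: of_nat_mult_lookup)

context witt_char
begin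

lemma ring_image_wpr: "ring_image (wpr j) (UNIV :: 'k wv set) (witt_quot p j)"
  by unfold_locales (simp_all add: wpr_ops)

definition mp :: "nat \<Rightarrow> ('i, 'k wv) mpoly \<Rightarrow> 'i multiset \<Rightarrow> (nat \<Rightarrow> 'k) set" where
  "mp j f \<mu> = wpr j (pm_lookup f \<mu>)"

lemma mp_eq_iff: "mp j f = mp j g \<longleftrightarrow> of_nat (p ^ j) dvd f - g"
  by (simp add: of_nat_dvd_poly_iff mp_def fun_eq_iff wpr_eq_iff lookup_minus del: of_nat_power)
    (simp add: of_nat_power)

text \<open>Coefficients that vanish are lifted to 0, so the lift has no monomials beyond those of
  \<open>F\<close>. This keeps homogeneous polynomials homogeneous.\<close>

lemma mp_lift:
  assumes "F \<in> carrier (mpoly_ring (witt_quot p j) I)"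
  shows "\<exists>f\<in>polys I. mp j f = F \<and> (\<forall>\<mu>\<in>pm_keys f. F \<mu> \<noteq> \<zero>\<^bsub>witt_quot p j\<^esub>)"
proof -
  define g where "g \<mu> = (if F \<mu> = wpr j 0 then 0 else SOME a. wpr j a = F \<mu>)" for \<mu>
  have F: "F \<mu> \<in> range (wpr j)" for \<mu>
    using assms by (auto simp: mpoly_ring_def wpr_ops)
  have g: "wpr j (g \<mu>) = F \<mu>" for \<mu>
    using F[of \<mu>] someI_ex[of "\<lambda>a. wpr j a = F \<mu>"] by (auto simp: g_def)
  have "finite {\<mu>. g \<mu> \<noteq> 0}"
    by (rule finite_subset[of _ "{\<mu>. F \<mu> \<noteq> wpr j 0}"]) (use assms in \<open>auto simp: g_def mpoly_ring_def wpr_ops\<close>)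
  then have look: "pm_lookup (Abs_poly_mapping g) = g"
    by simp
  have nz: "F \<mu> \<noteq> wpr j 0" if "\<mu> \<in> pm_keys (Abs_poly_mapping g)" for \<mu>
    using that by (auto simp: in_keys_iff look) (auto simp: g_def)
  then have "Abs_poly_mapping g \<in> polys I"
    using assms by (auto simp: polys_def mpoly_ring_def wpr_ops)
  then show ?thesis
    using nz by (intro bexI[of _ "Abs_poly_mapping g"]) (auto simp: mp_def look g wpr_ops)
qed

lemma ring_image_mp: "ring_image (mp j) (polys I) (mpoly_ring (witt_quot p j) I)"
proof -
  interpret R: ring_image "wpr j" UNIV "witt_quot p j" by (rule ring_image_wpr)
  have closed: "mp j f \<in> carrier (mpoly_ring (witt_quot p j) I)" if "f \<in> polys I" for f
  proof -
    have "finite {\<mu>. wpr j (pm_lookup f \<mu>) \<noteq> wpr j 0}"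
      by (rule finite_subset[OF _ finite_keys[of f]]) (auto simp: in_keys_iff)
    then show ?thesis
      using that by (force simp: mpoly_ring_def mp_def wpr_ops polys_def in_keys_iff)
  qed
  show ?thesis
  proof
    show "carrier (mpoly_ring (witt_quot p j) I) = mp j ` polys I"
      using mp_lift[of _ j I] closed by blast
    fix f g :: "('a, 'k wv) mpoly"
    show "mp j f \<otimes>\<^bsub>mpoly_ring (witt_quot p j) I\<^esub> mp j g = mp j (f * g)"
      by (simp add: mpoly_ring_def mp_def wpr_ops R.hom_finsum finite_submultisets
          lookup_mult_submultisets fun_eq_iff)
  qed (auto simp: polys_0 polys_add polys_uminus polys_1 polys_mult mpoly_ring_def mp_def wpr_ops
      lookup_add lookup_one when_def fun_eq_iff)
qed

lemma mpoly_monom_eq: "mpoly_monom (witt_quot p j) \<nu> = mp j (pm_single \<nu> 1)"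
  by (auto simp: mpoly_monom_def mp_def wpr_ops lookup_single when_def fun_eq_iff)

lemma mpoly_const_eq: "mpoly_const (witt_quot p j) (wpr j a) = mp j (pm_single 0 a)"
  by (auto simp: mpoly_const_def mp_def wpr_ops lookup_single when_def fun_eq_iff)

end


section \<open>Divided powers of modules over truncated Witt vectors\<close>

lemma Collect_image1:
  "(\<And>x. P x \<Longrightarrow> F x = h (G x)) \<Longrightarrow> {F x |x. P x} = h ` {G x |x. P x}"
  by (auto simp: image_def) metis+

lemma Collect_image2:
  "(\<And>x y z. P x y \<Longrightarrow> F x y z = h (G x y z)) \<Longrightarrow> {F x y z |x y z. P x y} = h ` {G x y z |x y z. P x y}"
  by (auto simp: image_def) metis+

lemma Collect_image3:
  "(\<And>x y z. P y \<Longrightarrow> F (c x) y z = h (G x y z)) \<Longrightarrow>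
    {F x y z |x y z. x \<in> range c \<and> P y} = h ` {G x y z |x y z. P y}"
  by (auto simp: image_def) metis+

definition dvar :: "'m \<Rightarrow> nat \<Rightarrow> ('m \<times> nat, 'k::{field,finite} wv) mpoly" where
  "dvar x i = pm_single {#(x, i)#} 1"

definition mdeg :: "('m \<times> nat) multiset \<Rightarrow> nat" where
  "mdeg \<mu> = sum_mset (image_mset snd \<mu>)"

locale dp_module = witt_char p K
  for p :: nat and K :: "'k::{field,finite} itself" +
  fixes j :: nat and M :: "((nat \<Rightarrow> 'k) set, 'm, 'c) module_scheme"
  assumes M_add: "x \<in> carrier M \<Longrightarrow> y \<in> carrier M \<Longrightarrow> x \<oplus>\<^bsub>M\<^esub> y \<in> carrier M"
    and M_smult: "x \<in> carrier M \<Longrightarrow> wpr j a \<odot>\<^bsub>M\<^esub> x \<in> carrier M"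
begin

abbreviation "R \<equiv> witt_quot p j"
abbreviation "D \<equiv> (polys (carrier M \<times> UNIV) :: ('m \<times> nat, 'k wv) mpoly set)"

text \<open>Roby's relations with coefficients lifted to W(k), so that vanishing on the ideal can be
  tested by divisibility by \<open>p^j\<close>.\<close>

definition drels :: "('m \<times> nat, 'k wv) mpoly set" where
  "drels =
     {dvar x 0 - 1 | x. x \<in> carrier M} \<union>
     {dvar (wpr j a \<odot>\<^bsub>M\<^esub> x) i - pm_single 0 (a ^ i) * dvar x i | a x i. x \<in> carrier M} \<union>
     {dvar x i * dvar x l - of_nat ((i + l) choose i) * dvar x (i + l) | x i l. x \<in> carrier M} \<union>
     {dvar (x \<oplus>\<^bsub>M\<^esub> y) i - (\<Sum>l\<in>{..i}. dvar x l * dvar y (i - l)) | x y i. x \<in> carrier M \<and> y \<in> carrier M}"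

sublocale P: ring_image "mp j" D "dp_polys R M"
  unfolding dp_polys_def by (rule ring_image_mp)

sublocale R: ring_image "wpr j" UNIV R
  by (rule ring_image_wpr)

lemma dvar_mem: "x \<in> carrier M \<Longrightarrow> dvar x i \<in> D"
  by (simp add: dvar_def polys_single)

lemma const_mem: "pm_single 0 a \<in> D"
  by (simp add: polys_single)

lemma drels_mem: "drels \<subseteq> D"
  unfolding drels_def
  by (auto intro!: P.minus_mem P.mult_mem P.sum_mem dvar_mem const_mem P.of_nat_mem P.one_mem M_add M_smult)

lemma dp_var_eq: "dp_var R x i = mp j (dvar x i)"
  by (simp add: dp_var_def mpoly_monom_eq dvar_def)

lemma dp_relations_eq: "dp_relations R M = mp j ` drels"
proof -
  let ?P = "dp_polys R M"
  have 1: "dp_var R x 0 \<ominus>\<^bsub>?P\<^esub> \<one>\<^bsub>?P\<^esub> = mp j (dvar x 0 - 1)" if "x \<in> carrier M" for x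
    using that by (simp add: dp_var_eq P.hom_one P.hom_minus dvar_mem P.one_mem)
  have 2: "dp_var R (wpr j a \<odot>\<^bsub>M\<^esub> x) i \<ominus>\<^bsub>?P\<^esub> mpoly_const R (wpr j a [^]\<^bsub>R\<^esub> i) \<otimes>\<^bsub>?P\<^esub> dp_var R x i
     = mp j (dvar (wpr j a \<odot>\<^bsub>M\<^esub> x) i - pm_single 0 (a ^ i) * dvar x i)" if "x \<in> carrier M" for a x i
    using that by (simp add: dp_var_eq R.hom_power mpoly_const_eq P.hom_mult P.hom_minus dvar_mem M_smult const_mem P.mult_mem)
  have 3: "dp_var R x i \<otimes>\<^bsub>?P\<^esub> dp_var R x l \<ominus>\<^bsub>?P\<^esub> add_pow ?P ((i + l) choose i) (dp_var R x (i + l))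
     = mp j (dvar x i * dvar x l - of_nat ((i + l) choose i) * dvar x (i + l))" if "x \<in> carrier M" for x i l
    using that by (simp add: dp_var_eq P.hom_mult P.hom_add_pow P.hom_minus dvar_mem P.mult_mem P.of_nat_mem)
  have 4: "dp_var R (x \<oplus>\<^bsub>M\<^esub> y) i \<ominus>\<^bsub>?P\<^esub> (\<Oplus>\<^bsub>?P\<^esub>l\<in>{..i}. dp_var R x l \<otimes>\<^bsub>?P\<^esub> dp_var R y (i - l))
     = mp j (dvar (x \<oplus>\<^bsub>M\<^esub> y) i - (\<Sum>l\<in>{..i}. dvar x l * dvar y (i - l)))"
    if "x \<in> carrier M" "y \<in> carrier M" for x y i
    using that by (simp add: dp_var_eq P.hom_mult P.hom_finsum P.hom_minus dvar_mem P.mult_mem P.sum_mem M_add)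
  show ?thesis
    unfolding dp_relations_def Let_def drels_def image_Un
  proof (intro arg_cong2[where f = "(\<union>)"])
    show "{dp_var R x 0 \<ominus>\<^bsub>?P\<^esub> \<one>\<^bsub>?P\<^esub> |x. x \<in> carrier M} = mp j ` {dvar x 0 - 1 |x. x \<in> carrier M}"
      by (rule Collect_image1) (rule 1)
    show "{dp_var R (a \<odot>\<^bsub>M\<^esub> x) i \<ominus>\<^bsub>?P\<^esub> mpoly_const R (a [^]\<^bsub>R\<^esub> i) \<otimes>\<^bsub>?P\<^esub> dp_var R x i |a x i.
        a \<in> carrier R \<and> x \<in> carrier M}
      = mp j ` {dvar (wpr j a \<odot>\<^bsub>M\<^esub> x) i - pm_single 0 (a ^ i) * dvar x i |a x i. x \<in> carrier M}"
      unfolding wpr_ops by (rule Collect_image3) (rule 2)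
    show "{dp_var R x i \<otimes>\<^bsub>?P\<^esub> dp_var R x l \<ominus>\<^bsub>?P\<^esub> add_pow ?P ((i + l) choose i) (dp_var R x (i + l)) |x i l.
        x \<in> carrier M}
      = mp j ` {dvar x i * dvar x l - of_nat ((i + l) choose i) * dvar x (i + l) |x i l. x \<in> carrier M}"
      by (rule Collect_image2) (rule 3)
    show "{dp_var R (x \<oplus>\<^bsub>M\<^esub> y) i \<ominus>\<^bsub>?P\<^esub> (\<Oplus>\<^bsub>?P\<^esub>l\<in>{..i}. dp_var R x l \<otimes>\<^bsub>?P\<^esub> dp_var R y (i - l)) |x y i.
        x \<in> carrier M \<and> y \<in> carrier M}
      = mp j ` {dvar (x \<oplus>\<^bsub>M\<^esub> y) i - (\<Sum>l\<in>{..i}. dvar x l * dvar y (i - l)) |x y i. x \<in> carrier M \<and> y \<in> carrier M}"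
      by (rule Collect_image2) (use 4 in blast)
  qed
qed

lemma dp_ideal_ideal: "ideal (dp_ideal R M) (dp_polys R M)"
proof -
  interpret cring "dp_polys R M" by (rule P.cring_image)
  show ?thesis
    unfolding dp_ideal_def
    by (rule genideal_ideal) (use drels_mem in \<open>auto simp: dp_relations_eq P.carrier_image\<close>)
qed

text \<open>The polynomials all of whose multiples are sent by \<open>\<Lambda>\<close> to multiples
  of \<open>p^j\<close> form an ideal containing the relations, hence all of
  \<open>dp_ideal\<close>. Taking all multiples builds in closure under products, as
  \<open>\<Lambda>\<close> is only additive; by additivity it also preserves multiples of
  \<open>p^j\<close>, so the choice of lifts does not matter.\<close>

lemma dp_ideal_dvd:
  fixes \<Lambda> :: "('m \<times> nat, 'k wv) mpoly \<Rightarrow> 'a::comm_ring_1"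
  assumes add: "\<And>f g. \<Lambda> (f + g) = \<Lambda> f + \<Lambda> g"
    and rel: "\<And>f r. f \<in> D \<Longrightarrow> r \<in> drels \<Longrightarrow> of_nat (p ^ j) dvd \<Lambda> (f * r)"
    and f: "f \<in> D" "mp j f \<in> dp_ideal R M"
  shows "of_nat (p ^ j) dvd \<Lambda> f"
proof -
  interpret C: cring "dp_polys R M" by (rule P.cring_image)
  have \<Lambda>0: "\<Lambda> 0 = 0"
    using add[of 0 0] by simp
  have \<Lambda>minus: "\<Lambda> (- f) = - \<Lambda> f" for f
    using add[of f "- f"] \<Lambda>0 by (simp add: eq_neg_iff_add_eq_0 add.commute)
  have \<Lambda>mult: "\<Lambda> (of_nat c * f) = of_nat c * \<Lambda> f" for c f
    by (induction c) (simp_all add: \<Lambda>0 add algebra_simps)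
  have \<Lambda>cong: "of_nat (p ^ j) dvd \<Lambda> g" if "mp j f = mp j g" "of_nat (p ^ j) dvd \<Lambda> f" for f g
  proof -
    have "of_nat (p ^ j) dvd g - f"
      using that(1) by (simp only: mp_eq_iff[symmetric])
    then obtain h where "g - f = of_nat (p ^ j) * h" ..
    then have "g = of_nat (p ^ j) * h + f"
      by (simp add: algebra_simps)
    then have "\<Lambda> g = of_nat (p ^ j) * \<Lambda> h + \<Lambda> f"
      by (simp only: add \<Lambda>mult)
    then show ?thesis
      using that(2) by (simp del: of_nat_power)
  qed
  define J where "J = {f \<in> D. \<forall>g\<in>D. of_nat (p ^ j) dvd \<Lambda> (g * f)}"
  have "ideal (mp j ` J) (dp_polys R M)"
  proof (rule idealI)
    show "subgroup (mp j ` J) (add_monoid (dp_polys R M))"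
    proof
      fix x assume "x \<in> mp j ` J"
      then obtain f where f: "f \<in> J" "x = mp j f" by blast
      then have "\<ominus>\<^bsub>dp_polys R M\<^esub> x = mp j (- f)" "- f \<in> J"
        by (auto simp: J_def P.hom_a_inv P.uminus_mem \<Lambda>minus)
      then show "inv\<^bsub>add_monoid (dp_polys R M)\<^esub> x \<in> mp j ` J"
        by (auto simp: a_inv_def)
    next
      fix x y assume "x \<in> mp j ` J" "y \<in> mp j ` J"
      then show "x \<otimes>\<^bsub>add_monoid (dp_polys R M)\<^esub> y \<in> mp j ` J"
        by (auto simp: J_def P.hom_add P.add_mem distrib_left add intro!: imageI)
    qed (auto simp: J_def P.carrier_image P.hom_zero P.zero_mem \<Lambda>0)
  next
    fix a x assume ax: "a \<in> mp j ` J" "x \<in> carrier (dp_polys R M)"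
    then obtain f g where fg: "f \<in> J" "g \<in> D" "a = mp j f" "x = mp j g"
      by (auto simp: P.carrier_image)
    then have "f * g \<in> J"
      by (auto simp: J_def P.mult_mem mult.commute[of f] simp flip: mult.assoc)
    moreover have "x \<otimes>\<^bsub>dp_polys R M\<^esub> a = mp j (f * g)" "a \<otimes>\<^bsub>dp_polys R M\<^esub> x = mp j (f * g)"
      using fg by (auto simp: J_def P.hom_mult mult.commute)
    ultimately show "x \<otimes>\<^bsub>dp_polys R M\<^esub> a \<in> mp j ` J" "a \<otimes>\<^bsub>dp_polys R M\<^esub> x \<in> mp j ` J"
      by auto
  qed (rule C.ring_axioms)
  moreover have "dp_relations R M \<subseteq> mp j ` J"
    using drels_mem rel unfolding dp_relations_eq J_def by auto
  ultimately have "dp_ideal R M \<subseteq> mp j ` J"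
    unfolding dp_ideal_def by (rule C.genideal_minimal)
  then obtain f' where "f' \<in> J" "mp j f' = mp j f"
    using f by (metis imageE subsetD)
  moreover from this have "of_nat (p ^ j) dvd \<Lambda> (1 * f')"
    unfolding J_def using P.one_mem by blast
  ultimately show ?thesis
    using \<Lambda>cong[of f' f] by simp
qed

definition cls :: "('m \<times> nat, 'k wv) mpoly \<Rightarrow> (('m \<times> nat) multiset \<Rightarrow> (nat \<Rightarrow> 'k) set) set" where
  "cls f = dp_class R M (mp j f)"

lemma cls_eq_iff: "f \<in> D \<Longrightarrow> g \<in> D \<Longrightarrow> cls f = cls g \<longleftrightarrow> mp j (f - g) \<in> dp_ideal R M"
proof -
  interpret C: cring "dp_polys R M" by (rule P.cring_image)
  assume "f \<in> D" "g \<in> D"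
  then show ?thesis
    using C.quotient_eq_iff_same_a_r_cos[OF dp_ideal_ideal, of "mp j f" "mp j g"]
    by (simp add: cls_def dp_class_def P.carrier_image P.hom_minus)
qed

sublocale A: ring_image cls D "dp_algebra R M"
proof -
  interpret C: cring "dp_polys R M" by (rule P.cring_image)
  interpret I: ideal "dp_ideal R M" "dp_polys R M" by (rule dp_ideal_ideal)
  show "ring_image cls D (dp_algebra R M)"
  proof
    show "carrier (dp_algebra R M) = cls ` D"
      by (auto simp: dp_algebra_def FactRing_def A_RCOSETS_def' P.carrier_image cls_def dp_class_def)
    show "\<zero>\<^bsub>dp_algebra R M\<^esub> = cls 0"
      using I.a_rcos_const[OF I.zero_closed]
      by (simp add: dp_algebra_def FactRing_def cls_def dp_class_def P.hom_zero)
  qed (auto simp: dp_algebra_def FactRing_def cls_def dp_class_def P.carrier_image P.hom_one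
      P.zero_mem P.add_mem P.uminus_mem P.one_mem P.mult_mem I.a_rcos_sum I.rcoset_mult_add P.hom_add P.hom_mult)
qed

definition hom_polys :: "nat \<Rightarrow> ('m \<times> nat, 'k wv) mpoly set" where
  "hom_polys d = {f \<in> D. \<forall>\<mu>\<in>pm_keys f. mdeg \<mu> = d}"

lemma hom_polys_D: "f \<in> hom_polys d \<Longrightarrow> f \<in> D"
  by (simp add: hom_polys_def)

lemma hom_polys_const_mult: 
  assumes "f \<in> hom_polys d" 
  shows "pm_single 0 a * f \<in> hom_polys d"
proof -
  have "pm_keys (pm_single 0 a * f) \<subseteq> pm_keys f"
    by (auto simp: in_keys_iff lookup_const_mult)
  then show ?thesis
    using assms by (auto simp: hom_polys_def intro!: P.mult_mem const_mem)
qed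

sublocale H: group_image cls "hom_polys d" "dp_part R M d"
proof
  show "carrier (dp_part R M d) = cls ` hom_polys d"
  proof (intro equalityI subsetI)
    fix C assume "C \<in> carrier (dp_part R M d)"
    then obtain F where F: "F \<in> carrier (dp_polys R M)" "C = dp_class R M F"
      "\<forall>\<mu>. F \<mu> \<noteq> \<zero>\<^bsub>R\<^esub> \<longrightarrow> mdeg \<mu> = d"
      by (auto simp: dp_part_def mdeg_def)
    then obtain f where "f \<in> D" "mp j f = F" "\<forall>\<mu>\<in>pm_keys f. F \<mu> \<noteq> \<zero>\<^bsub>R\<^esub>"
      using mp_lift[of F j "carrier M \<times> UNIV"] by (auto simp: dp_polys_def)
    then show "C \<in> cls ` hom_polys d"
      using F by (auto simp: cls_def hom_polys_def)
  next
    fix C assume "C \<in> cls ` hom_polys d"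
    then obtain f where f: "f \<in> hom_polys d" "C = cls f"
      by blast
    have "mdeg \<mu> = d" if "mp j f \<mu> \<noteq> wpr j 0" for \<mu>
      using f that by (cases "\<mu> \<in> pm_keys f") (auto simp: hom_polys_def mp_def in_keys_iff)
    then show "C \<in> carrier (dp_part R M d)"
      using f by (auto simp: dp_part_def cls_def P.carrier_image hom_polys_D wpr_ops mdeg_def intro!: imageI)
  qed
  fix f g assume fg: "f \<in> hom_polys d" "g \<in> hom_polys d"
  then show "f + g \<in> hom_polys d"
    using keys_add[of f g] by (auto simp: hom_polys_def intro: P.add_mem)
  show "cls f \<oplus>\<^bsub>dp_part R M d\<^esub> cls g = cls (f + g)"
    using fg by (simp add: dp_part_def A.hom_add hom_polys_D)
qed (auto simp: dp_part_def A.hom_zero hom_polys_def P.zero_mem P.uminus_mem in_keys_iff)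

lemma dp_part_smult: "f \<in> hom_polys d \<Longrightarrow> wpr j a \<odot>\<^bsub>dp_part R M d\<^esub> cls f = cls (pm_single 0 a * f)"
  using A.hom_mult[of "pm_single 0 a" f]
  by (simp add: dp_part_def mpoly_const_eq const_mem hom_polys_D flip: cls_def)

lemma dp_monom_eq: "dp_monom R M xs = cls (pm_single (mset xs) 1)"
  by (simp add: dp_monom_def mpoly_monom_eq cls_def)

end


section \<open>Multinomial coefficients\<close>

definition mnom :: "nat multiset \<Rightarrow> nat" where
  "mnom A = fact (sum_mset A) div prod_mset (image_mset fact A)"

lemma prod_fact_dvd: "prod_mset (image_mset fact A) dvd (fact (sum_mset A) :: nat)"
proof (induction A)
  case (add a A)
  have "fact a * fact (sum_mset A) dvd (fact (a + sum_mset A) :: nat)"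
    by (rule fact_fact_dvd_fact)
  then show ?case
    using mult_dvd_mono[OF dvd_refl add, of "fact a"] by (auto intro: dvd_trans)
qed simp

lemma mnom_mult_prod_fact: "mnom A * prod_mset (image_mset fact A) = fact (sum_mset A)"
  unfolding mnom_def using prod_fact_dvd by (rule dvd_div_mult_self)

lemma mnom_empty [simp]: "mnom {#} = 1"
  by (simp add: mnom_def)

lemma mnom_pos: "mnom A > 0"
  using mnom_mult_prod_fact[of A] by (metis fact_nonzero mult_is_0 neq0_conv)

lemma mnom_add: "mnom (add_mset a A) = ((a + sum_mset A) choose a) * mnom A"
proof -
  let ?F = "prod_mset (image_mset fact (add_mset a A)) :: nat"
  have "mnom (add_mset a A) * ?F = fact (a + sum_mset A)"
    using mnom_mult_prod_fact[of "add_mset a A"] by simp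
  also have "\<dots> = ((a + sum_mset A) choose a) * (fact a * fact (sum_mset A))"
    using binomial_fact_lemma[of a "a + sum_mset A"] by (simp add: mult_ac)
  also have "\<dots> = ((a + sum_mset A) choose a) * mnom A * ?F"
    by (simp add: mnom_mult_prod_fact[of A, symmetric] mult_ac)
  finally show ?thesis
    by (auto simp: image_iff)
qed

lemma mnom_split: "mnom (add_mset i (add_mset l A)) = ((i + l) choose i) * mnom (add_mset (i + l) A)"
  using choose_mult[of i "i + l" "i + l + sum_mset A"] by (simp add: mnom_add add.assoc mult_ac)

text \<open>From \<open>i (p^n choose i) = p^n (p^n - 1 choose i - 1)\<close>, cancelling the part
  of \<open>i\<close> prime to \<open>p\<close>. The multiplied form avoids the truncated
  subtraction \<open>n - multiplicity p i\<close>.\<close>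

lemma prime_power_dvd_choose:
  assumes "prime p" "i > 0"
  shows "p ^ n dvd p ^ multiplicity p i * (p ^ n choose i)"
proof -
  obtain i' where i': "i = p ^ multiplicity p i * i'" "\<not> p dvd i'"
    using multiplicity_decompose'[of i p] assms by (metis not_prime_unit not_gr0)
  have "i * (p ^ n choose i) = p ^ n * ((p ^ n - 1) choose (i - 1))"
    using assms(2) by (rule times_binomial_minus1_eq)
  then have "p ^ n dvd i * (p ^ n choose i)"
    by simp
  also have "i * (p ^ n choose i) = i' * (p ^ multiplicity p i * (p ^ n choose i))"
    by (subst i'(1)) (simp only: mult_ac)
  finally have "p ^ n dvd i' * (p ^ multiplicity p i * (p ^ n choose i))" .
  moreover have "coprime (p ^ n) i'"
    using i'(2) assms by (simp add: prime_imp_coprime)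
  ultimately show ?thesis
    by (simp only: coprime_dvd_mult_right_iff)
qed

text \<open>With \<open>e\<close> the valuation of \<open>i\<close>, the binomial coefficient
  carries at least \<open>n - e\<close> factors \<open>p\<close> and the difference of powers
  \<open>e + 1\<close>, together \<open>n + 1\<close>. For \<open>i = 0\<close> the difference is
  0.\<close>

lemma dvd_choose_mult_power_diff:
  fixes u w :: "'a::comm_ring_1"
  assumes "prime p" "of_nat p dvd u - w"
  shows "of_nat (p ^ Suc n) dvd of_nat (p ^ n choose i) * (u ^ i - w ^ i)"
proof (cases "i = 0")
  case False
  obtain z where z: "u ^ i - w ^ i = of_nat p ^ Suc (multiplicity p i) * z"
    using dvd_diff_power_multiplicity[OF assms(2)] by (rule dvdE)
  obtain y where y: "p ^ multiplicity p i * (p ^ n choose i) = p ^ n * y"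
    using prime_power_dvd_choose[OF assms(1), of i n] False by (auto elim: dvdE)
  have "of_nat (p ^ n choose i) * (u ^ i - w ^ i) = of_nat (p * (p ^ multiplicity p i * (p ^ n choose i))) * z"
    by (simp add: z mult_ac)
  also have "\<dots> = of_nat (p * (p ^ n * y)) * z"
    by (simp only: y)
  also have "\<dots> = of_nat (p ^ Suc n) * (of_nat y * z)"
    by (simp add: mult_ac)
  finally show ?thesis
    by (simp del: of_nat_power of_nat_mult)
qed simp


section \<open>Coefficients of powers of generic forms\<close>

lemma polys_power: "f \<in> polys I \<Longrightarrow> f ^ n \<in> (polys I :: ('i, 'a::comm_ring_1) mpoly set)"
  by (induction n) (auto simp: polys_1 polys_mult)

lemma polys_sum: "(\<And>x. x \<in> X \<Longrightarrow> f x \<in> polys I) \<Longrightarrow>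
    (\<Sum>x\<in>X. f x) \<in> (polys I :: ('i, 'a::comm_ring_1) mpoly set)"
  by (induction X rule: infinite_finite_induct) (auto simp: polys_0 polys_add)

lemma polys_mono: "f \<in> polys I \<Longrightarrow> I \<subseteq> J \<Longrightarrow> f \<in> polys J"
  by (auto simp: polys_def)

lemma single_power:
  "pm_single {#x#} (1::'a::comm_ring_1) ^ k = pm_single (replicate_mset k x) 1"
  by (induction k) (simp_all add: mult_single)

lemma lookup_var_power_mult:
  fixes g :: "('i, 'a::comm_ring_1) mpoly"
  assumes g: "g \<in> polys (- {x})" and x: "x \<notin># \<tau>"
  shows "pm_lookup (pm_single {#x#} 1 ^ k * g) (replicate_mset a x + \<tau>)
    = (if k = a then pm_lookup g \<tau> else 0)"
proof -
  have "pm_lookup g (replicate_mset a x + \<tau> - replicate_mset k x) = 0" if "k < a"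
  proof -
    have "count (replicate_mset a x + \<tau> - replicate_mset k x) x > 0"
      using that by simp
    then have "x \<in># replicate_mset a x + \<tau> - replicate_mset k x"
      by (simp only: count_greater_zero_iff)
    then show ?thesis
      using g unfolding polys_def by (auto simp: in_keys_iff)
  qed
  moreover have "replicate_mset k x \<subseteq># replicate_mset a x + \<tau> \<longleftrightarrow> k \<le> a"
  proof
    assume "replicate_mset k x \<subseteq># replicate_mset a x + \<tau>"
    from mset_subset_eq_count[OF this, of x] show "k \<le> a"
      using x by (simp add: not_in_iff)
  next
    assume "k \<le> a"
    then have "replicate_mset k x \<subseteq># replicate_mset a x"
      by (simp add: subseteq_mset_def)
    then show "replicate_mset k x \<subseteq># replicate_mset a x + \<tau>"
      by (rule subset_mset.order_trans) simp
  qed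
  ultimately show ?thesis
    by (auto simp: single_power lookup_single_mult not_le)
qed

text \<open>The multinomial theorem for one coefficient, splitting off the last variable by the
  binomial theorem. \<open>Q\<close> collects the powers of \<open>Y\<close> already extracted. The
  variables \<open>\<sigma> i\<close> occur neither in \<open>Y\<close> nor in \<open>Q\<close> nor
  in \<open>\<tau>\<close>, so only the summand with \<open>k = a l\<close> survives.\<close>

lemma lookup_power_linear_form:
  fixes Y :: "nat \<Rightarrow> ('i, 'a::comm_ring_1) mpoly"
  assumes \<sigma>: "inj \<sigma>" and Y: "\<And>i. Y i \<in> polys (- range \<sigma>)"
    and \<tau>: "set_mset \<tau> \<inter> range \<sigma> = {}"
    and "Q \<in> polys (- range \<sigma>)" "(\<Sum>i<l. a i) = e"
  shows "pm_lookup (Q * (\<Sum>i<l. pm_single {#\<sigma> i#} 1 * Y i) ^ e)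
      ((\<Sum>i<l. replicate_mset (a i) (\<sigma> i)) + \<tau>) =
    of_nat (mnom (image_mset a (mset_set {..<l}))) * pm_lookup (Q * (\<Prod>i<l. Y i ^ a i)) \<tau>"
  using assms(4,5)
proof (induction l arbitrary: Q e)
  case (Suc l)
  define Z where "Z = (\<Sum>i<l. pm_single {#\<sigma> i#} 1 * Y i)"
  define s :: "('i, 'a) mpoly" where "s = pm_single {#\<sigma> l#} 1"
  define A where "A = (\<Sum>i<l. replicate_mset (a i) (\<sigma> i)) + \<tau>"
  have sub: "polys (- range \<sigma>) \<subseteq> (polys (- {\<sigma> l}) :: ('i, 'a) mpoly set)"
    by (auto intro: polys_mono)
  have "pm_single {#\<sigma> i#} 1 \<in> (polys (- {\<sigma> l}) :: ('i, 'a) mpoly set)" if "i < l" for i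
    using that \<sigma> by (intro polys_single) (auto dest: injD)
  then have Z: "Z \<in> polys (- {\<sigma> l})"
    unfolding Z_def using Y sub by (intro polys_sum polys_mult) auto
  have "\<sigma> l \<notin># (\<Sum>i<l. replicate_mset (a i) (\<sigma> i))"
    using \<sigma> by (auto simp: set_mset_sum dest!: injD split: if_splits)
  then have A: "\<sigma> l \<notin># A"
    using \<tau> by (auto simp: A_def)
  have el: "e - a l = (\<Sum>i<l. a i)" "a l \<le> e" 
    using Suc.prems by auto
  have "Q * (s * Y l + Z) ^ e = (\<Sum>k\<le>e. of_nat (e choose k) * (s ^ k * (Q * Y l ^ k * Z ^ (e - k))))"
    unfolding binomial_ring by (simp add: sum_distrib_left power_mult_distrib mult_ac)
  then have "pm_lookup (Q * (s * Y l + Z) ^ e) (replicate_mset (a l) (\<sigma> l) + A)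
    = (\<Sum>k\<le>e. of_nat (e choose k) * pm_lookup (s ^ k * (Q * Y l ^ k * Z ^ (e - k))) (replicate_mset (a l) (\<sigma> l) + A))"
    by (simp add: lookup_sum of_nat_mult_lookup)
  also have "\<dots> = (\<Sum>k\<le>e. if k = a l then of_nat (e choose k) * pm_lookup (Q * Y l ^ k * Z ^ (e - k)) A else 0)"
  proof (intro sum.cong refl)
    fix k
    have "Q * Y l ^ k * Z ^ (e - k) \<in> polys (- {\<sigma> l})"
      using sub Suc.prems(1) Y[of l] by (intro polys_mult polys_power Z) auto
    from lookup_var_power_mult[OF this A, of k "a l", folded s_def]
    show "of_nat (e choose k) * pm_lookup (s ^ k * (Q * Y l ^ k * Z ^ (e - k))) (replicate_mset (a l) (\<sigma> l) + A)
      = (if k = a l then of_nat (e choose k) * pm_lookup (Q * Y l ^ k * Z ^ (e - k)) A else 0)"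
      by simp
  qed
  also have "\<dots> = of_nat (e choose a l) * pm_lookup (Q * Y l ^ a l * Z ^ (e - a l)) A"
    using el(2) by (simp add: sum.delta)
  also have "pm_lookup (Q * Y l ^ a l * Z ^ (e - a l)) A =
      of_nat (mnom (image_mset a (mset_set {..<l}))) * pm_lookup (Q * Y l ^ a l * (\<Prod>i<l. Y i ^ a i)) \<tau>"
    unfolding A_def Z_def using Suc.prems(1) Y[of l] el(1)
    by (intro Suc.IH polys_mult polys_power) auto
  also have "of_nat (e choose a l) * \<dots> = of_nat ((e choose a l) * mnom (image_mset a (mset_set {..<l}))) *
      pm_lookup (Q * (\<Prod>i<Suc l. Y i ^ a i)) \<tau>"
    by (simp add: mult_ac)
  also have "(e choose a l) * mnom (image_mset a (mset_set {..<l})) = mnom (image_mset a (mset_set {..<Suc l}))"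
  proof -
    have "sum_mset (image_mset a (mset_set {..<l})) = e - a l"
      using el by (simp add: sum_unfold_sum_mset)
    then show ?thesis
      using el(2) by (simp add: lessThan_Suc mnom_add)
  qed
  finally show ?case
    by (simp add: s_def Z_def A_def add_ac)
qed simp

definition lform :: "(nat \<Rightarrow> nat + nat) \<Rightarrow> ('y \<Rightarrow> 'a::comm_ring_1) \<Rightarrow> ('y \<times> nat) list \<Rightarrow> (nat + nat, 'a) mpoly" where
  "lform \<sigma> c ys = (\<Sum>l<length ys. pm_single {#\<sigma> l#} (c (fst (ys ! l))))"

definition lexpo :: "(nat \<Rightarrow> nat + nat) \<Rightarrow> ('y \<times> nat) list \<Rightarrow> (nat + nat) multiset" where
  "lexpo \<sigma> ys = (\<Sum>l<length ys. replicate_mset (snd (ys ! l)) (\<sigma> l))"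

definition gform :: "('x \<Rightarrow> 'y \<Rightarrow> 'a::comm_ring_1) \<Rightarrow> ('x \<times> nat) list \<Rightarrow> ('y \<times> nat) list \<Rightarrow> (nat + nat, 'a) mpoly" where
  "gform c xs ys = (\<Sum>i<length xs. \<Sum>l<length ys.
     pm_single {#Inl i, Inr l#} (c (fst (xs ! i)) (fst (ys ! l))))"

text \<open>The value that the pairing must take on the monomials given by \<open>xs\<close> and
  \<open>ys\<close>: the form \<open>c\<close> is evaluated at generic combinations of both sides,
  and the coefficient of the matching monomial is taken in the \<open>d\<close>-th power.\<close>

definition gcoef :: "('x \<Rightarrow> 'y \<Rightarrow> 'a::comm_ring_1) \<Rightarrow> nat \<Rightarrow> ('x \<times> nat) list \<Rightarrow> ('y \<times> nat) list \<Rightarrow> 'a" where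
  "gcoef c d xs ys = pm_lookup (gform c xs ys ^ d) (lexpo Inl xs + lexpo Inr ys)"

lemma exponents_eq: "exponents (map snd xs) (map snd ys) = lexpo Inl xs + lexpo Inr ys"
  by (simp add: exponents_def lexpo_def)

lemma image_mset_nth_lessThan: "image_mset (\<lambda>i. f (xs ! i)) (mset_set {..<length xs}) = image_mset f (mset xs)"
proof -
  have "mset xs = image_mset ((!) xs) (mset_set {..<length xs})"
    by (metis map_nth mset_map mset_upt lessThan_atLeast0)
  then show ?thesis
    by (simp add: image_mset.compositionality o_def)
qed

lemma lform_polys: "\<sigma> ` UNIV \<subseteq> I \<Longrightarrow> lform \<sigma> c ys \<in> polys I"
  unfolding lform_def by (intro polys_sum polys_single) auto

lemma lform_power_coef:
  assumes "inj \<sigma>" "range \<sigma> \<inter> range \<sigma>' = {}" "sum_list (map snd xs) = d"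
  shows "pm_lookup ((\<Sum>i<length xs. pm_single {#\<sigma> i#} 1 * lform \<sigma>' (c (fst (xs ! i))) ys) ^ d)
      (lexpo \<sigma> xs + lexpo \<sigma>' ys)
    = of_nat (mnom (image_mset snd (mset xs))) *
      pm_lookup (prod_mset (image_mset (\<lambda>(x, a). lform \<sigma>' (c x) ys ^ a) (mset xs))) (lexpo \<sigma>' ys)"
proof -
  have eq: "(\<Prod>i<length xs. lform \<sigma>' (c (fst (xs ! i))) ys ^ snd (xs ! i)) =
      prod_mset (image_mset (\<lambda>(x, a). lform \<sigma>' (c x) ys ^ a) (mset xs))"
    unfolding prod_unfold_prod_mset image_mset_nth_lessThan[symmetric] by (simp add: case_prod_beta)
  have lf: "lform \<sigma>' (c x) ys \<in> polys (- range \<sigma>)" for x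
    by (intro lform_polys) (use assms(2) in auto)
  have "set_mset (lexpo \<sigma>' ys) \<inter> range \<sigma> = {}"
    using assms(2) by (auto simp: lexpo_def set_mset_sum split: if_splits)
  moreover have "(\<Sum>i<length xs. snd (xs ! i)) = d"
    using assms(3) by (simp add: sum_list_sum_nth atLeast0LessThan)
  ultimately show ?thesis
    using lookup_power_linear_form[where Q = 1 and l = "length xs" and a = "\<lambda>i. snd (xs ! i)" and \<tau> = "lexpo \<sigma>' ys" and \<sigma> = \<sigma>
        and Y = "\<lambda>i. lform \<sigma>' (c (fst (xs ! i))) ys" and e = d] assms(1,2)
    by (simp add: eq image_mset_nth_lessThan polys_1 lf flip: lexpo_def)
qed

text \<open>Reading the generic form as linear in the variables of \<open>xs\<close>, with
  coefficients in those of \<open>ys\<close>, exposes the value as a weight on monomials in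
  \<open>xs\<close>. This form shows that Roby's relations are respected in the first argument;
  \<open>gcoef_right\<close> does the same for the second.\<close>

lemma gcoef_left:
  assumes "sum_list (map snd xs) = d"
  shows "gcoef c d xs ys = of_nat (mnom (image_mset snd (mset xs))) *
    pm_lookup (prod_mset (image_mset (\<lambda>(x, a). lform Inr (c x) ys ^ a) (mset xs))) (lexpo Inr ys)"
proof -
  have "gform c xs ys = (\<Sum>i<length xs. pm_single {#Inl i#} 1 * lform Inr (c (fst (xs ! i))) ys)"
    by (simp add: gform_def lform_def sum_distrib_left mult_single add_mset_commute)
  then show ?thesis
    using lform_power_coef[of Inl Inr xs d c ys] assms by (simp add: gcoef_def inj_def) blast
qed

lemma gcoef_right:
  assumes "sum_list (map snd ys) = d"
  shows "gcoef c d xs ys = of_nat (mnom (image_mset snd (mset ys))) *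
    pm_lookup (prod_mset (image_mset (\<lambda>(y, b). lform Inl (\<lambda>x. c x y) xs ^ b) (mset ys))) (lexpo Inl xs)"
proof -
  have "gform c xs ys = (\<Sum>i<length ys. pm_single {#Inr i#} 1 * lform Inl (\<lambda>x. c x (fst (ys ! i))) xs)"
    unfolding gform_def lform_def by (subst sum.swap) (simp add: sum_distrib_left mult_single add_mset_commute)
  then show ?thesis
    using lform_power_coef[of Inr Inl ys d "\<lambda>y x. c x y" xs] assms by (simp add: gcoef_def inj_def add.commute) blast
qed

lemma gcoef_perm:
  assumes "mset xs = mset xs'" "mset ys = mset ys'"
    "sum_list (map snd xs) = d" "sum_list (map snd ys) = d"
  shows "gcoef c d xs ys = gcoef c d xs' ys'"
proof -
  have "sum_list (map snd xs') = d" "sum_list (map snd ys') = d"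
    using assms by (metis mset_map sum_mset_sum_list)+
  then show ?thesis
    using assms by (metis (no_types, lifting) gcoef_left gcoef_right)
qed


section \<open>The pairing of divided powers\<close>

context dp_module
begin

lemma linear_map_cls:
  assumes h: "h \<in> linear_maps R (dp_part R M d) (self_module R)"
    and w: "\<And>\<mu>. set_mset \<mu> \<subseteq> carrier M \<times> UNIV \<Longrightarrow> mdeg \<mu> = d \<Longrightarrow> h (cls (pm_single \<mu> 1)) = wpr j (w \<mu>)"
    and f: "f \<in> hom_polys d"
  shows "h (cls f) = wpr j (pm_sum id w f)"
proof -

  have h_add: "h (cls (f + g)) = h (cls f) \<oplus>\<^bsub>R\<^esub> h (cls g)" if "f \<in> hom_polys d" "g \<in> hom_polys d" for f g
    using h that by (auto simp: linear_maps_def self_module_def H.carrier_image H.hom_add)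
  have h_smult: "h (cls (pm_single 0 a * f)) = wpr j a \<otimes>\<^bsub>R\<^esub> h (cls f)" if "f \<in> hom_polys d" for f a
  proof -
    have "h (wpr j a \<odot>\<^bsub>dp_part R M d\<^esub> cls f) = wpr j a \<otimes>\<^bsub>R\<^esub> h (cls f)"
      using h that by (auto simp: linear_maps_def self_module_def H.carrier_image wpr_ops)
    then show ?thesis
      by (simp add: dp_part_smult that)
  qed
  have h_car: "h (cls f) \<in> carrier R" if "f \<in> hom_polys d" for f
    using h that by (auto simp: linear_maps_def self_module_def H.carrier_image)
  let ?A = "{\<mu>. set_mset \<mu> \<subseteq> carrier M \<times> UNIV \<and> mdeg \<mu> = d}"
  have A: "g \<in> hom_polys d" if "pm_keys g \<subseteq> ?A" for g
    using that by (auto simp: hom_polys_def polys_def)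
  have "pm_keys f \<subseteq> ?A"
    using f by (auto simp: hom_polys_def polys_def)
  then show ?thesis
  proof (induction f rule: keys_induct)
    case zero
    have "h (cls 0) = wpr j 0 \<otimes>\<^bsub>R\<^esub> h (cls 0)"
      using h_smult[of 0 0] H.zero_mem by simp
    also have "\<dots> = wpr j 0"
      using h_car[OF H.zero_mem] by (auto simp: wpr_ops)
    finally show ?case
      by simp
  next
    case (single k a)
    have "pm_single k a = pm_single 0 a * pm_single k 1"
      by (simp add: mult_single)
    then have "h (cls (pm_single k a)) = wpr j a \<otimes>\<^bsub>R\<^esub> h (cls (pm_single k 1))"
      using single by (simp only:) (intro h_smult A, auto)
    then show ?case
      using single by (simp add: w wpr_ops pm_sum_single)
  next
    case (add f g)
    then show ?case
      by (simp add: h_add A wpr_ops pm_sum_add)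
  qed
qed

definition pow_weight :: "('m \<Rightarrow> 'a::comm_ring_1) \<Rightarrow> nat \<Rightarrow> ('m \<times> nat) multiset \<Rightarrow> 'a" where
  "pow_weight Y d \<mu> = (if mdeg \<mu> = d then of_nat (mnom (image_mset snd \<mu>)) *
     prod_mset (image_mset (\<lambda>(x, a). Y x ^ a) \<mu>) else 0)"

text \<open>The linear map given by the law \<open>\<Sum>\<^sub>i s\<^sub>i x\<^sub>i \<mapsto> (\<Sum>\<^sub>i s\<^sub>i Y(x\<^sub>i))^d\<close> kills Roby's relations
  modulo \<open>p^(n+1)\<close> although \<open>Y\<close> is linear only modulo \<open>p\<close>, since \<open>d = p^n\<close>.\<close>

lemma pow_weight_ideal:
  fixes Y :: "'m \<Rightarrow> 'a::comm_ring_1" and emb :: "'k wv \<Rightarrow> 'a"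
  assumes j: "j = Suc n" and d: "d = p ^ n"
    and emb: "\<And>a b. emb (a + b) = emb a + emb b" "\<And>a b. emb (a * b) = emb a * emb b" "emb 0 = 0" "emb 1 = 1"
    and Y_add: "\<And>x y. x \<in> carrier M \<Longrightarrow> y \<in> carrier M \<Longrightarrow> of_nat p dvd Y (x \<oplus>\<^bsub>M\<^esub> y) - (Y x + Y y)"
    and Y_smult: "\<And>x a. x \<in> carrier M \<Longrightarrow> of_nat p dvd Y (wpr j a \<odot>\<^bsub>M\<^esub> x) - emb a * Y x"
    and f: "f \<in> D" "mp j f \<in> dp_ideal R M"
  shows "of_nat (p ^ j) dvd pm_sum emb (pow_weight Y d) f"
proof (rule dp_ideal_dvd[OF _ _ f])
  let ?L = "pm_sum emb (pow_weight Y d)"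
  show L_add: "?L (f + g) = ?L f + ?L g" for f g
    by (rule pm_sum_add) (use emb in auto)
  have L_diff: "?L (f - g) = ?L f - ?L g" for f g
    by (rule pm_sum_minus) (use emb in auto)
  have L_sum: "?L (\<Sum>x\<in>X. F x) = (\<Sum>x\<in>X. ?L (F x))" for X :: "nat set" and F
    by (rule pm_sum_sum) (use emb in auto)
  have L_single: "?L (pm_single \<mu> a) = emb a * pow_weight Y d \<mu>" for \<mu> a
    by (rule pm_sum_single) (use emb in auto)
  have emb_of_nat: "emb (of_nat c) = of_nat c" for c
    by (induction c) (simp_all add: emb)
  have emb_power: "emb (a ^ c) = emb a ^ c" for a c
    by (induction c) (simp_all add: emb)
  let ?W = "pow_weight Y d"
  \<comment> \<open>Pulling one symbol out of a monomial of degree \<open>d\<close> leaves the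
    factor \<open>(d choose i) (Y x)^i\<close>, to which the congruence for powers applies.\<close>
  have W: "?W (add_mset (x, i) \<kappa>) = of_nat (d choose i) * Y x ^ i * 
      (of_nat (mnom (image_mset snd \<kappa>)) * prod_mset (image_mset (\<lambda>(x, a). Y x ^ a) \<kappa>))"
    if "i + mdeg \<kappa> = d" for x i \<kappa>
    using that by (auto simp: pow_weight_def mdeg_def mnom_add mult_ac)
  have W0: "?W (add_mset (x, i) \<kappa>) = 0" if "i + mdeg \<kappa> \<noteq> d" for x i \<kappa>
    using that by (auto simp: pow_weight_def mdeg_def)
  have W_cong: "of_nat (p ^ j) dvd of_nat (d choose i) * u ^ i * C - of_nat (d choose i) * w ^ i * C"
    if "of_nat p dvd u - w" for u w C :: 'a and i
  proof -
    have "of_nat (d choose i) * u ^ i * C - of_nat (d choose i) * w ^ i * C = (of_nat (d choose i) * (u ^ i - w ^ i)) * C"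
      by (simp add: algebra_simps)
    then show ?thesis
      using dvd_choose_mult_power_diff[OF prime_p that, of n i] by (simp only: j d dvd_mult2)
  qed
  have W_zero: "?W (add_mset (x, 0) \<kappa>) = ?W \<kappa>" for x \<kappa>
    by (simp add: pow_weight_def mdeg_def mnom_add)
  have W_mult: "?W (add_mset (x, i) (add_mset (x, l) \<kappa>)) = of_nat ((i + l) choose i) * ?W (add_mset (x, i + l) \<kappa>)" for x i l \<kappa>
    by (auto simp: pow_weight_def mdeg_def power_add mnom_split mult_ac)
  fix f r assume "r \<in> drels"
  then show "of_nat (p ^ j) dvd ?L (f * r)"
  proof (induction f rule: poly_mapping_add_induct)
    case (single \<kappa> c)
    have D: "?L (pm_single \<kappa> c * pm_single 0 a * dvar x i) = emb c * emb a * ?W (add_mset (x, i) \<kappa>)" for a x i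
      by (simp add: dvar_def mult_single L_single emb)
    have D1: "?L (pm_single \<kappa> c * dvar x i) = emb c * ?W (add_mset (x, i) \<kappa>)" for x i
      by (simp add: dvar_def mult_single L_single emb)
    have D2: "?L (pm_single \<kappa> c * (dvar x i * dvar y l)) = emb c * ?W (add_mset (x, i) (add_mset (y, l) \<kappa>))" for x i y l
      by (simp add: dvar_def mult_single L_single emb add_mset_commute)
    from single consider (1) x where "x \<in> carrier M" "r = dvar x 0 - 1"
      | (2) a x i where "x \<in> carrier M" "r = dvar (wpr j a \<odot>\<^bsub>M\<^esub> x) i - pm_single 0 (a ^ i) * dvar x i"
      | (3) x i l where "x \<in> carrier M" "r = dvar x i * dvar x l - of_nat ((i + l) choose i) * dvar x (i + l)"
      | (4) x y i where "x \<in> carrier M" "y \<in> carrier M" "r = dvar (x \<oplus>\<^bsub>M\<^esub> y) i - (\<Sum>l\<in>{..i}. dvar x l * dvar y (i - l))"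
      unfolding drels_def by blast
    then show ?case
    \<comment> \<open>The relations for \<open>[x]_0\<close> and \<open>[x]_i [x]_l\<close> are
      killed exactly. Only those for scalar multiples and sums rest on the linearity of
      \<open>Y\<close> modulo \<open>p\<close>.\<close>
    proof cases
      case 1
      then have "?L (pm_single \<kappa> c * r) = 0"
        by (simp add: right_diff_distrib L_diff D1 W_zero L_single)
      then show ?thesis
        by simp
    next
      case 2
      have "?L (pm_single \<kappa> c * r) = emb c * (?W (add_mset (wpr j a \<odot>\<^bsub>M\<^esub> x, i) \<kappa>) - emb a ^ i * ?W (add_mset (x, i) \<kappa>))"
        by (simp add: 2(2) right_diff_distrib L_diff D1 D emb_power flip: mult.assoc)
      moreover have "of_nat (p ^ j) dvd ?W (add_mset (wpr j a \<odot>\<^bsub>M\<^esub> x, i) \<kappa>) - emb a ^ i * ?W (add_mset (x, i) \<kappa>)"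
      proof (cases "i + mdeg \<kappa> = d")
        case True
        show ?thesis
          using W_cong[OF Y_smult[OF 2(1)], of i a "of_nat (mnom (image_mset snd \<kappa>)) * prod_mset (image_mset (\<lambda>(x, a). Y x ^ a) \<kappa>)"]
          by (simp add: W[OF True] power_mult_distrib mult_ac)
      qed (simp add: W0)
      ultimately show ?thesis
        by simp
    next
      case 3
      have "pm_single \<kappa> c * (of_nat ((i + l) choose i) * dvar x (i + l))
         = pm_single \<kappa> c * pm_single 0 (of_nat ((i + l) choose i)) * dvar x (i + l)"
        by (simp add: mult_ac)
      then have "?L (pm_single \<kappa> c * r) = 0"
        by (simp only: 3(2) right_diff_distrib L_diff D D2 W_mult emb_of_nat) (simp add: mult_ac)
      then show ?thesis
        by simp
    next
      case 4
      have "?L (pm_single \<kappa> c * r) = emb c * (?W (add_mset (x \<oplus>\<^bsub>M\<^esub> y, i) \<kappa>) - 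
          (\<Sum>l\<le>i. ?W (add_mset (x, l) (add_mset (y, i - l) \<kappa>))))"
        by (simp add: 4(3) right_diff_distrib L_diff D1 D2 L_sum sum_distrib_left)
      moreover have "of_nat (p ^ j) dvd ?W (add_mset (x \<oplus>\<^bsub>M\<^esub> y, i) \<kappa>) - 
          (\<Sum>l\<le>i. ?W (add_mset (x, l) (add_mset (y, i - l) \<kappa>)))"
      proof (cases "i + mdeg \<kappa> = d")
        case True
        define C where "C = of_nat (mnom (image_mset snd \<kappa>)) * prod_mset (image_mset (\<lambda>(x, a). Y x ^ a) \<kappa>)"
        \<comment> \<open>Merging the parts \<open>l\<close> and \<open>i - l\<close> leaves
          \<open>(i choose l)\<close>, so the sum over \<open>l\<close> becomes the binomial
          expansion of \<open>(Y x + Y y)^i\<close>.\<close>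
        have "?W (add_mset (x, l) (add_mset (y, i - l) \<kappa>)) = of_nat (d choose i) * (of_nat (i choose l) * Y x ^ l * Y y ^ (i - l)) * C"
          if "l \<le> i" for l
        proof -
          have "mnom (add_mset l (add_mset (i - l) (image_mset snd \<kappa>))) = (i choose l) * ((d choose i) * mnom (image_mset snd \<kappa>))"
            using that True mnom_split[of l "i - l" "image_mset snd \<kappa>"] mnom_add[of i "image_mset snd \<kappa>"]
            by (simp add: mdeg_def)
          then show ?thesis
            using that True by (simp add: pow_weight_def mdeg_def C_def mult_ac)
        qed
        then have "(\<Sum>l\<le>i. ?W (add_mset (x, l) (add_mset (y, i - l) \<kappa>))) = of_nat (d choose i) * (Y x + Y y) ^ i * C"
          by (simp add: binomial_ring sum_distrib_left sum_distrib_right mult_ac)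
        then show ?thesis
          using W_cong[OF Y_add[OF 4(1,2)], of i C] W[OF True, of "x \<oplus>\<^bsub>M\<^esub> y", folded C_def] by simp
      next
        case False
        then have "(\<Sum>l\<le>i. ?W (add_mset (x, l) (add_mset (y, i - l) \<kappa>))) = 0"
          by (intro sum.neutral ballI W0) (simp add: mdeg_def)
        then show ?thesis
          using False by (simp add: W0)
      qed
      ultimately show ?thesis
        by simp
    qed
  qed (simp_all add: distrib_right L_add)
qed

end


lemma of_nat_dvd_single:
  fixes a :: "'a::comm_ring_1"
  assumes "of_nat c dvd a"
  shows "of_nat c dvd pm_single (\<mu> :: 'i multiset) a"
  using assms by (auto simp: of_nat_dvd_poly_iff lookup_single when_def)

lemma lform_cong_dvd:
  assumes "\<And>y b. (y, b) \<in> set ys \<Longrightarrow> of_nat c dvd F y - G y"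
  shows "of_nat c dvd lform \<sigma> F ys - lform \<sigma> G ys"
proof -
  have "of_nat c dvd F (fst (ys ! l)) - G (fst (ys ! l))" if "l < length ys" for l
    using assms[of "fst (ys ! l)" "snd (ys ! l)"] that by simp
  then have "of_nat c dvd (\<Sum>l<length ys. pm_single {#\<sigma> l#} (F (fst (ys ! l)) - G (fst (ys ! l))))"
    by (intro dvd_sum of_nat_dvd_single) auto
  then show ?thesis
    by (simp add: lform_def sum_subtractf single_diff)
qed

lemma lform_add: "lform \<sigma> (\<lambda>y. F y + G y) ys = lform \<sigma> F ys + lform \<sigma> G ys"
  by (simp add: lform_def single_add sum.distrib)

lemma lform_mult: "lform \<sigma> (\<lambda>y. a * F y) ys = pm_single 0 a * lform \<sigma> F ys"
  by (simp add: lform_def sum_distrib_left mult_single)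

text \<open>The generic form needs lists, its variables being indexed by positions; by
  \<open>gcoef_perm\<close> any ordering gives the same value.\<close>

definition mset_list :: "'a multiset \<Rightarrow> 'a list" where
  "mset_list \<mu> = (SOME xs. mset xs = \<mu>)"

lemma mset_mset_list [simp]: "mset (mset_list \<mu>) = \<mu>"
  unfolding mset_list_def by (rule someI_ex) (rule ex_mset)

lemma sum_list_mset_list: "sum_list (map snd (mset_list \<mu>)) = mdeg \<mu>"
  by (simp add: mdeg_def flip: sum_mset_sum_list)

context dp_module
begin

definition form_pairing :: "('m \<Rightarrow> 'n \<Rightarrow> 'k wv) \<Rightarrow> nat \<Rightarrow> ('m \<times> nat) multiset \<Rightarrow> ('n \<times> nat) multiset \<Rightarrow> 'k wv" where
  "form_pairing c d \<mu> \<nu> = (if mdeg \<mu> = d \<and> mdeg \<nu> = d then gcoef c d (mset_list \<mu>) (mset_list \<nu>) else 0)"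

lemma pm_sum_pow_weight_lookup:
  assumes "\<And>\<mu>. pm_lookup (pow_weight Y d \<mu>) (\<tau> :: 'i multiset) = w \<mu>"
  shows "pm_lookup (pm_sum (pm_single 0) (pow_weight Y d) f) \<tau> = pm_sum id w f"
  by (simp add: pm_sum_def lookup_sum lookup_const_mult assms)

text \<open>\<open>pow_weight_ideal\<close> is applied with polynomial values: \<open>Y x\<close> is
  the linear form of \<open>c x\<close> in the variables of the other argument. The resulting
  congruence of polynomials is then read off at the coefficient \<open>\<tau>\<close>.\<close>

lemma lform_weight_ideal:
  fixes c :: "'m \<Rightarrow> 'n \<Rightarrow> 'k wv" and ys :: "('n \<times> nat) list"
  assumes j: "j = Suc n" and d: "d = p ^ n"
    and c_add: "\<And>x x' y b. x \<in> carrier M \<Longrightarrow> x' \<in> carrier M \<Longrightarrow> (y, b) \<in> set ys \<Longrightarrow>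
        of_nat p dvd c (x \<oplus>\<^bsub>M\<^esub> x') y - (c x y + c x' y)"
    and c_smult: "\<And>x a y b. x \<in> carrier M \<Longrightarrow> (y, b) \<in> set ys \<Longrightarrow>
        of_nat p dvd c (wpr j a \<odot>\<^bsub>M\<^esub> x) y - a * c x y"
    and w: "\<And>\<mu>. pm_lookup (pow_weight (\<lambda>x. lform \<sigma> (c x) ys) d \<mu>) \<tau> = w \<mu>"
    and f: "f \<in> D" "mp j f \<in> dp_ideal R M"
  shows "of_nat (p ^ j) dvd pm_sum id w f"
proof -
  have "of_nat (p ^ j) dvd pm_sum (pm_single 0) (pow_weight (\<lambda>x. lform \<sigma> (c x) ys) d) f"
  proof (rule pow_weight_ideal[OF j d _ _ _ _ _ _ f])
    show "of_nat p dvd lform \<sigma> (c (x \<oplus>\<^bsub>M\<^esub> y)) ys - (lform \<sigma> (c x) ys + lform \<sigma> (c y) ys)"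
      if "x \<in> carrier M" "y \<in> carrier M" for x y
      unfolding lform_add[symmetric] by (rule lform_cong_dvd) (use c_add that in auto)
    show "of_nat p dvd lform \<sigma> (c (wpr j a \<odot>\<^bsub>M\<^esub> x)) ys - pm_single 0 a * lform \<sigma> (c x) ys"
      if "x \<in> carrier M" for x a
      unfolding lform_mult[symmetric] by (rule lform_cong_dvd) (use c_smult that in auto)
  qed (simp_all add: single_add mult_single)
  then have "of_nat (p ^ j) dvd pm_lookup (pm_sum (pm_single 0) (pow_weight (\<lambda>x. lform \<sigma> (c x) ys) d) f) \<tau>"
    by (simp only: of_nat_dvd_poly_iff)
  then show ?thesis
    by (simp only: pm_sum_pow_weight_lookup[OF w])
qed

end

text \<open>The form \<open>c\<close> is bilinear only modulo \<open>p\<close>: it stands for the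
  lift \<open>[\<phi>(v)]\<close> of the evaluation, and Teichmueller lifts are additive only modulo
  \<open>p\<close>.\<close>

locale dp_pair = M: dp_module p K j M + N: dp_module p K j N
  for p and K :: "'k::{field,finite} itself" and j
    and M :: "((nat \<Rightarrow> 'k) set, 'm, 'c) module_scheme"
    and N :: "((nat \<Rightarrow> 'k) set, 'n, 'e) module_scheme" +
  fixes c :: "'m \<Rightarrow> 'n \<Rightarrow> 'k wv" and n d :: nat
  assumes j: "j = Suc n" and d: "d = p ^ n"
    and c_add_left: "x \<in> carrier M \<Longrightarrow> x' \<in> carrier M \<Longrightarrow> y \<in> carrier N \<Longrightarrow>
        of_nat p dvd c (x \<oplus>\<^bsub>M\<^esub> x') y - (c x y + c x' y)"
    and c_smult_left: "x \<in> carrier M \<Longrightarrow> y \<in> carrier N \<Longrightarrow>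
        of_nat p dvd c (M.wpr j a \<odot>\<^bsub>M\<^esub> x) y - a * c x y"
    and c_add_right: "x \<in> carrier M \<Longrightarrow> y \<in> carrier N \<Longrightarrow> y' \<in> carrier N \<Longrightarrow>
        of_nat p dvd c x (y \<oplus>\<^bsub>N\<^esub> y') - (c x y + c x y')"
    and c_smult_right: "x \<in> carrier M \<Longrightarrow> y \<in> carrier N \<Longrightarrow>
        of_nat p dvd c x (M.wpr j a \<odot>\<^bsub>N\<^esub> y) - a * c x y"
begin

section \<open>Descent of the form to the divided powers\<close>

abbreviation "W \<equiv> M.form_pairing c d"

definition Bil :: "('m \<times> nat, 'k wv) mpoly \<Rightarrow> ('n \<times> nat, 'k wv) mpoly \<Rightarrow> 'k wv" where
  "Bil f g = pm_sum id (\<lambda>\<nu>. pm_sum id (\<lambda>\<mu>. W \<mu> \<nu>) f) g"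

lemma Bil_swap: "Bil f g = pm_sum id (\<lambda>\<mu>. pm_sum id (\<lambda>\<nu>. W \<mu> \<nu>) g) f"
  unfolding Bil_def pm_sum_def id_def sum_distrib_left by (subst sum.swap) (simp add: mult_ac)

lemma Bil_add_right: "Bil f (g + g') = Bil f g + Bil f g'"
  by (simp add: Bil_def pm_sum_add)

lemma Bil_add_left: "Bil (f + f') g = Bil f g + Bil f' g"
  by (simp add: Bil_swap pm_sum_add)

lemma Bil_minus_right: "Bil f (g - g') = Bil f g - Bil f g'"
  by (simp add: Bil_def pm_sum_minus)

lemma Bil_minus_left: "Bil (f - f') g = Bil f g - Bil f' g"
  by (simp add: Bil_swap pm_sum_minus)

lemma pm_sum_const_mult:
  "pm_sum id w (pm_single 0 a * f) = a * pm_sum id w (f :: ('i, 'k wv) mpoly)"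
proof (induction f rule: poly_mapping_add_induct)
  case (single k b)
  then show ?case
    by (simp add: mult_single pm_sum_single mult_ac)
qed (simp_all add: distrib_left pm_sum_add)

lemma Bil_const_mult_right: "Bil f (pm_single 0 a * g) = a * Bil f g"
  by (simp add: Bil_def pm_sum_const_mult)

lemma Bil_const_mult_left: "Bil (pm_single 0 a * f) g = a * Bil f g"
  by (simp add: Bil_swap pm_sum_const_mult)

lemma W_ideal_left:
  assumes "f \<in> M.D" "M.mp j f \<in> dp_ideal M.R M" "set_mset \<nu> \<subseteq> carrier N \<times> UNIV"
  shows "of_nat (p ^ j) dvd pm_sum id (\<lambda>\<mu>. W \<mu> \<nu>) f"
proof (cases "mdeg \<nu> = d")
  case True
  have ys: "y \<in> carrier N" if "(y, b) \<in> set (mset_list \<nu>)" for y b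
    using assms(3) that by (metis mem_Sigma_iff mset_mset_list set_mset_mset subsetD)
  show ?thesis
  proof (rule M.lform_weight_ideal[OF j d _ _ _ assms(1,2)])
    show "pm_lookup (M.pow_weight (\<lambda>x. lform Inr (c x) (mset_list \<nu>)) d \<mu>) (lexpo Inr (mset_list \<nu>)) = W \<mu> \<nu>" for \<mu>
      using gcoef_left[of "mset_list \<mu>" d c "mset_list \<nu>"] True
      by (simp add: M.pow_weight_def M.form_pairing_def sum_list_mset_list of_nat_mult_lookup)
  qed (auto intro!: c_add_left c_smult_left dest: ys)
qed (simp add: M.form_pairing_def pm_sum_def)

lemma W_ideal_right:
  assumes "g \<in> N.D" "M.mp j g \<in> dp_ideal M.R N" "set_mset \<mu> \<subseteq> carrier M \<times> UNIV"
  shows "of_nat (p ^ j) dvd pm_sum id (\<lambda>\<nu>. W \<mu> \<nu>) g"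
proof (cases "mdeg \<mu> = d")
  case True
  have xs: "x \<in> carrier M" if "(x, b) \<in> set (mset_list \<mu>)" for x b
    using assms(3) that by (metis mem_Sigma_iff mset_mset_list set_mset_mset subsetD)
  show ?thesis
  proof (rule N.lform_weight_ideal[OF j d _ _ _ assms(1,2)])
    show "pm_lookup (N.pow_weight (\<lambda>y. lform Inl (\<lambda>x. c x y) (mset_list \<mu>)) d \<nu>) (lexpo Inl (mset_list \<mu>)) = W \<mu> \<nu>" for \<nu>
      using gcoef_right[of "mset_list \<nu>" d c "mset_list \<mu>"] True
      by (simp add: N.pow_weight_def M.form_pairing_def sum_list_mset_list of_nat_mult_lookup)
  qed (auto intro!: c_add_right c_smult_right dest: xs)
qed (simp add: M.form_pairing_def pm_sum_def)

lemma Bil_ideal_left: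
  assumes "f \<in> M.D" "M.mp j f \<in> dp_ideal M.R M" "g \<in> N.D"
  shows "of_nat (p ^ j) dvd Bil f g"
  unfolding Bil_def pm_sum_def[of id _ g] 
  by (intro dvd_sum dvd_mult W_ideal_left assms) (use assms(3) in \<open>auto simp: polys_def\<close>)

lemma Bil_ideal_right:
  assumes "g \<in> N.D" "M.mp j g \<in> dp_ideal M.R N" "f \<in> M.D"
  shows "of_nat (p ^ j) dvd Bil f g"
  unfolding Bil_swap pm_sum_def[of id _ f] 
  by (intro dvd_sum dvd_mult W_ideal_right assms) (use assms(3) in \<open>auto simp: polys_def\<close>)

abbreviation "DM \<equiv> dp_part M.R M d"
abbreviation "DN \<equiv> dp_part M.R N d"

definition BB :: "(('m \<times> nat) multiset \<Rightarrow> (nat \<Rightarrow> 'k) set) set \<Rightarrow> (('n \<times> nat) multiset \<Rightarrow> (nat \<Rightarrow> 'k) set) set \<Rightarrow> (nat \<Rightarrow> 'k) set" where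
  "BB = (\<lambda>C\<in>carrier DM. \<lambda>E\<in>carrier DN. M.wpr j (Bil (SOME f. f \<in> M.hom_polys d \<and> M.cls f = C) (SOME g. g \<in> N.hom_polys d \<and> N.cls g = E)))"

lemma BB_cls:
  assumes f: "f \<in> M.hom_polys d" and g: "g \<in> N.hom_polys d"
  shows "BB (M.cls f) (N.cls g) = M.wpr j (Bil f g)"
proof -
  define f' where "f' = (SOME f'. f' \<in> M.hom_polys d \<and> M.cls f' = M.cls f)"
  define g' where "g' = (SOME g'. g' \<in> N.hom_polys d \<and> N.cls g' = N.cls g)"
  have f': "f' \<in> M.hom_polys d" "M.cls f' = M.cls f"
    using someI[of "\<lambda>f'. f' \<in> M.hom_polys d \<and> M.cls f' = M.cls f" f] f by (auto simp: f'_def)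
  have g': "g' \<in> N.hom_polys d" "N.cls g' = N.cls g"
    using someI[of "\<lambda>g'. g' \<in> N.hom_polys d \<and> N.cls g' = N.cls g" g] g by (auto simp: g'_def)
  note D = f g f'(1) g'(1) M.hom_polys_D N.hom_polys_D
  have "Bil f' g' - Bil f g = Bil (f' - f) g' + Bil f (g' - g)"
    by (simp add: Bil_minus_left Bil_minus_right)
  moreover have "of_nat (p ^ j) dvd Bil (f' - f) g'"
    using f'(2) D by (intro Bil_ideal_left) (auto simp: M.P.minus_mem simp flip: M.cls_eq_iff)
  moreover have "of_nat (p ^ j) dvd Bil f (g' - g)"
    using g'(2) D by (intro Bil_ideal_right) (auto simp: N.P.minus_mem simp flip: N.cls_eq_iff)
  ultimately have "M.wpr j (Bil f' g') = M.wpr j (Bil f g)"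
    by (simp add: M.wpr_eq_iff)
  then show ?thesis
    using f g by (simp add: BB_def M.H.carrier_image N.H.carrier_image f'_def g'_def)
qed

lemma BB_bilinear: "BB \<in> bilinear_forms M.R DM DN"
proof -
  have "BB C \<in> linear_maps M.R DN (self_module M.R)" if "C \<in> carrier DM" for C
  proof -
    obtain f where f: "f \<in> M.hom_polys d" "C = M.cls f"
      using \<open>C \<in> carrier DM\<close> by (auto simp: M.H.carrier_image)
    have "BB C \<in> extensional (carrier DN)"
      using that by (simp add: BB_def)
    then show ?thesis
      unfolding linear_maps_def PiE_def self_module_def
      by (auto simp: N.H.carrier_image f BB_cls N.H.hom_add N.H.add_mem M.wpr_ops Bil_add_right
          N.dp_part_smult N.hom_polys_const_mult Bil_const_mult_right)
  qed
  moreover have "(\<lambda>C\<in>carrier DM. BB C E) \<in> linear_maps M.R DM (self_module M.R)" if "E \<in> carrier DN" for E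
  proof -
    obtain g where g: "g \<in> N.hom_polys d" "E = N.cls g"
      using \<open>E \<in> carrier DN\<close> by (auto simp: N.H.carrier_image)
    then show ?thesis
      unfolding linear_maps_def PiE_def self_module_def
      by (auto simp: M.H.carrier_image g BB_cls M.H.hom_add M.H.add_mem M.wpr_ops Bil_add_left
          M.dp_part_smult M.hom_polys_const_mult Bil_const_mult_left)
  qed
  moreover have "BB \<in> extensional (carrier DM)"
    by (simp add: BB_def)
  ultimately show ?thesis
    by (simp add: bilinear_forms_def)
qed

lemma single_hom_polys:
  "set xs \<subseteq> carrier M \<times> UNIV \<Longrightarrow> sum_list (map snd xs) = d \<Longrightarrow> pm_single (mset xs) a \<in> M.hom_polys d"
  "set ys \<subseteq> carrier N \<times> UNIV \<Longrightarrow> sum_list (map snd ys) = d \<Longrightarrow> pm_single (mset ys) a \<in> N.hom_polys d"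
  by (auto simp: M.hom_polys_def N.hom_polys_def polys_single mdeg_def simp flip: sum_mset_sum_list)

lemma BB_monom:
  assumes "set xs \<subseteq> carrier M \<times> UNIV" "set ys \<subseteq> carrier N \<times> UNIV" "sum_list (map snd xs) = d" "sum_list (map snd ys) = d"
  shows "BB (dp_monom M.R M xs) (dp_monom M.R N ys) = M.wpr j (gcoef c d xs ys)"
proof -
  have "mdeg (mset xs) = d" "mdeg (mset ys) = d"
    using assms(3,4) by (simp_all add: mdeg_def flip: sum_mset_sum_list)
  then have "W (mset xs) (mset ys) = gcoef c d xs ys"
    using gcoef_perm[of "mset_list (mset xs)" xs "mset_list (mset ys)" ys d c]
    by (simp add: M.form_pairing_def sum_list_mset_list)
  then show ?thesis
    using assms by (simp add: M.dp_monom_eq N.dp_monom_eq BB_cls single_hom_polys Bil_def pm_sum_single)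
qed

text \<open>The classes of monomials span the degree \<open>d\<close> parts, so values on them
  determine a bilinear form there. Outside the carriers both forms are \<open>undefined\<close>,
  which makes the description in \<open>pairing\<close> single out one function.\<close>

lemma bilinear_form_unique:
  assumes B: "B \<in> bilinear_forms M.R DM DN"
    and mono: "\<And>xs ys. set xs \<subseteq> carrier M \<times> UNIV \<Longrightarrow> set ys \<subseteq> carrier N \<times> UNIV \<Longrightarrow>
      sum_list (map snd xs) = d \<Longrightarrow> sum_list (map snd ys) = d \<Longrightarrow>
      B (dp_monom M.R M xs) (dp_monom M.R N ys) = M.wpr j (gcoef c d xs ys)"
  shows "B = BB"
proof -
  have B_mono: "B (M.cls (pm_single \<mu> 1)) (N.cls (pm_single \<nu> 1)) = M.wpr j (W \<mu> \<nu>)"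
    if "set_mset \<mu> \<subseteq> carrier M \<times> UNIV" "mdeg \<mu> = d" "set_mset \<nu> \<subseteq> carrier N \<times> UNIV" "mdeg \<nu> = d" for \<mu> \<nu>
    using mono[of "mset_list \<mu>" "mset_list \<nu>"] that
    by (simp add: M.dp_monom_eq N.dp_monom_eq sum_list_mset_list M.form_pairing_def flip: set_mset_mset)
  have mem: "M.cls (pm_single \<mu> 1) \<in> carrier DM" if "set_mset \<mu> \<subseteq> carrier M \<times> UNIV" "mdeg \<mu> = d" for \<mu>
    using that by (auto simp: M.H.carrier_image M.hom_polys_def polys_single intro!: imageI)
  have memN: "N.cls (pm_single \<mu> 1) \<in> carrier DN" if "set_mset \<mu> \<subseteq> carrier N \<times> UNIV" "mdeg \<mu> = d" for \<mu>
    using that by (auto simp: N.H.carrier_image N.hom_polys_def polys_single intro!: imageI)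
  have B1: "B (M.cls f) (N.cls (pm_single \<nu> 1)) = M.wpr j (pm_sum id (\<lambda>\<mu>. W \<mu> \<nu>) f)"
    if "set_mset \<nu> \<subseteq> carrier N \<times> UNIV" "mdeg \<nu> = d" "f \<in> M.hom_polys d" for \<nu> f
  proof -
    have "(\<lambda>C\<in>carrier DM. B C (N.cls (pm_single \<nu> 1))) \<in> linear_maps M.R DM (self_module M.R)"
      using B memN[OF that(1,2)] by (simp add: bilinear_forms_def)
    from M.linear_map_cls[OF this _ that(3), of "\<lambda>\<mu>. W \<mu> \<nu>"] show ?thesis
      using that mem by (simp add: B_mono M.H.carrier_image)
  qed
  have B2: "B (M.cls f) (N.cls g) = M.wpr j (Bil f g)" if "f \<in> M.hom_polys d" "g \<in> N.hom_polys d" for f g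
  proof -
    have "B (M.cls f) \<in> linear_maps M.R DN (self_module M.R)"
      using B that by (simp add: bilinear_forms_def M.H.carrier_image)
    from N.linear_map_cls[OF this _ that(2), of "\<lambda>\<nu>. pm_sum id (\<lambda>\<mu>. W \<mu> \<nu>) f"] show ?thesis
      using that by (simp add: B1 Bil_def)
  qed
  have "B C E = BB C E" for C E
  proof (cases "C \<in> carrier DM \<and> E \<in> carrier DN")
    case True
    then show ?thesis
      by (auto simp: M.H.carrier_image N.H.carrier_image B2 BB_cls)
  next
    case False
    have "B C = undefined \<and> BB C = undefined" if "C \<notin> carrier DM"
      using B BB_bilinear that by (simp add: bilinear_forms_def extensional_def)
    moreover have "B C E = undefined \<and> BB C E = undefined" if "C \<in> carrier DM" "E \<notin> carrier DN"
      using B BB_bilinear that by (auto simp: bilinear_forms_def linear_maps_def PiE_def extensional_def)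
    ultimately show ?thesis
      using False by (cases "C \<in> carrier DM") auto
  qed
  then show ?thesis
    by blast
qed

end


section \<open>Small Omega powers by generators and relations\<close>

lemma pair_mset_eq_iff: "{#Inl i, Inr l#} = {#Inl i', Inr l'#} \<longleftrightarrow> i = i' \<and> l = l'"
  by (auto simp: add_eq_conv_ex)

lemma sum_sum_delta:
  assumes "i0 < (a::nat)" "l0 < (b::nat)"
  shows "(\<Sum>i<a. \<Sum>l<b. if i = i0 \<and> l = l0 then F i l else 0) = (F i0 l0 :: 'a::comm_monoid_add)"
proof -
  have "(\<Sum>l<b. if i = i0 \<and> l = l0 then F i l else 0) = (if i = i0 then F i0 l0 else 0)" for i
    using assms(2) by (cases "i = i0") (simp_all add: sum.delta)
  then show ?thesis
    using assms(1) by (simp add: sum.delta)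
qed

lemma mdeg_pos_ex:
  assumes "mdeg \<nu> > 0"
  shows "\<exists>x b. (x, b) \<in># \<nu> \<and> b > 0"
proof (rule ccontr)
  assume "\<nexists>x b. (x, b) \<in># \<nu> \<and> b > 0"
  then have "\<forall>b\<in>#image_mset snd \<nu>. b = 0"
    by auto
  then have "mdeg \<nu> = 0"
    unfolding mdeg_def by (metis sum_mset_0_iff)
  then show False
    using assms by simp
qed

abbreviation teich_monom :: "'v \<Rightarrow> (('v \<Rightarrow> 'k::{field,finite}) \<times> nat) multiset \<Rightarrow> 'k wv" where
  "teich_monom v \<nu> \<equiv> prod_mset (image_mset (\<lambda>(\<phi>, b). teich (\<phi> v) ^ b) \<nu>)"

text \<open>For \<open>\<nu>\<close> of degree \<open>p^n\<close>, this is the pairing of the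
  combination of the classes of \<open>[v]\<close> with coefficients \<open>a v\<close> against the
  monomial \<open>\<nu>\<close> of functionals, before reduction modulo
  \<open>p^(n+1)\<close>.\<close>

abbreviation rel_sum :: "'v set \<Rightarrow> ('v \<Rightarrow> 'k::{field,finite} wv) \<Rightarrow> (('v \<Rightarrow> 'k) \<times> nat) multiset \<Rightarrow> 'k wv" where
  "rel_sum V a \<nu> \<equiv> \<Sum>v\<in>V. a v * (of_nat (mnom (image_mset snd \<nu>)) * teich_monom v \<nu>)"

definition delta :: "'v \<Rightarrow> 'v \<Rightarrow> 'a::zero_neq_one" where
  "delta v u = (if u = v then 1 else 0)"

definition omega_rel :: "nat \<Rightarrow> nat \<Rightarrow> ('k::{field,finite} \<Rightarrow> 'v::ab_group_add \<Rightarrow> 'v) \<Rightarrow> 'v set \<Rightarrow> ('v \<Rightarrow> 'k wv) \<Rightarrow> bool" where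
  "omega_rel p n scale V a \<longleftrightarrow> (\<forall>\<nu>. set_mset \<nu> \<subseteq> dual_space scale V \<times> UNIV \<longrightarrow> mdeg \<nu> = p ^ n \<longrightarrow>
     of_nat (p ^ Suc n) dvd (rel_sum V a \<nu>))"

context witt_char
begin

text \<open>The monomials in one left and one right variable are pairwise distinct, so every
  coefficient of the generic value is a single \<open>\<phi>(v)\<close> or 0. Hence the
  coefficientwise Teichmueller lift involves no lift of a sum.\<close>

lemma gform_teich_lookup:
  "pm_lookup (gform (\<lambda>v \<phi>. teich (\<phi> v :: 'k)) xs ys) \<mu> = teich (generic_value (map fst xs) (map fst ys) \<mu>)"
proof (cases "\<exists>i<length xs. \<exists>l<length ys. \<mu> = {#Inl i, Inr l#}")
  case True
  then obtain i0 l0 where il: "i0 < length xs" "l0 < length ys" "\<mu> = {#Inl i0, Inr l0#}"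
    by blast
  have "pm_lookup (gform (\<lambda>v \<phi>. teich (\<phi> v)) xs ys) \<mu> =
      (\<Sum>i<length xs. \<Sum>l<length ys. if i = i0 \<and> l = l0 then teich ((fst (ys ! l)) (fst (xs ! i))) else 0)"
    by (simp add: gform_def lookup_sum lookup_single when_def il pair_mset_eq_iff)
  moreover have "generic_value (map fst xs) (map fst ys) \<mu> =
      (\<Sum>i<length xs. \<Sum>l<length ys. if i = i0 \<and> l = l0 then (fst (ys ! l)) (fst (xs ! i)) else 0)"
    unfolding generic_value_def by (intro sum.cong refl) (auto simp: il pair_mset_eq_iff)
  ultimately show ?thesis
    using il by (simp only: sum_sum_delta)
next
  case False
  have "pm_lookup (gform (\<lambda>v \<phi>. teich (\<phi> v)) xs ys) \<mu> = 0"
    using False unfolding gform_def lookup_sum by (intro sum.neutral ballI) (auto simp: lookup_single when_def)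
  moreover have "generic_value (map fst xs) (map fst ys) \<mu> = 0"
    using False unfolding generic_value_def by (intro sum.neutral ballI) auto
  ultimately show ?thesis
    by (simp add: teich_0)
qed

lemma tau_law_generic_value:
  "tau_law p n (generic_value (map fst xs) (map fst ys)) (exponents (map snd xs) (map snd ys))
    = wpr (n + 1) (gcoef (\<lambda>v \<phi>. teich (\<phi> v :: 'k)) (p ^ n) xs ys)"
proof -
  interpret ring_image "mp (n + 1)" UNIV "mpoly_ring (witt_quot p (n + 1) :: (nat \<Rightarrow> 'k) set ring) (UNIV :: (nat + nat) set)"
    using ring_image_mp[of "n + 1" "UNIV :: (nat + nat) set"] by (simp add: polys_def)
  have "(\<lambda>\<mu>. teichmueller p (n + 1) (generic_value (map fst xs) (map fst ys) \<mu>)) =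
      mp (n + 1) (gform (\<lambda>v \<phi>. teich (\<phi> v)) xs ys)"
    by (simp only: mp_def fun_eq_iff teichmueller_eq gform_teich_lookup) simp
  then show ?thesis
    unfolding tau_law_def by (simp only: hom_power UNIV_I) (simp only: mp_def gcoef_def exponents_eq)
qed

end

text \<open>The truncation level \<open>j\<close> and the degree \<open>d\<close> are parameters
  tied to \<open>n\<close> by equations, which keeps them atomic in the terms of the divided power
  construction.\<close>

locale omega_space = witt_char p K + vector_space scale
  for p :: nat and K :: "'k::{field,finite} itself"
    and scale :: "'k \<Rightarrow> 'v::ab_group_add \<Rightarrow> 'v" +
  fixes n j d :: nat and V :: "'v set"
  assumes j_eq: "j = n + 1" and d_eq: "d = p ^ n"
    and V: "subspace V" and finite_V: "finite V"
begin

lemma j_pos: "j > 0"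
  by (simp add: j_eq)

lemma witt_module_simps:
  "carrier (witt_module scale V) = V" "x \<oplus>\<^bsub>witt_module scale V\<^esub> y = x + y"
  "wpr j a \<odot>\<^bsub>witt_module scale V\<^esub> x = scale (wcomp a 0) x"
  by (simp_all add: witt_module_def residue_wpr[OF j_pos])

lemma witt_dual_simps:
  "carrier (witt_dual scale V) = dual_space scale V"
  "\<phi> \<oplus>\<^bsub>witt_dual scale V\<^esub> \<psi> = (\<lambda>v\<in>V. \<phi> v + \<psi> v)"
  "wpr j a \<odot>\<^bsub>witt_dual scale V\<^esub> \<phi> = (\<lambda>v\<in>V. wcomp a 0 * \<phi> v)"
  by (simp_all add: witt_dual_def residue_wpr[OF j_pos])

lemma dual_space_closed:
  "\<phi> \<in> dual_space scale V \<Longrightarrow> \<psi> \<in> dual_space scale V \<Longrightarrow> (\<lambda>v\<in>V. \<phi> v + \<psi> v) \<in> dual_space scale V"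
  "\<phi> \<in> dual_space scale V \<Longrightarrow> (\<lambda>v\<in>V. a * \<phi> v) \<in> dual_space scale V"
  by (auto simp: dual_space_def subspace_add[OF V] subspace_scale[OF V] algebra_simps)

lemma dual_space_app:
  assumes "\<phi> \<in> dual_space scale V"
  shows "x \<in> V \<Longrightarrow> y \<in> V \<Longrightarrow> \<phi> (x + y) = \<phi> x + \<phi> y" "x \<in> V \<Longrightarrow> \<phi> (scale c x) = c * \<phi> x"
  using assms by (auto simp: dual_space_def)

sublocale dp_pair p K j "witt_module scale V" "witt_dual scale V" "\<lambda>v \<phi>. teich (\<phi> v)" n d
proof unfold_locales
  show "j = Suc n"
    by (simp add: j_eq)
  show "d = p ^ n"
    by (rule d_eq)
qed (simp_all add: witt_module_simps witt_dual_simps subspace_add[OF V] subspace_scale[OF V]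
    dual_space_closed dual_space_app teich_add_dvd teich_mult_dvd)

lemma pairing_eq: "pairing p n scale V = BB"
  unfolding pairing_def Let_def tau_law_generic_value j_eq[symmetric] d_eq[symmetric]
proof (rule the_equality, intro conjI allI impI)
  show "BB \<in> bilinear_forms M.R DM DN"
    by (rule BB_bilinear)
  show "BB (dp_monom M.R (witt_module scale V) xs) (dp_monom M.R (witt_dual scale V) ys) = wpr j (gcoef (\<lambda>v \<phi>. teich (\<phi> v)) d xs ys)"
    if "set xs \<subseteq> carrier (witt_module scale V) \<times> UNIV" "set ys \<subseteq> carrier (witt_dual scale V) \<times> UNIV"
      "sum_list (map snd xs) = d" "sum_list (map snd ys) = d" for xs ys
    using that by (rule BB_monom)
qed (blast intro: bilinear_form_unique)

section \<open>The kernel of the pairing and the quotient by it\<close>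

abbreviation "ker \<equiv> pairing_kernel p n scale V"

definition in_ker :: "('v \<times> nat, 'k wv) mpoly \<Rightarrow> bool" where
  "in_ker f \<longleftrightarrow> (\<forall>g\<in>N.hom_polys d. of_nat (p ^ j) dvd Bil f g)"

lemma cls_in_ker: "f \<in> M.hom_polys d \<Longrightarrow> M.cls f \<in> ker \<longleftrightarrow> in_ker f"
  unfolding pairing_kernel_def pairing_eq j_eq[symmetric] d_eq[symmetric]
  by (auto simp: M.H.carrier_image N.H.carrier_image BB_cls wpr_ops wpr_eq_iff in_ker_def)

lemma ker_image: "ker = M.cls ` {f \<in> M.hom_polys d. in_ker f}"
proof -
  have "ker \<subseteq> M.cls ` M.hom_polys d"
    unfolding pairing_kernel_def j_eq[symmetric] d_eq[symmetric] M.H.carrier_image by blast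
  then show ?thesis
    using cls_in_ker by auto
qed

lemma in_ker_0: "in_ker 0"
  by (simp add: in_ker_def Bil_swap)

lemma in_ker_add: "in_ker f \<Longrightarrow> in_ker g \<Longrightarrow> in_ker (f + g)"
  by (simp add: in_ker_def Bil_add_left)

lemma in_ker_uminus: "in_ker f \<Longrightarrow> in_ker (- f)"
  using Bil_minus_left[of 0 f] by (simp add: in_ker_def Bil_swap)

lemma in_ker_const_mult: "in_ker f \<Longrightarrow> in_ker (pm_single 0 a * f)"
  by (simp add: in_ker_def Bil_const_mult_left)

lemma ker_subgroup: "abelian_subgroup ker DM"
proof (rule abelian_subgroupI3)
  show "abelian_group DM"
    by (rule M.H.abelian_group_image)
  show "additive_subgroup ker DM"
  proof (rule additive_subgroup.intro, unfold_locales)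
    show "ker \<subseteq> carrier (add_monoid DM)"
      by (auto simp: ker_image M.H.carrier_image)
    fix x assume "x \<in> ker"
    then obtain f where f: "f \<in> M.hom_polys d" "in_ker f" "x = M.cls f"
      by (auto simp: ker_image)
    have "inv\<^bsub>add_monoid DM\<^esub> x = \<ominus>\<^bsub>DM\<^esub> x"
      by (simp add: a_inv_def)
    also have "\<dots> \<in> ker"
      using f by (auto simp: M.H.hom_a_inv cls_in_ker M.H.uminus_mem in_ker_uminus)
    finally show "inv\<^bsub>add_monoid DM\<^esub> x \<in> ker" .
  qed (auto simp: ker_image M.H.hom_add M.H.hom_zero M.H.add_mem in_ker_add M.H.zero_mem in_ker_0 intro!: imageI)
qed

definition qcls :: "('v \<times> nat, 'k wv) mpoly \<Rightarrow> (('v \<times> nat) multiset \<Rightarrow> (nat \<Rightarrow> 'k) set) set set" where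
  "qcls f = ker +>\<^bsub>DM\<^esub> M.cls f"

lemma qcls_eq_iff:
  assumes "f \<in> M.hom_polys d" "g \<in> M.hom_polys d"
  shows "qcls f = qcls g \<longleftrightarrow> in_ker (f - g)"
proof -
  interpret S: abelian_subgroup ker DM by (rule ker_subgroup)
  have car: "M.cls f \<in> carrier DM" "M.cls g \<in> carrier DM"
    using assms by (auto simp: M.H.carrier_image)
  have "qcls f = qcls g \<longleftrightarrow> M.cls f \<in> ker +>\<^bsub>DM\<^esub> M.cls g"
    using S.a_repr_independence'[OF _ car(2)] S.a_rcos_self[OF car(1)] unfolding qcls_def by metis
  also have "\<dots> \<longleftrightarrow> in_ker (f - g)"
  proof
    assume "M.cls f \<in> ker +>\<^bsub>DM\<^esub> M.cls g"
    then obtain h where h: "h \<in> M.hom_polys d" "in_ker h" "M.cls f = M.cls (h + g)"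
      using assms by (auto simp: a_r_coset_def r_coset_def ker_image M.H.hom_add)
    have "M.cls (f - (h + g)) = M.cls f \<ominus>\<^bsub>DM\<^esub> M.cls (h + g)"
      using assms h by (intro M.H.hom_minus[symmetric] M.H.add_mem)
    also have "\<dots> = M.cls (f - f)"
      using assms(1) unfolding h(3)[symmetric] by (rule M.H.hom_minus) (rule assms)
    finally have "M.cls (f - (h + g)) \<in> ker"
      by (simp add: cls_in_ker M.H.zero_mem in_ker_0)
    then have "in_ker (f - (h + g))"
      using assms h by (simp add: cls_in_ker M.H.add_mem M.H.minus_mem)
    from in_ker_add[OF this h(2)] show "in_ker (f - g)"
      by simp
  next
    assume "in_ker (f - g)"
    then have "M.cls (f - g) \<in> ker" "M.cls f = M.cls (f - g) \<oplus>\<^bsub>DM\<^esub> M.cls g"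
      using assms by (simp_all add: cls_in_ker M.H.minus_mem M.H.hom_add)
    then show "M.cls f \<in> ker +>\<^bsub>DM\<^esub> M.cls g"
      unfolding a_r_coset_def r_coset_def by auto
  qed
  finally show ?thesis .
qed

abbreviation "Om \<equiv> Omega p n scale V"

lemma Om_eq: "Om = quotient_module DM ker"
  unfolding Omega_def j_eq[symmetric] d_eq[symmetric] ..

sublocale Q: group_image qcls "M.hom_polys d" Om
proof -
  interpret S: abelian_subgroup ker DM by (rule ker_subgroup)
  show "group_image qcls (M.hom_polys d) Om"
  proof
    show "carrier Om = qcls ` M.hom_polys d"
      by (auto simp: Om_eq quotient_module_def A_RCOSETS_def' M.H.carrier_image qcls_def)
    have "M.cls 0 \<in> ker"
      by (simp add: cls_in_ker M.H.zero_mem in_ker_0)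
    then show "\<zero>\<^bsub>Om\<^esub> = qcls 0"
      by (simp add: Om_eq quotient_module_def qcls_def S.a_rcos_const)
  qed (auto simp: M.H.zero_mem M.H.add_mem M.H.uminus_mem Om_eq quotient_module_def qcls_def M.H.carrier_image
      S.a_rcos_sum M.H.hom_add)
qed

text \<open>The scalar multiple is defined as a union over all representatives; they give the same
  coset because the kernel is closed under scalars.\<close>

lemma Om_smult:
  assumes f: "f \<in> M.hom_polys d"
  shows "wpr j a \<odot>\<^bsub>Om\<^esub> qcls f = qcls (pm_single 0 a * f)"
proof -
  interpret S: abelian_subgroup ker DM by (rule ker_subgroup)
  have "ker +>\<^bsub>DM\<^esub> (wpr j a \<odot>\<^bsub>DM\<^esub> x) = qcls (pm_single 0 a * f)" if "x \<in> qcls f" for x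
  proof -
    obtain h where "h \<in> ker" "x = h \<oplus>\<^bsub>DM\<^esub> M.cls f"
      using \<open>x \<in> qcls f\<close> by (auto simp: qcls_def a_r_coset_def r_coset_def)
    then obtain g where g: "g \<in> M.hom_polys d" "in_ker g" "x = M.cls (g + f)"
      using f by (auto simp: ker_image M.H.hom_add)
    have "in_ker (pm_single 0 a * (g + f) - pm_single 0 a * f)"
      using in_ker_const_mult[OF g(2), of a] by (simp add: distrib_left)
    then have "qcls (pm_single 0 a * (g + f)) = qcls (pm_single 0 a * f)"
      using f g by (simp add: qcls_eq_iff M.hom_polys_const_mult M.H.add_mem)
    then show ?thesis
      using f g by (simp add: M.dp_part_smult M.H.add_mem qcls_def)
  qed
  moreover have "M.cls f \<in> qcls f"
    unfolding qcls_def using f by (intro S.a_rcos_self) (simp add: M.H.carrier_image)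
  ultimately show ?thesis
    by (auto simp: Om_eq quotient_module_def)
qed

section \<open>The submodule spanned by the generators\<close>

definition gen_poly :: "('v \<Rightarrow> 'k wv) \<Rightarrow> ('v \<times> nat, 'k wv) mpoly" where
  "gen_poly a = (\<Sum>v\<in>V. pm_single {#(v, d)#} (a v))"

text \<open>The element with coefficient \<open>a v\<close> at the generator of \<open>v\<close>. As
  \<open>V\<close> is finite, arbitrary functions serve as formal combinations.\<close>

definition Theta :: "('v \<Rightarrow> 'k wv) \<Rightarrow> (('v \<times> nat) multiset \<Rightarrow> (nat \<Rightarrow> 'k) set) set set" where
  "Theta a = qcls (gen_poly a)"

lemma single_gen_mem: "v \<in> V \<Longrightarrow> pm_single {#(v, d)#} c \<in> M.hom_polys d"
  using single_hom_polys(1)[of "[(v, d)]" c] by (simp add: witt_module_def)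

lemma gen_poly_mem: "gen_poly a \<in> M.hom_polys d"
  unfolding gen_poly_def by (intro M.H.sum_mem single_gen_mem)

lemma gen_poly_delta: "v \<in> V \<Longrightarrow> gen_poly (delta v) = pm_single {#(v, d)#} 1"
proof -
  assume "v \<in> V"
  moreover have "gen_poly (delta v) = (\<Sum>u\<in>V. if u = v then pm_single {#(v, d)#} 1 else 0)"
    unfolding gen_poly_def by (intro sum.cong) (auto simp: delta_def)
  ultimately show ?thesis
    using finite_V by (simp add: sum.delta)
qed

lemma omega_elem_eq: "v \<in> V \<Longrightarrow> omega_elem p n scale V v = Theta (delta v)"
  unfolding omega_elem_def j_eq[symmetric] d_eq[symmetric]
  by (simp add: Theta_def gen_poly_delta qcls_def M.dp_monom_eq)

lemma Theta_add: "Theta a \<oplus>\<^bsub>Om\<^esub> Theta b = Theta (\<lambda>v. a v + b v)"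
  by (simp add: Theta_def Q.hom_add gen_poly_mem) (simp add: gen_poly_def single_add sum.distrib)

lemma Theta_smult: "wpr j c \<odot>\<^bsub>Om\<^esub> Theta a = Theta (\<lambda>v. c * a v)"
  by (simp add: Theta_def Om_smult gen_poly_mem) (simp add: gen_poly_def sum_distrib_left mult_single)

lemma Theta_0: "\<zero>\<^bsub>Om\<^esub> = Theta (\<lambda>v. 0)"
  by (simp add: Theta_def Q.hom_zero gen_poly_def)

lemma in_ker_gen_poly: "in_ker (gen_poly a) \<longleftrightarrow> omega_rel p n scale V a"
proof -
  let ?S = "\<lambda>\<nu>. \<Sum>v\<in>V. a v * (of_nat (mnom (image_mset snd \<nu>)) * teich_monom v \<nu>)"
  \<comment> \<open>With a single symbol on the left every linear form is a monomial in one
    variable, so the coefficient sought is the full product of Teichmueller powers.\<close>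
  have W: "W {#(v, d)#} \<nu> = of_nat (mnom (image_mset snd \<nu>)) * teich_monom v \<nu>"
    if "mdeg \<nu> = d" for v and \<nu> :: "(('v \<Rightarrow> 'k) \<times> nat) multiset"
  proof -
    have 1: "mset_list {#(v, d)#} = [(v, d)]"
      using mset_mset_list[of "{#(v, d)#}"] by (metis mset_single_iff)
    have 2: "lform Inl F [(v, d)] = pm_single {#Inl 0#} (F v)" for F :: "'v \<Rightarrow> 'k wv"
      by (simp add: lform_def)
    have 3: "pm_single {#Inl 0 :: nat + nat#} c ^ b = pm_single (replicate_mset b (Inl 0)) (c ^ b)" for c :: "'k wv" and b
      by (induction b) (simp_all add: mult_single)
    have 4: "prod_mset (image_mset (\<lambda>(\<phi>, b). pm_single {#Inl 0 :: nat + nat#} (teich (\<phi> v)) ^ b) \<nu>) =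
        pm_single (replicate_mset (mdeg \<nu>) (Inl 0)) (teich_monom v \<nu>)"
    proof (induction \<nu>)
      case (add x \<nu>)
      have "replicate_mset b y + replicate_mset c y = replicate_mset (b + c) y" for b c and y :: "nat + nat"
        by (simp add: multiset_eq_iff)
      then show ?case
        using add by (cases x) (simp add: mdeg_def 3 mult_single)
    qed (simp add: mdeg_def)
    have "mdeg {#(v, d)#} = d"
      by (simp add: mdeg_def)
    then show ?thesis
      using that gcoef_right[of "mset_list \<nu>" d "\<lambda>v \<phi>. teich (\<phi> v)" "[(v, d)]"]
      by (simp add: M.form_pairing_def sum_list_mset_list 1 2 4 lexpo_def)
  qed
  have S: "pm_sum id (\<lambda>\<mu>. W \<mu> \<nu>) (gen_poly a) = ?S \<nu>" if "mdeg \<nu> = d" for \<nu>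
    unfolding gen_poly_def using W[OF that] by (simp add: pm_sum_sum pm_sum_single)
  have I: "set_mset \<nu> \<subseteq> carrier (witt_dual scale V) \<times> UNIV \<longleftrightarrow> set_mset \<nu> \<subseteq> dual_space scale V \<times> UNIV" for \<nu>
    by (simp add: witt_dual_def)
  show ?thesis
  proof
    assume L: "in_ker (gen_poly a)"
    have "of_nat (p ^ j) dvd ?S \<nu>" if "set_mset \<nu> \<subseteq> dual_space scale V \<times> UNIV" "mdeg \<nu> = d" for \<nu>
    proof -
      have "pm_single \<nu> 1 \<in> N.hom_polys d"
        using that by (auto simp: N.hom_polys_def polys_single I)
      then have "of_nat (p ^ j) dvd Bil (gen_poly a) (pm_single \<nu> 1)"
        using L unfolding in_ker_def by blast
      then show ?thesis
        using that by (simp add: Bil_def pm_sum_single S)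
    qed
    then show "omega_rel p n scale V a"
      unfolding omega_rel_def d_eq[symmetric] Suc_eq_plus1 j_eq[symmetric] by blast
  next
    assume R: "omega_rel p n scale V a"
    show "in_ker (gen_poly a)"
      unfolding in_ker_def Bil_def
    proof
      fix g assume g: "g \<in> N.hom_polys d"
      show "of_nat (p ^ j) dvd pm_sum id (\<lambda>\<nu>. pm_sum id (\<lambda>\<mu>. W \<mu> \<nu>) (gen_poly a)) g"
        unfolding pm_sum_def[of id _ g]
      proof (intro dvd_sum dvd_mult)
        fix \<nu> assume "\<nu> \<in> pm_keys g"
        then have \<nu>: "set_mset \<nu> \<subseteq> dual_space scale V \<times> UNIV" "mdeg \<nu> = d"
          using g by (auto simp: N.hom_polys_def polys_def witt_dual_simps(1))
        show "of_nat (p ^ j) dvd pm_sum id (\<lambda>\<mu>. W \<mu> \<nu>) (gen_poly a)"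
          unfolding S[OF \<nu>(2)]
          by (rule R[unfolded omega_rel_def d_eq[symmetric] Suc_eq_plus1 j_eq[symmetric], rule_format, OF \<nu>])
      qed
    qed
  qed
qed

lemma Theta_eq_iff: "Theta a = Theta b \<longleftrightarrow> omega_rel p n scale V (\<lambda>v. a v - b v)"
proof -
  have "gen_poly a - gen_poly b = gen_poly (\<lambda>v. a v - b v)"
    by (simp add: gen_poly_def single_diff sum_subtractf)
  then show ?thesis
    by (simp add: Theta_def qcls_eq_iff gen_poly_mem in_ker_gen_poly)
qed

lemma Theta_cong: "(\<And>v. v \<in> V \<Longrightarrow> a v = b v) \<Longrightarrow> Theta a = Theta b"
  by (simp add: Theta_def gen_poly_def)

lemma Theta_a_inv: "\<ominus>\<^bsub>Om\<^esub> Theta a = Theta (\<lambda>v. - a v)"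
  by (simp add: Theta_def Q.hom_a_inv gen_poly_mem) (simp add: gen_poly_def single_uminus sum_negf)

lemma Theta_mem: "Theta a \<in> carrier Om"
  by (simp add: Theta_def Q.carrier_image gen_poly_mem)

lemma submodule_range_Theta: "submodule (range Theta) M.R Om"
proof (intro submodule.intro subgroup.intro submodule_axioms.intro)
  fix x assume "x \<in> range Theta"
  then have "\<ominus>\<^bsub>Om\<^esub> x \<in> range Theta"
    by (auto simp: Theta_a_inv)
  then show "inv\<^bsub>add_monoid Om\<^esub> x \<in> range Theta"
    by (simp add: a_inv_def)
qed (auto simp: Theta_mem Theta_add Theta_0 wpr_ops Theta_smult)

lemma range_Theta_minimal:
  assumes N: "submodule N M.R Om" and sub: "omega_elem p n scale V ` V \<subseteq> N"
  shows "range Theta \<subseteq> N"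
proof
  fix x assume "x \<in> range Theta"
  then obtain a where x: "x = Theta a" by blast
  interpret N: submodule N M.R Om by (rule N)
  have gen: "qcls (pm_single {#(v, d)#} (a v)) \<in> N" if "v \<in> V" for v
  proof -
    have "qcls (pm_single {#(v, d)#} 1) \<in> N"
      using sub that by (auto simp: omega_elem_eq Theta_def gen_poly_delta)
    then have "wpr j (a v) \<odot>\<^bsub>Om\<^esub> qcls (pm_single {#(v, d)#} 1) \<in> N"
      by (intro N.smult_closed) (auto simp: wpr_ops)
    then show ?thesis
      using that by (simp add: Om_smult single_gen_mem mult_single)
  qed
  have "qcls (\<Sum>v\<in>F. pm_single {#(v, d)#} (a v)) \<in> N" if "finite F" "F \<subseteq> V" for F
    using that
  proof (induction F rule: finite_induct)
    case empty
    then show ?case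
      using N.one_closed by (simp add: Q.hom_zero)
  next
    case (insert v F)
    then have "qcls (pm_single {#(v, d)#} (a v)) \<oplus>\<^bsub>Om\<^esub> qcls (\<Sum>v\<in>F. pm_single {#(v, d)#} (a v)) \<in> N"
      using N.m_closed gen by simp
    then show ?case
      using insert by (simp add: Q.hom_add single_gen_mem M.H.sum_mem subset_iff)
  qed
  then show "x \<in> N"
    using finite_V by (simp add: x Theta_def gen_poly_def)
qed

lemma Omega_small_carrier: "carrier (Omega_small p n scale V) = range Theta"
  unfolding Omega_small_def j_eq[symmetric] partial_object.simps
  by (rule hull_unique)
    (use submodule_range_Theta range_Theta_minimal in \<open>auto simp: omega_elem_eq simp del: image_subset_iff\<close>)

end


subsection \<open>Modules presented by generators and relations\<close>

text \<open>Says that \<open>S\<close> is the module with generators \<open>V\<close> and relations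
  \<open>r\<close>, by way of the map \<open>\<Theta>\<close> from coefficient functions. These
  functions are total, so the last clause makes their values outside \<open>V\<close>
  irrelevant.\<close>

definition presented :: "(nat \<Rightarrow> 'k::{field,finite}, 's) module \<Rightarrow> 'v set \<Rightarrow> (('v \<Rightarrow> 'k wv) \<Rightarrow> 's) \<Rightarrow> (('v \<Rightarrow> 'k wv) \<Rightarrow> bool) \<Rightarrow> bool" where
  "presented S V \<Theta> r \<longleftrightarrow> finite V \<and> carrier S = range \<Theta> \<and> \<zero>\<^bsub>S\<^esub> = \<Theta> (\<lambda>v. 0) \<and>
     (\<forall>a b. \<Theta> a \<oplus>\<^bsub>S\<^esub> \<Theta> b = \<Theta> (\<lambda>v. a v + b v)) \<and> (\<forall>c a. wcomp c \<odot>\<^bsub>S\<^esub> \<Theta> a = \<Theta> (\<lambda>v. c * a v)) \<and>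
     (\<forall>a b. \<Theta> a = \<Theta> b \<longleftrightarrow> r (\<lambda>v. a v - b v)) \<and> (\<forall>a b. (\<forall>v\<in>V. a v = b v) \<longrightarrow> \<Theta> a = \<Theta> b)"

lemma (in omega_space) Omega_small_presented:
  "presented (Omega_small p n scale V) V Theta (omega_rel p n scale V)"
proof -
  have "witt_proj p (n + 1) (wcomp c) = wpr j c" for c
    by (simp add: wpr_def j_eq)
  then have "wcomp c \<odot>\<^bsub>Omega_small p n scale V\<^esub> Theta a = Theta (\<lambda>v. c * a v)" for c a
    by (simp add: Omega_small_def Theta_smult)
  moreover have "\<zero>\<^bsub>Omega_small p n scale V\<^esub> = Theta (\<lambda>v. 0)"
    "\<And>a b. Theta a \<oplus>\<^bsub>Omega_small p n scale V\<^esub> Theta b = Theta (\<lambda>v. a v + b v)"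
    by (simp_all add: Omega_small_def Theta_0 Theta_add)
  ultimately show ?thesis
    unfolding presented_def
    by (intro conjI allI impI finite_V Omega_small_carrier Theta_eq_iff Theta_cong) auto
qed

lemma presentedD:
  assumes "presented S V \<Theta> r"
  shows "finite V" "carrier S = range \<Theta>" "\<zero>\<^bsub>S\<^esub> = \<Theta> (\<lambda>v. 0)"
    "\<Theta> a \<oplus>\<^bsub>S\<^esub> \<Theta> b = \<Theta> (\<lambda>v. a v + b v)" "wcomp c \<odot>\<^bsub>S\<^esub> \<Theta> a = \<Theta> (\<lambda>v. c * a v)"
    "\<Theta> a = \<Theta> b \<longleftrightarrow> r (\<lambda>v. a v - b v)" "(\<And>v. v \<in> V \<Longrightarrow> a v = b v) \<Longrightarrow> \<Theta> a = \<Theta> b"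
  using assms unfolding presented_def by auto

text \<open>A linear map \<open>L\<close> of coefficient functions that preserves relations descends
  to the modules, and linearity with the values on generators leaves no other choice. This one
  argument evaluates the definite descriptions of the functorial map, the Frobenius and the
  transfer.\<close>

lemma presented_linear_map:
  fixes p :: nat
  assumes S: "presented S V \<Theta> r" and S': "presented S' V' \<Theta>' r'"
    and L_add: "\<And>a b. L (\<lambda>v. a v + b v) = (\<lambda>v. L a v + L b v)"
    and L_smult: "\<And>c a. L (\<lambda>v. c * a v) = (\<lambda>v. c * L a v)"
    and L_rel: "\<And>a. r a \<Longrightarrow> r' (L a)"
    and gen: "\<And>v. v \<in> V \<Longrightarrow> g v = \<Theta>' (L (delta v))" "\<And>v. v \<in> V \<Longrightarrow> e v = \<Theta> (delta v)"
  defines "h \<equiv> THE h. h \<in> linear_maps (witt p) S S' \<and> (\<forall>v\<in>V. h (e v) = g v)"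
  shows "h \<in> linear_maps (witt p) S S'" "h (\<Theta> a) = \<Theta>' (L a)"
proof -
  note P = presentedD[OF S] and P' = presentedD[OF S']
  have L0: "L (\<lambda>v. 0) = (\<lambda>v. 0)"
    using L_smult[of 0 "\<lambda>v. 0"] by simp
  have L_diff: "L (\<lambda>v. a v - b v) = (\<lambda>v. L a v - L b v)" for a b
    using L_add[of a "\<lambda>v. - 1 * b v"] by (simp only: L_smult) simp
  define h0 where "h0 = (\<lambda>x\<in>carrier S. \<Theta>' (L (SOME a. \<Theta> a = x)))"
  have h0: "h0 (\<Theta> a) = \<Theta>' (L a)" for a
  proof -
    define b where "b = (SOME b. \<Theta> b = \<Theta> a)"
    have "\<Theta> b = \<Theta> a"
      unfolding b_def by (rule someI[of _ a]) (rule refl)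
    then have "r' (L (\<lambda>v. b v - a v))"
      by (intro L_rel) (simp only: P(6))
    then have "\<Theta>' (L b) = \<Theta>' (L a)"
      unfolding P'(6) by (simp only: L_diff)
    then show ?thesis
      by (simp add: h0_def P(2) b_def)
  qed
  have smult: "c \<odot>\<^bsub>S\<^esub> \<Theta> a = \<Theta> (\<lambda>v. Wv c * a v)" "c \<odot>\<^bsub>S'\<^esub> \<Theta>' a' = \<Theta>' (\<lambda>v. Wv c * a' v)" for c a a'
    using P(5)[of "Wv c" a] P'(5)[of "Wv c" a'] by simp_all
  have h0_lin: "h0 \<in> linear_maps (witt p) S S'"
    unfolding linear_maps_def
  proof (intro CollectI conjI ballI)
    show "h0 \<in> carrier S \<rightarrow>\<^sub>E carrier S'"
      by (auto simp: P(2) P'(2) h0) (simp add: h0_def P(2))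
  qed (auto simp: P(2,4) P'(4) h0 L_add smult L_smult)
  have uniq: "k (\<Theta> a) = \<Theta>' (L a)" if k: "k \<in> linear_maps (witt p) S S'" "\<And>v. v \<in> V \<Longrightarrow> k (\<Theta> (delta v)) = \<Theta>' (L (delta v))" for k a
  proof -
    have k_add: "k (\<Theta> (\<lambda>v. a v + b v)) = k (\<Theta> a) \<oplus>\<^bsub>S'\<^esub> k (\<Theta> b)" for a b
      using k(1) unfolding linear_maps_def P(2) P(4)[symmetric] by blast
    have k_smult: "k (\<Theta> (\<lambda>v. c * a v)) = wcomp c \<odot>\<^bsub>S'\<^esub> k (\<Theta> a)" for c a
      using k(1) unfolding linear_maps_def P(2) P(5)[symmetric] witt_eq by auto
    have k_mem: "k (\<Theta> a) \<in> range \<Theta>'" for a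
      using k(1) unfolding linear_maps_def P(2) P'(2) by blast
    have k0: "k (\<Theta> (\<lambda>v. 0)) = \<Theta>' (\<lambda>v. 0)"
    proof -
      obtain b where b: "k (\<Theta> (\<lambda>v. 0)) = \<Theta>' b"
        using k_mem by blast
      have "k (\<Theta> (\<lambda>v. 0)) = wcomp 0 \<odot>\<^bsub>S'\<^esub> \<Theta>' b"
        using k_smult[of 0 "\<lambda>v. 0"] by (simp add: b)
      then show ?thesis
        by (simp add: P'(5))
    qed
    have "k (\<Theta> (\<lambda>u. if u \<in> F then a u else 0)) = \<Theta>' (L (\<lambda>u. if u \<in> F then a u else 0))" if "finite F" "F \<subseteq> V" for F
      using that
    proof (induction F rule: finite_induct)
      case (insert v F)
      have eq: "(\<lambda>u. if u \<in> insert v F then a u else 0) = (\<lambda>u. (if u \<in> F then a u else 0) + a v * delta v u)"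
        using insert by (auto simp: delta_def fun_eq_iff)
      have "k (\<Theta> (\<lambda>u. if u \<in> F then a u else 0)) = \<Theta>' (L (\<lambda>u. if u \<in> F then a u else 0))" "v \<in> V"
        using insert by auto
      then show ?case
        unfolding eq k_add k_smult L_add L_smult by (simp add: k(2) P'(4,5))
    qed (simp add: k0 L0)
    from this[OF P(1) subset_refl] have "k (\<Theta> (\<lambda>u. if u \<in> V then a u else 0)) = \<Theta>' (L (\<lambda>u. if u \<in> V then a u else 0))" .
    moreover have 1: "\<Theta> (\<lambda>u. if u \<in> V then a u else 0) = \<Theta> a"
      by (rule P(7)) simp
    \<comment> \<open>\<open>L\<close> may depend on values outside \<open>V\<close>. The equality
      holds because \<open>\<Theta>\<close> does not see them and \<open>h0\<close> is well defined
      on classes.\<close>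
    moreover have "\<Theta>' (L (\<lambda>u. if u \<in> V then a u else 0)) = \<Theta>' (L a)"
      unfolding h0[symmetric] 1 ..
    ultimately show ?thesis
      by simp
  qed
  have "h = h0"
    unfolding h_def
  proof (rule the_equality)
    show "h0 \<in> linear_maps (witt p) S S' \<and> (\<forall>v\<in>V. h0 (e v) = g v)"
      using h0_lin gen by (simp add: h0)
    fix k assume k: "k \<in> linear_maps (witt p) S S' \<and> (\<forall>v\<in>V. k (e v) = g v)"
    then have "k (\<Theta> (delta v)) = \<Theta>' (L (delta v))" if "v \<in> V" for v
      using that by (simp flip: gen)
    note uniq[OF conjunct1[OF k] this]
    then have kh: "k (\<Theta> a) = h0 (\<Theta> a)" for a
      by (simp only: h0)
    have "k \<in> extensional (carrier S)" "h0 \<in> extensional (carrier S)"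
      using k h0_lin by (auto simp: linear_maps_def PiE_def)
    then show "k = h0"
      by (rule extensionalityI) (auto simp: P(2) kh)
  qed
  then show "h \<in> linear_maps (witt p) S S'" "h (\<Theta> a) = \<Theta>' (L a)"
    using h0_lin h0 by simp_all
qed


section \<open>Relations between the generators\<close>

lemma sum_mset_image_mult: "sum_mset (image_mset ((*) c) A) = c * (sum_mset A :: nat)"
  by (induction A) (simp_all add: distrib_left)

lemma multiplicity_mult_nat:
  "prime (p::nat) \<Longrightarrow> a > 0 \<Longrightarrow> b > 0 \<Longrightarrow> multiplicity p (a * b) = multiplicity p a + multiplicity p b"
  by (rule prime_elem_multiplicity_mult_distrib) auto

text \<open>Among the \<open>p\<close> factors added in passing from \<open>(p N)!\<close> to
  \<open>(p (N+1))!\<close>, only the last one, \<open>p (N+1)\<close>, is divisible by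
  \<open>p\<close>.\<close>

lemma multiplicity_fact_mult:
  assumes p: "prime (p::nat)"
  shows "multiplicity p (fact (p * N) :: nat) = N + multiplicity p (fact N :: nat)"
proof (induction N)
  case (Suc N)
  have p0: "p > 0"
    using p by (rule prime_gt_0_nat)
  have *: "multiplicity p (fact (p * N + k) :: nat) = multiplicity p (fact (p * N) :: nat)" if "k < p" for k
    using that
  proof (induction k)
    case (Suc k)
    have "\<not> p dvd Suc (p * N + k)"
      using Suc.prems by (metis add_Suc_right dvd_add_right_iff dvd_triv_left nat_dvd_not_less zero_less_Suc)
    then have "multiplicity p (Suc (p * N + k)) = 0"
      by (rule not_dvd_imp_multiplicity_0)
    then show ?case
      using Suc by (simp add: multiplicity_mult_nat[OF p] del: mult_Suc)
  qed simp
  have "p * Suc N = Suc (p * N + (p - 1))"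
    using p0 by simp
  then have "(fact (p * Suc N) :: nat) = (p * Suc N) * fact (p * N + (p - 1))"
    by (metis fact_Suc of_nat_id)
  then have "multiplicity p (fact (p * Suc N) :: nat) = multiplicity p p + multiplicity p (Suc N) + multiplicity p (fact (p * N + (p - 1)) :: nat)"
    using p0 by (simp add: multiplicity_mult_nat[OF p] del: mult_Suc_right mult_Suc)
  also have "\<dots> = 1 + multiplicity p (Suc N) + (N + multiplicity p (fact N :: nat))"
    using *[of "p - 1"] p0 Suc p by (simp add: multiplicity_self prime_gt_1_nat)
  also have "\<dots> = Suc N + multiplicity p (fact (Suc N) :: nat)"
    by (simp add: multiplicity_mult_nat[OF p] del: mult_Suc)
  finally show ?case .
qed simp

lemma multiplicity_mnom:
  assumes p: "prime (p::nat)"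
  shows "multiplicity p (mnom A) + (\<Sum>a\<in>#A. multiplicity p (fact a :: nat)) = multiplicity p (fact (sum_mset A) :: nat)"
proof -
  have pos: "(0::nat) < prod_mset (image_mset fact A)" for A :: "nat multiset"
    by (induction A) auto
  have "multiplicity p (prod_mset (image_mset fact A) :: nat) = (\<Sum>a\<in>#A. multiplicity p (fact a :: nat))"
    using pos by (induction A) (simp_all add: multiplicity_mult_nat[OF p])
  then show ?thesis
    using multiplicity_mult_nat[OF p mnom_pos pos, of A A] by (simp add: mnom_mult_prod_fact)
qed

text \<open>Multiplying all entries by \<open>p\<close> adds the sum of the entries to the valuation
  of the numerator and the same number, entry by entry, to that of the denominator.\<close>

lemma multiplicity_mnom_mult:
  assumes p: "prime (p::nat)"
  shows "multiplicity p (mnom (image_mset ((*) (p ^ r)) A)) = multiplicity p (mnom A)"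
proof (induction r arbitrary: A)
  case (Suc r)
  have step: "multiplicity p (mnom (image_mset ((*) p) A)) = multiplicity p (mnom A)" for A
  proof -
    have "(\<Sum>a\<in>#image_mset ((*) p) A. multiplicity p (fact a :: nat)) = sum_mset A + (\<Sum>a\<in>#A. multiplicity p (fact a :: nat))"
      by (induction A) (simp_all add: multiplicity_fact_mult[OF p])
    moreover have "sum_mset (image_mset ((*) p) A) = p * sum_mset A"
      by (rule sum_mset_image_mult)
    ultimately show ?thesis
      using multiplicity_mnom[OF p, of "image_mset ((*) p) A"] multiplicity_mnom[OF p, of A]
      by (simp add: multiplicity_fact_mult[OF p])
  qed
  have "image_mset ((*) (p ^ Suc r)) A = image_mset ((*) p) (image_mset ((*) (p ^ r)) A)"
    unfolding image_mset.compositionality by (intro image_mset_cong) (simp add: mult.assoc)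
  then show ?case
    by (simp only: step Suc)
next
  case 0
  have "(*) (1::nat) = (\<lambda>a. a)"
    by auto
  then show ?case
    by (simp only: power_0 image_mset.identity image_mset_id id_apply)
qed

text \<open>By Pascal's rule \<open>(N-1 choose k)\<close> and \<open>(N-1 choose k+1)\<close> add
  up to \<open>(N choose k+1)\<close>. The latter is divisible by \<open>p\<close>, since
  \<open>p^i\<close> divides \<open>(k+1) (N choose k+1)\<close> while \<open>0 < k+1 < p^i\<close>.
  So indivisibility propagates from \<open>k = 0\<close>.\<close>

lemma prime_not_dvd_pred_choose:
  assumes p: "prime (p::nat)" and N: "p ^ i dvd N" "N > 0" and k: "k < p ^ i"
  shows "\<not> p dvd (N - 1 choose k)"
  using k
proof (induction k)
  case (Suc k)
  have "p dvd (N choose Suc k)"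
  proof (rule ccontr)
    assume "\<not> p dvd (N choose Suc k)"
    then have "coprime (p ^ i) (N choose Suc k)"
      using p by (simp add: prime_imp_coprime)
    moreover have "p ^ i dvd Suc k * (N choose Suc k)"
      using N times_binomial_minus1_eq[of "Suc k" N] by simp
    ultimately have "p ^ i dvd Suc k"
      by (simp only: coprime_dvd_mult_left_iff)
    then show False
      using Suc.prems by (simp add: nat_dvd_not_less)
  qed
  moreover have "N choose Suc k = (N - 1 choose k) + (N - 1 choose Suc k)"
    using N(2) by (cases N) auto
  ultimately show ?case
    using Suc by (metis Suc_lessD dvd_add_left_iff)
qed (use p in \<open>simp add: prime_nat_iff\<close>)

text \<open>With \<open>q = p^r\<close> and \<open>e\<close> the valuation of \<open>b\<close>,
  compare valuations in \<open>K (q b choose K) = q b (q b - 1 choose K - 1)\<close>: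
  \<open>K\<close> has valuation \<open>e\<close>, \<open>q b\<close> has \<open>r + e\<close>, and
  the last binomial is prime to \<open>p\<close> because \<open>K - 1 < p^(r+e)\<close>. The bound
  on \<open>K\<close> leaves an exponent of at least \<open>b\<close> behind.\<close>

lemma multiplicity_choose_split:
  fixes p b r :: nat
  assumes p: "prime (p::nat)" and b: "b > 0"
  defines "K \<equiv> (p ^ r - 1) * p ^ multiplicity p b"
  shows "K \<le> (p ^ r - 1) * b" "r > 0 \<Longrightarrow> multiplicity p (p ^ r * b choose K) = r"
proof -
  have le: "p ^ multiplicity p b \<le> b"
    using b by (intro dvd_imp_le multiplicity_dvd) auto
  then show "K \<le> (p ^ r - 1) * b"
    by (simp add: K_def)
  assume r: "r > 0"
  have p1: "p > 1"
    using p by (rule prime_gt_1_nat)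
  then have q: "p ^ r > 1"
    using r by (rule one_less_power)
  have K0: "K > 0"
    using q p1 by (simp add: K_def)
  have "\<not> p dvd p ^ r - 1"
  proof
    assume "p dvd p ^ r - 1"
    moreover have "p dvd p ^ r"
      using r by simp
    ultimately have "p dvd p ^ r - (p ^ r - 1)"
      by (rule dvd_diff_nat[rotated])
    then show False
      using q p1 by simp
  qed
  then have vK: "multiplicity p K = multiplicity p b"
    using q p1 unfolding K_def
    by (subst multiplicity_mult_nat[OF p]) (auto simp: not_dvd_imp_multiplicity_0 p)
  have vN: "multiplicity p (p ^ r * b) = r + multiplicity p b"
    using p1 b by (subst multiplicity_mult_nat[OF p]) (auto simp: p)
  have "K - 1 < p ^ (r + multiplicity p b)"
  proof -
    have "K \<le> p ^ r * p ^ multiplicity p b"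
      by (simp add: K_def)
    then show ?thesis
      using K0 by (simp add: power_add)
  qed
  then have "multiplicity p (p ^ r * b - 1 choose (K - 1)) = 0"
    using b p1 by (intro not_dvd_imp_multiplicity_0 prime_not_dvd_pred_choose[OF p, of "r + multiplicity p b"])
      (auto simp: power_add intro!: mult_dvd_mono multiplicity_dvd)
  moreover have "K * (p ^ r * b choose K) = (p ^ r * b) * (p ^ r * b - 1 choose (K - 1))"
    by (rule times_binomial_minus1_eq[OF K0])
  moreover have "K \<le> p ^ r * b" 
    using \<open>K \<le> (p ^ r - 1) * b\<close> by (meson diff_le_self le_trans mult_le_mono1)
  then have "p ^ r * b choose K > 0" "p ^ r * b - 1 choose (K - 1) > 0"
    using K0 by auto
  ultimately show "multiplicity p (p ^ r * b choose K) = r"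
    using multiplicity_mult_nat[OF p K0, of "p ^ r * b choose K"]
      multiplicity_mult_nat[OF p, of "p ^ r * b" "p ^ r * b - 1 choose (K - 1)"] vK vN b p1
    by simp
qed

section \<open>Frobenius and transfer on relations\<close>

context witt_char
begin

text \<open>Integers prime to \<open>p\<close> are units in W(k), so an integer coefficient may be
  exchanged for any other of at least the same valuation.\<close>

lemma of_nat_mult_dvd_multiplicity:
  fixes S :: "'k wv"
  assumes "of_nat (p ^ N) dvd of_nat a * S" "multiplicity p a \<le> multiplicity p b" "a > 0" "b > 0"
  shows "of_nat (p ^ N) dvd of_nat b * S"
proof -
  obtain a' where a': "a = p ^ multiplicity p a * a'" "\<not> p dvd a'"
    using multiplicity_decompose'[of a p] assms(3) prime_p by (metis not_prime_unit not_gr0)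
  have "p ^ multiplicity p a dvd b"
    using assms(2) by (rule multiplicity_dvd')
  then obtain b' where b': "b = p ^ multiplicity p a * b'" ..
  have "coprime a' p"
    using prime_imp_coprime[OF prime_p a'(2)] by (rule coprime_commute[THEN iffD1])
  then obtain y :: "'k wv" where y: "of_nat a' * y = 1"
    using wv_coprime_unit by blast
  have "of_nat b * S = of_nat (p ^ multiplicity p a) * of_nat b' * S"
    by (subst b') (simp only: of_nat_mult)
  also have "\<dots> = of_nat (p ^ multiplicity p a) * of_nat b' * S * (of_nat a' * y)"
    by (simp add: y)
  also have "\<dots> = of_nat b' * y * (of_nat (p ^ multiplicity p a * a') * S)"
    by (simp only: of_nat_mult mult_ac)
  also have "\<dots> = of_nat b' * y * (of_nat a * S)"
    by (simp flip: a'(1))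
  finally show ?thesis
    using assms(1) by simp
qed

end

locale witt_field = witt_char p K
  for p :: nat and K :: "'k::{field,finite} itself" +
  fixes r :: nat
  assumes card_k: "CARD('k) = p ^ r"
begin

lemma r_pos: "r > 0"
proof -
  have "CARD('k) > 1"
    using card_mono[of "UNIV :: 'k set" "{0, 1}"] by simp
  then show ?thesis
    using card_k by (cases r) auto
qed

lemma q_gt_1: "p ^ r > 1"
  using prime_gt_1_nat[OF prime_p] r_pos by (rule one_less_power)

lemma power_q_minus_1:
  assumes "(x :: 'k) \<noteq> 0"
  shows "x ^ (p ^ r - 1) = 1"
proof -
  have "bij_betw ((*) x) (- {0}) (- {0})"
    by (rule bij_betwI[of _ _ _ "(*) (inverse x)"]) (use assms in auto)
  then have "(\<Prod>y\<in>- {0}. x * y) = \<Prod>(- {0})"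
    by (rule prod.reindex_bij_betw)
  moreover have "card (- {0 :: 'k}) = p ^ r - 1"
    by (simp add: Compl_eq_Diff_UNIV card_k)
  ultimately show ?thesis
    by (simp add: prod.distrib)
qed

lemma power_q: "(x :: 'k) ^ (p ^ r) = x"
proof (cases "x = 0")
  case False
  have "p ^ r = Suc (p ^ r - 1)"
    using q_gt_1 by simp
  then show ?thesis
    by (metis power_Suc power_q_minus_1[OF False] mult_1_right)
qed (use prime_gt_0_nat[OF prime_p] in simp)

lemma teich_power_q: "teich (x :: 'k) ^ (p ^ r * b) = teich x ^ b"
  by (simp add: power_mult power_q flip: teich_power)

lemma omega_rel_frob_step:
  assumes "omega_rel p (n + r) scale V (a :: 'v::ab_group_add \<Rightarrow> 'k wv)"
  shows "omega_rel p n scale V a"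
  unfolding omega_rel_def
proof (intro allI impI)
  fix \<nu> :: "(('v \<Rightarrow> 'k) \<times> nat) multiset"
  assume \<nu>: "set_mset \<nu> \<subseteq> dual_space scale V \<times> UNIV" "mdeg \<nu> = p ^ n"
  define S where "S = (\<Sum>v\<in>V. a v * teich_monom v \<nu>)"
  define \<nu>' where "\<nu>' = image_mset (\<lambda>(\<phi>, b). (\<phi>, p ^ r * b)) \<nu>"
  have snd: "image_mset snd \<nu>' = image_mset ((*) (p ^ r)) (image_mset snd \<nu>)"
    by (simp add: \<nu>'_def image_mset.compositionality o_def case_prod_unfold)
  have deg: "mdeg \<nu>' = p ^ (n + r)"
    using \<nu>(2) unfolding mdeg_def snd by (simp add: power_add mult.commute sum_mset_image_mult)
  have sub: "set_mset \<nu>' \<subseteq> dual_space scale V \<times> UNIV"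
    using \<nu>(1) by (auto simp: \<nu>'_def)
  have T: "teich_monom v \<nu>' = teich_monom v \<nu>" for v
    by (simp add: \<nu>'_def image_mset.compositionality o_def case_prod_unfold teich_power_q)
  have "of_nat (p ^ Suc (n + r)) dvd (\<Sum>v\<in>V. a v * (of_nat (mnom (image_mset snd \<nu>')) *
      teich_monom v \<nu>))"
    using assms[unfolded omega_rel_def, rule_format, OF sub deg] unfolding T .
  then have "of_nat (p ^ Suc (n + r)) dvd of_nat (mnom (image_mset snd \<nu>')) * S"
    by (simp add: S_def sum_distrib_left mult_ac)
  then have "of_nat (p ^ Suc (n + r)) dvd of_nat (mnom (image_mset snd \<nu>)) * S"
    by (rule of_nat_mult_dvd_multiplicity) (auto simp: snd multiplicity_mnom_mult[OF prime_p] mnom_pos)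
  moreover have "of_nat (p ^ Suc n) dvd (of_nat (p ^ Suc (n + r)) :: 'k wv)"
    by (simp only: of_nat_power) (rule le_imp_power_dvd, simp)
  ultimately have "of_nat (p ^ Suc n) dvd of_nat (mnom (image_mset snd \<nu>)) * S"
    by (rule dvd_trans[rotated])
  then show "of_nat (p ^ Suc n) dvd (rel_sum V a \<nu>)"
    by (simp add: S_def sum_distrib_left mult_ac)
qed

text \<open>The indicator function of \<open>\<psi> \<noteq> 0\<close> is the Teichmueller lift of \<open>\<psi>^(q-1)\<close>. Splitting
  \<open>(q-1) p^e\<close> off an exponent \<open>q b\<close> with \<open>e = v\<^sub>p(b)\<close> multiplies the multinomial coefficient
  by a number of valuation \<open>r\<close>, which the drop by \<open>r\<close> levels compensates.\<close>

lemma omega_rel_transfer_step: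
  assumes rel: "omega_rel p (n + r) scale V (a :: 'v::ab_group_add \<Rightarrow> 'k wv)" and \<psi>: "\<psi> \<in> dual_space scale V"
  shows "omega_rel p n scale V (\<lambda>v. if \<psi> v = 0 then a v else 0)"
  unfolding omega_rel_def
proof (intro allI impI)
  fix \<nu> :: "(('v \<Rightarrow> 'k) \<times> nat) multiset"
  assume \<nu>: "set_mset \<nu> \<subseteq> dual_space scale V \<times> UNIV" "mdeg \<nu> = p ^ n"
  let ?A = "image_mset snd \<nu>"
  have "mdeg \<nu> > 0"
    using \<nu>(2) prime_gt_0_nat[OF prime_p] by simp
  \<comment> \<open>The exponent of this one functional is shared with \<open>\<psi>\<close>; all
    other exponents are just multiplied by \<open>q\<close>.\<close>
  then obtain \<phi>0 b0 where b0: "(\<phi>0, b0) \<in># \<nu>" "b0 > 0"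
    using mdeg_pos_ex by blast
  then obtain \<nu>0 where \<nu>0: "\<nu> = add_mset (\<phi>0, b0) \<nu>0"
    by (metis insert_DiffM)
  define k where "k = (p ^ r - 1) * p ^ multiplicity p b0"
  have k_le: "k \<le> (p ^ r - 1) * b0" and vk: "multiplicity p (p ^ r * b0 choose k) = r"
    unfolding k_def using multiplicity_choose_split[OF prime_p b0(2)] r_pos by blast+
  have kq: "b0 \<le> p ^ r * b0 - k" "k \<le> p ^ r * b0"
  proof -
    have "b0 \<le> p ^ r * b0"
      using q_gt_1 by simp
    then show "b0 \<le> p ^ r * b0 - k" "k \<le> p ^ r * b0"
      using k_le unfolding diff_mult_distrib by linarith+
  qed
  have k0: "k > 0"
    using q_gt_1 prime_gt_0_nat[OF prime_p] by (simp add: k_def)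
  have pow_k: "(x :: 'k) ^ k = (if x = 0 then 0 else 1)" for x
  proof (cases "x = 0")
    case False
    have "x ^ k = (x ^ (p ^ r - 1)) ^ (p ^ multiplicity p b0)"
      unfolding k_def by (rule power_mult)
    then show ?thesis
      by (simp only: power_q_minus_1[OF False] power_one False if_False)
  qed (use k0 in simp)
  \<comment> \<open>Away from 0, \<open>x^k = 1\<close> and \<open>x^q = x\<close>. At 0 both sides
    vanish, because an exponent of at least \<open>b0 > 0\<close> is left after removing
    \<open>k\<close>.\<close>
  have pow_b: "(x :: 'k) ^ (p ^ r * b0 - k) = x ^ b0" for x
  proof (cases "x = 0")
    case False
    have "x ^ (p ^ r * b0 - k) * x ^ k = x ^ (p ^ r * b0)"
      using kq by (simp flip: power_add)
    then show ?thesis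
      using False by (simp add: pow_k power_mult power_q)
  next
    case True
    have "p ^ r * b0 - k > 0"
      using kq b0 by linarith
    then show ?thesis
      using True b0 by (simp add: power_0_left)
  qed
  define \<mu> where "\<mu> = image_mset (\<lambda>(\<phi>, b). (\<phi>, p ^ r * b)) \<nu>0"
  define \<nu>' where "\<nu>' = add_mset (\<phi>0, p ^ r * b0 - k) (add_mset (\<psi>, k) \<mu>)"
  have snd: "image_mset snd \<mu> = image_mset ((*) (p ^ r)) (image_mset snd \<nu>0)"
    by (simp add: \<mu>_def image_mset.compositionality o_def case_prod_unfold)
  have "mdeg \<nu>' = p ^ r * b0 + mdeg \<mu>"
    using kq by (simp add: \<nu>'_def mdeg_def)
  also have "\<dots> = p ^ r * mdeg \<nu>"
    unfolding mdeg_def snd by (simp add: \<nu>0 distrib_left sum_mset_image_mult)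
  finally have deg: "mdeg \<nu>' = p ^ (n + r)"
    by (simp add: \<nu>(2) power_add mult.commute)
  have sub: "set_mset \<nu>' \<subseteq> dual_space scale V \<times> UNIV"
    using \<nu>(1) \<psi> by (auto simp: \<nu>'_def \<mu>_def \<nu>0)
  have "teich_monom v \<mu> = teich_monom v \<nu>0" for v
    by (simp add: \<mu>_def image_mset.compositionality o_def case_prod_unfold teich_power_q)
  then have T: "teich_monom v \<nu>' = (if \<psi> v = 0 then 0 else teich_monom v \<nu>)" for v
    by (simp add: \<nu>'_def \<nu>0 pow_b pow_k teich_0 teich_1 flip: teich_power)
  define S where "S = (\<Sum>v\<in>V. a v * teich_monom v \<nu>)"
  define S1 where "S1 = (\<Sum>v\<in>V. a v * (if \<psi> v = 0 then 0 else teich_monom v \<nu>))"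
  have "of_nat (p ^ Suc (n + r)) dvd (rel_sum V a \<nu>')"
    using rel[unfolded omega_rel_def, rule_format, OF sub deg] .
  then have "of_nat (p ^ Suc (n + r)) dvd of_nat (mnom (image_mset snd \<nu>')) * S1"
    by (simp only: S1_def T sum_distrib_left mult_ac)
  moreover have "multiplicity p (mnom (image_mset snd \<nu>')) \<le> multiplicity p (p ^ r * mnom ?A)"
  proof -
    have "mnom (image_mset snd \<nu>') = (p ^ r * b0 choose (p ^ r * b0 - k)) * mnom (add_mset (p ^ r * b0) (image_mset snd \<mu>))"
      using mnom_split[of "p ^ r * b0 - k" k "image_mset snd \<mu>"] kq by (simp add: \<nu>'_def)
    also have "add_mset (p ^ r * b0) (image_mset snd \<mu>) = image_mset ((*) (p ^ r)) ?A"
      by (simp add: snd \<nu>0)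
    also have "(p ^ r * b0 choose (p ^ r * b0 - k)) = (p ^ r * b0 choose k)"
      using kq binomial_symmetric[of k "p ^ r * b0"] by simp
    finally have "multiplicity p (mnom (image_mset snd \<nu>')) = r + multiplicity p (mnom ?A)"
      using kq by (simp add: multiplicity_mult_nat[OF prime_p] mnom_pos vk multiplicity_mnom_mult[OF prime_p])
    also have "r + multiplicity p (mnom ?A) = multiplicity p (p ^ r * mnom ?A)"
      using prime_p by (simp add: multiplicity_mult_nat mnom_pos prime_gt_0_nat)
    finally show ?thesis
      by simp
  qed
  ultimately have "of_nat (p ^ Suc (n + r)) dvd of_nat (p ^ r * mnom ?A) * S1"
    by (rule of_nat_mult_dvd_multiplicity) (auto simp: mnom_pos prime_gt_0_nat[OF prime_p])
  then have "of_nat p ^ (r + Suc n) dvd of_nat p ^ r * (of_nat (mnom ?A) * S1)"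
    by (simp add: mult.assoc add.commute)
  \<comment> \<open>The \<open>r\<close> extra levels of the given relation pay for the factor
    \<open>p^r\<close> of the binomial coefficient.\<close>
  then have "of_nat p ^ Suc n dvd of_nat (mnom ?A) * S1"
    by (rule p_power_mult_cancel)
  moreover have "of_nat p ^ Suc n dvd of_nat (mnom ?A) * S"
    using omega_rel_frob_step[OF rel] \<nu> unfolding omega_rel_def S_def
    by (simp add: sum_distrib_left mult_ac)
  ultimately have "of_nat p ^ Suc n dvd of_nat (mnom ?A) * S - of_nat (mnom ?A) * S1"
    by (rule dvd_diff[rotated])
  \<comment> \<open>\<open>S1\<close> is the part of \<open>S\<close> with
    \<open>\<psi> v \<noteq> 0\<close>, so the difference is the part supported on the kernel of
    \<open>\<psi>\<close>.\<close>
  moreover have "S - S1 = (\<Sum>v\<in>V. (if \<psi> v = 0 then a v else 0) * teich_monom v \<nu>)"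
    unfolding S_def S1_def sum_subtractf[symmetric] by (intro sum.cong) auto
  then have "of_nat (mnom ?A) * S - of_nat (mnom ?A) * S1 = (\<Sum>v\<in>V. (if \<psi> v = 0 then a v else 0) * (of_nat (mnom ?A) * teich_monom v \<nu>))"
    unfolding right_diff_distrib[symmetric] by (simp add: sum_distrib_left mult_ac)
  ultimately show "of_nat (p ^ Suc n) dvd (\<Sum>v\<in>V. (if \<psi> v = 0 then a v else 0) * (of_nat (mnom ?A) * teich_monom v \<nu>))"
    by simp
qed

lemma omega_rel_frob:
  "omega_rel p (n + m * r) scale V (a :: 'v::ab_group_add \<Rightarrow> 'k wv) \<Longrightarrow> omega_rel p n scale V a"
proof (induction m)
  case (Suc m)
  have "n + Suc m * r = n + m * r + r"
    by simp
  then show ?case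
    using Suc omega_rel_frob_step by metis
qed simp

text \<open>Each functional uses up \<open>r\<close> levels, hence the induction over the
  functionals with the level generalised.\<close>

lemma omega_rel_transfer:
  assumes "finite \<Psi>" "\<Psi> \<subseteq> dual_space scale V"
    "omega_rel p (n + card \<Psi> * r) scale V (a :: 'v::ab_group_add \<Rightarrow> 'k wv)"
  shows "omega_rel p n scale V (\<lambda>v. if \<forall>\<psi>\<in>\<Psi>. \<psi> v = 0 then a v else 0)"
  using assms
proof (induction \<Psi> arbitrary: n rule: finite_induct)
  case (insert \<psi> \<Psi>)
  have "omega_rel p (n + r) scale V (\<lambda>v. if \<forall>\<psi>\<in>\<Psi>. \<psi> v = 0 then a v else 0)"
    using insert.prems insert.hyps by (intro insert.IH) (auto simp: algebra_simps)
  from omega_rel_transfer_step[OF this, of \<psi>]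
  have "omega_rel p n scale V (\<lambda>v. if \<psi> v = 0 then if \<forall>\<psi>\<in>\<Psi>. \<psi> v = 0 then a v else 0 else 0)"
    using insert.prems by simp
  moreover have "(\<lambda>v. if \<psi> v = 0 then if \<forall>\<psi>\<in>\<Psi>. \<psi> v = 0 then a v else 0 else 0) = (\<lambda>v. if \<forall>\<psi>\<in>insert \<psi> \<Psi>. \<psi> v = 0 then a v else 0)"
    by auto
  ultimately show ?case
    by simp
qed simp

end


section \<open>Counting subspaces\<close>

text \<open>The product \<open>(q-1) (q^2-1) ... (q^n-1)\<close>. The Gaussian binomial coefficient
  is the quotient of \<open>qfact q n\<close> by \<open>qfact q a * qfact q (n-a)\<close>.\<close>

definition qfact :: "nat \<Rightarrow> nat \<Rightarrow> nat" where
  "qfact q n = (\<Prod>i<n. q ^ Suc i - 1)"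

lemma qfact_descending: "a \<le> e \<Longrightarrow> (\<Prod>i<a. q ^ (e - i) - 1) * qfact q (e - a) = qfact q e"
proof (induction a)
  case (Suc a)
  have "qfact q (e - a) = (q ^ (e - a) - 1) * qfact q (e - Suc a)"
    using Suc.prems by (metis Suc_diff_Suc Suc_le_lessD mult.commute prod.lessThan_Suc qfact_def)
  then show ?case
    using Suc by (simp add: mult.assoc)
qed simp

lemma qfact_descending': "(\<Prod>i<a. q ^ (a - i) - 1) = qfact q a"
  using qfact_descending[of a a q] by (simp add: qfact_def)

lemma qfact_pos: "q > 1 \<Longrightarrow> qfact q n > 0"
  unfolding qfact_def by (intro prod_pos) (use one_less_power[of q "Suc _"] in \<open>simp del: power_Suc\<close>)

text \<open>Every factor is congruent to -1 modulo \<open>p\<close>. The cardinality of a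
  Grassmannian divides such a product, so it is prime to \<open>p\<close> and invertible in
  W(k).\<close>

lemma prime_not_dvd_qfact:
  assumes "prime (p::nat)" "p dvd q" "q > 0"
  shows "\<not> p dvd qfact q n"
proof -
  have "\<not> p dvd q ^ Suc i - 1" for i
  proof
    assume "p dvd q ^ Suc i - 1"
    moreover have "p dvd q ^ Suc i"
      using assms(2) by simp
    ultimately have "p dvd q ^ Suc i - (q ^ Suc i - 1)"
      by (rule dvd_diff_nat[rotated])
    then show False
      using assms by (simp add: Suc_leI prime_nat_iff)
  qed
  then show ?thesis
    unfolding qfact_def using assms(1) by (simp add: prime_dvd_prod_iff del: power_Suc)
qed

locale finite_field_space = vector_space scale
  for scale :: "'k::{field,finite} \<Rightarrow> 'v::ab_group_add \<Rightarrow> 'v"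
begin

lemma q_gt_1: "CARD('k) > 1"
  using card_mono[of "UNIV :: 'k set" "{0, 1}"] by simp

lemma card_span:
  assumes "finite S" "independent S"
  shows "finite (span S) \<and> card (span S) = CARD('k) ^ card S"
  using assms
proof (induction S rule: finite_induct)
  case (insert x S)
  have x: "x \<notin> span S" "independent S"
    using insert by (auto simp: independent_insert)
  let ?f = "\<lambda>(c, y). scale c x + y"
  have "span (insert x S) = ?f ` (UNIV \<times> span S)"
  proof (intro equalityI subsetI)
    fix z assume "z \<in> span (insert x S)"
    then obtain c where "z - scale c x \<in> span S"
      by (auto simp: span_insert)
    then show "z \<in> ?f ` (UNIV \<times> span S)"
      by (auto intro!: image_eqI[of _ _ "(c, z - scale c x)"])
  next
    fix z assume "z \<in> ?f ` (UNIV \<times> span S)"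
    then obtain c y where "z = scale c x + y" "y \<in> span S"
      by auto
    then show "z \<in> span (insert x S)"
      by (auto simp: span_insert intro!: exI[of _ c])
  qed
  moreover have "inj_on ?f (UNIV \<times> span S)"
  proof (rule inj_onI, clarify)
    fix c c' y y' assume y: "y \<in> span S" "y' \<in> span S" and eq: "scale c x + y = scale c' x + y'"
    have "scale c x = scale c' x + y' - y"
      using eq by (metis add_diff_cancel_right')
    then have "scale (c - c') x = y' - y"
      by (simp add: scale_left_diff_distrib)
    then have "scale (c - c') x \<in> span S"
      using y by (simp add: span_diff)
    then have "c = c'"
      using x span_scale[of "scale (c - c') x" S "inverse (c - c')"] by (cases "c = c'") auto
    then show "c = c' \<and> y = y'"
      using eq by simp
  qed
  ultimately show ?case
    using insert x by (simp add: card_image card_cartesian_product)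
qed simp

lemma card_subspace:
  assumes "subspace W" "finite W"
  shows "card W = CARD('k) ^ dim W"
proof -
  obtain B where B: "B \<subseteq> W" "independent B" "W \<subseteq> span B" "card B = dim W"
    using basis_exists by blast
  then have "span B = W"
    using assms(1) by (metis span_minimal subset_antisym)
  then show ?thesis
    using card_span[of B] B assms(2) finite_subset by metis
qed

text \<open>Lists are built from the right: each head lies outside the span of \<open>S\<close> and
  the tail, so the list completes an independent \<open>S\<close> to a larger independent
  set.\<close>

fun extends :: "'v set \<Rightarrow> 'v list \<Rightarrow> bool" where
  "extends S [] \<longleftrightarrow> True"
| "extends S (x # xs) \<longleftrightarrow> x \<notin> span (S \<union> set xs) \<and> extends S xs"

lemma extends_independent:
  assumes "finite S" "independent S"
  shows "extends S xs \<Longrightarrow> independent (S \<union> set xs) \<and> card (S \<union> set xs) = card S + length xs"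
proof (induction xs)
  case (Cons x xs)
  then have "x \<notin> S \<union> set xs"
    using span_base by fastforce
  then show ?case
    using Cons assms(1) by (auto simp: independent_insert)
qed (use assms in simp)

definition frames :: "'v set \<Rightarrow> 'v set \<Rightarrow> nat \<Rightarrow> 'v list set" where
  "frames S U a = {xs. length xs = a \<and> set xs \<subseteq> U \<and> extends S xs}"

lemma card_frames:
  assumes S: "finite S" "independent S" "S \<subseteq> U" and U: "subspace U" "finite U"
  shows "finite (frames S U a) \<and> card (frames S U a) = (\<Prod>i<a. card U - CARD('k) ^ (card S + i))"
proof (induction a)
  case 0
  have "frames S U 0 = {[]}"
    by (auto simp: frames_def)
  then show ?case
    by simp
next
  case (Suc a)
  let ?f = "\<lambda>(xs, x). x # xs"
  have eq: "frames S U (Suc a) = ?f ` (SIGMA xs:frames S U a. U - span (S \<union> set xs))"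
    by (auto simp: frames_def length_Suc_conv image_iff)
  have "card (U - span (S \<union> set xs)) = card U - CARD('k) ^ (card S + a)" if "xs \<in> frames S U a" for xs
  proof -
    have "span (S \<union> set xs) \<subseteq> U"
      using that S U by (intro span_minimal) (auto simp: frames_def)
    moreover have "card (span (S \<union> set xs)) = CARD('k) ^ (card S + a)" "finite (span (S \<union> set xs))"
      using that extends_independent[OF S(1,2), of xs] card_span[of "S \<union> set xs"] S(1)
      by (auto simp: frames_def)
    ultimately show ?thesis
      by (simp add: card_Diff_subset)
  qed
  then have "card (SIGMA xs:frames S U a. U - span (S \<union> set xs)) = card (frames S U a) * (card U - CARD('k) ^ (card S + a))"
    using Suc U by (simp add: card_SigmaI)
  moreover have "inj_on ?f (SIGMA xs:frames S U a. U - span (S \<union> set xs))"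
    by (auto simp: inj_on_def)
  ultimately show ?case
    unfolding eq using Suc U by (auto simp: card_image)
qed

text \<open>Double counting of frames: a list of \<open>a\<close> vectors extending \<open>S\<close>
  in \<open>U\<close> spans, together with \<open>S\<close>, exactly one such \<open>W\<close>, and
  every \<open>W\<close> contains equally many of them. Empty \<open>S\<close> gives the
  Grassmannian, a single vector the subspaces through it.\<close>

lemma card_intermediate_subspaces:
  assumes S: "finite S" "independent S" "S \<subseteq> U" and U: "subspace U" "finite U" "card U = CARD('k) ^ (card S + e)"
    and a: "a \<le> e"
  shows "card {W. subspace W \<and> S \<subseteq> W \<and> W \<subseteq> U \<and> dim W = card S + a} * qfact CARD('k) a * qfact CARD('k) (e - a) = qfact CARD('k) e"
proof -
  let ?G = "{W. subspace W \<and> S \<subseteq> W \<and> W \<subseteq> U \<and> dim W = card S + a}"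
  let ?s = "card S"
  have cardW: "card W = CARD('k) ^ (?s + a)" "finite W" if "W \<in> ?G" for W
    using that U(2) card_subspace[of W] finite_subset[of W U] by auto
  have spanW: "span (S \<union> set xs) = W" if "W \<in> ?G" "xs \<in> frames S W a" for W xs
  proof (rule card_subset_eq)
    have W: "subspace W" "S \<union> set xs \<subseteq> W" and xs: "extends S xs" "length xs = a"
      using that by (auto simp: frames_def)
    show "finite W"
      by (rule cardW[OF that(1)])
    show "span (S \<union> set xs) \<subseteq> W"
      using W by (intro span_minimal)
    show "card (span (S \<union> set xs)) = card W"
      using extends_independent[OF S(1,2) xs(1)] card_span[of "S \<union> set xs"] S(1) xs(2)
      by (simp add: cardW(1)[OF that(1)])
  qed
  have finG: "finite ?G"
    by (rule finite_subset[of _ "Pow U"]) (use U in auto)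
  have un: "frames S U a = (\<Union>W\<in>?G. frames S W a)"
  proof (intro equalityI subsetI)
    fix xs assume xs: "xs \<in> frames S U a"
    let ?W = "span (S \<union> set xs)"
    have I: "independent (S \<union> set xs)" "card (S \<union> set xs) = ?s + a"
      using xs extends_independent[OF S(1,2), of xs] by (auto simp: frames_def)
    have "?W \<subseteq> U"
      using xs S U by (intro span_minimal) (auto simp: frames_def)
    then have "?W \<in> ?G"
      using I dim_span_eq_card_independent[OF I(1)] span_superset[of "S \<union> set xs"] by auto
    moreover have "xs \<in> frames S ?W a"
      using xs span_superset[of "S \<union> set xs"] by (auto simp: frames_def)
    ultimately show "xs \<in> (\<Union>W\<in>?G. frames S W a)"
      by blast
  qed (auto simp: frames_def)
  have fr: "finite (frames S W a) \<and> card (frames S W a) = (\<Prod>i<a. CARD('k) ^ (?s + a) - CARD('k) ^ (?s + i))" if "W \<in> ?G" for W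
    using card_frames[OF S(1,2), of W a] that cardW[OF that] by simp
  have "card (frames S U a) = (\<Sum>W\<in>?G. card (frames S W a))"
    unfolding un
  proof (rule card_UN_disjoint[OF finG])
    show "\<forall>W\<in>?G. finite (frames S W a)"
      using fr by blast
    show "\<forall>W\<in>?G. \<forall>W'\<in>?G. W \<noteq> W' \<longrightarrow> frames S W a \<inter> frames S W' a = {}"
      using spanW by blast
  qed
  also have "\<dots> = card ?G * (\<Prod>i<a. CARD('k) ^ (?s + a) - CARD('k) ^ (?s + i))"
    using fr by simp
  finally have "card ?G * (\<Prod>i<a. CARD('k) ^ (?s + a) - CARD('k) ^ (?s + i)) = (\<Prod>i<a. CARD('k) ^ (?s + e) - CARD('k) ^ (?s + i))"
    using card_frames[OF S U(1,2), of a] U(3) by simp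
  \<comment> \<open>The powers of \<open>q\<close> occur in both counts and cancel, so the result
    depends on \<open>e\<close> and \<open>a\<close> but not on the size of
    \<open>S\<close>.\<close>
  moreover have split: "(\<Prod>i<a. CARD('k) ^ (?s + c) - CARD('k) ^ (?s + i)) = (\<Prod>i<a. CARD('k) ^ (?s + i)) * (\<Prod>i<a. CARD('k) ^ (c - i) - 1)" if "a \<le> c" for c
    unfolding prod.distrib[symmetric] using that
    by (intro prod.cong refl) (auto simp: diff_mult_distrib2 simp flip: power_add)
  moreover have "(\<Prod>i<a. CARD('k) ^ (?s + i)) > 0"
    by (intro prod_pos) simp
  ultimately have "card ?G * (\<Prod>i<a. CARD('k) ^ (a - i) - 1) = (\<Prod>i<a. CARD('k) ^ (e - i) - 1)"
    using a by (simp add: split mult.left_commute)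
  then have "card ?G * qfact CARD('k) a * qfact CARD('k) (e - a) = (\<Prod>i<a. CARD('k) ^ (e - i) - 1) * qfact CARD('k) (e - a)"
    unfolding qfact_descending' by simp
  then show ?thesis
    by (simp only: qfact_descending[OF a])
qed

text \<open>The functionals are the coordinates along the vectors that complete a basis of
  \<open>W\<close> to one of the whole space. They are distinct, since the coordinate along
  \<open>b\<close> is 1 at \<open>b\<close> and 0 at the other basis vectors.\<close>

lemma subspace_eq_common_kernel:
  assumes W: "subspace W" and fin: "finite (UNIV :: 'v set)"
  shows "\<exists>\<Psi>. finite \<Psi> \<and> \<Psi> \<subseteq> dual_space scale UNIV \<and> card \<Psi> = dim UNIV - dim W \<and> W = {v. \<forall>\<psi>\<in>\<Psi>. \<psi> v = 0}"
proof -
  obtain C where C: "C \<subseteq> W" "independent C" "W \<subseteq> span C" "card C = dim W"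
    using basis_exists by blast
  obtain E where E: "C \<subseteq> E" "independent E" "UNIV \<subseteq> span E"
    using maximal_independent_subset_extend[of C UNIV] C by auto
  have finite: "finite C" "finite E"
    using fin by (auto intro: finite_subset)
  have E_span: "v \<in> span E" for v
    using E(3) by auto
  have W_span: "W = span C"
    using C W by (metis span_minimal subset_antisym)
  let ?R = "\<lambda>b v. representation E v b"
  have "card E = dim UNIV"
    using E by (intro basis_card_eq_dim) auto
  have inj: "inj_on ?R (E - C)"
  proof (rule inj_onI)
    fix b b' assume b: "b \<in> E - C" "b' \<in> E - C" and eq: "?R b = ?R b'"
    have "?R b b = ?R b' b"
      using eq by meson
    then show "b = b'"
      using b E(2) by (auto simp: representation_basis split: if_splits)
  qed
  show ?thesis
  proof (intro exI[of _ "?R ` (E - C)"] conjI)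
    show "finite (?R ` (E - C))"
      using finite by simp
    show "?R ` (E - C) \<subseteq> dual_space scale UNIV"
      using E_span by (auto simp: dual_space_def representation_add[OF E(2)] representation_scale[OF E(2)])
    show "card (?R ` (E - C)) = dim UNIV - dim W"
      using inj finite E(1) C(4) \<open>card E = dim UNIV\<close> by (simp add: card_image card_Diff_subset)
    show "W = {v. \<forall>\<psi>\<in>?R ` (E - C). \<psi> v = 0}"
    proof (intro equalityI subsetI)
      fix v assume "v \<in> W"
      then have "representation E v = representation C v"
        using W_span E by (intro representation_extend) auto
      then show "v \<in> {v. \<forall>\<psi>\<in>?R ` (E - C). \<psi> v = 0}"
        using representation_ne_zero by fastforce
    next
      fix v assume "v \<in> {v. \<forall>\<psi>\<in>?R ` (E - C). \<psi> v = 0}"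
      then have "b \<in> C" if "representation E v b \<noteq> 0" for b
        using that representation_ne_zero by fastforce
      then have "(\<Sum>b | representation E v b \<noteq> 0. scale (representation E v b) b) \<in> span C"
        by (intro span_sum span_scale span_base) auto
      then show "v \<in> W"
        using sum_nonzero_representation_eq[OF E(2) E_span[of v]] W_span by simp
    qed
  qed
qed

lemma dual_space_extend:
  assumes W: "subspace W"
  shows "\<exists>P. range P \<subseteq> W \<and> (\<forall>v\<in>W. P v = v) \<and> (\<forall>\<phi>\<in>dual_space scale W. \<phi> \<circ> P \<in> dual_space scale UNIV)"
proof -
  interpret vector_space_pair scale scale ..
  obtain P where P: "range P \<subseteq> W" "Vector_Spaces.linear scale scale P" "\<forall>v\<in>W. P v = v"
    using linear_exists_left_inverse_on[of "\<lambda>x. x" W] W by (auto simp: linear_ident)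
  have "\<phi> \<circ> P \<in> dual_space scale UNIV" if "\<phi> \<in> dual_space scale W" for \<phi>
    using that P(1) by (auto simp: dual_space_def linear_add[OF P(2)] linear_scale[OF P(2)] image_subset_iff)
  then show ?thesis
    using P by blast
qed

text \<open>Functionals on \<open>W\<close> extend to the whole space by composition with a
  projection onto \<open>W\<close>. This changes no value on \<open>W\<close>, so a relation
  supported there can be tested on either space; \<open>omega_rel_extend\<close> is the converse, by
  restricting functionals.\<close>

lemma omega_rel_restrict:
  fixes a :: "'v \<Rightarrow> 'k wv"
  assumes W: "subspace W" and fin: "finite (UNIV :: 'v set)"
    and rel: "omega_rel p n scale UNIV (\<lambda>v. if v \<in> W then a v else 0)"
  shows "omega_rel p n scale W a"
  unfolding omega_rel_def
proof (intro allI impI)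
  fix \<nu> :: "(('v \<Rightarrow> 'k) \<times> nat) multiset"
  assume \<nu>: "set_mset \<nu> \<subseteq> dual_space scale W \<times> UNIV" "mdeg \<nu> = p ^ n"
  obtain P where P: "range P \<subseteq> W" "\<And>v. v \<in> W \<Longrightarrow> P v = v" "\<And>\<phi>. \<phi> \<in> dual_space scale W \<Longrightarrow> \<phi> \<circ> P \<in> dual_space scale UNIV"
    using dual_space_extend[OF W] by blast
  define \<nu>' where "\<nu>' = image_mset (\<lambda>(\<phi>, b). (\<phi> \<circ> P, b)) \<nu>"
  have snd: "image_mset snd \<nu>' = image_mset snd \<nu>"
    by (simp add: \<nu>'_def image_mset.compositionality o_def case_prod_unfold)
  have deg: "mdeg \<nu>' = p ^ n"
    using \<nu>(2) by (simp add: mdeg_def snd)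
  have sub: "set_mset \<nu>' \<subseteq> dual_space scale UNIV \<times> UNIV"
    using \<nu>(1) P(3) by (auto simp: \<nu>'_def)
  have T: "teich_monom v \<nu>' = teich_monom v \<nu>" if "v \<in> W" for v
    using P(2)[OF that] by (simp add: \<nu>'_def image_mset.compositionality o_def case_prod_unfold)
  have "(rel_sum UNIV (\<lambda>v. if v \<in> W then a v else 0) \<nu>')
     = (rel_sum W a \<nu>)"
    using fin by (intro sum.mono_neutral_cong_right) (auto simp: snd T)
  then show "of_nat (p ^ Suc n) dvd (rel_sum W a \<nu>)"
    using rel[unfolded omega_rel_def, rule_format, OF sub deg] by simp
qed

lemma omega_rel_extend:
  fixes a :: "'v \<Rightarrow> 'k wv"
  assumes W: "subspace W" and fin: "finite (UNIV :: 'v set)" and rel: "omega_rel p n scale W a"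
  shows "omega_rel p n scale UNIV (\<lambda>v. if v \<in> W then a v else 0)"
  unfolding omega_rel_def
proof (intro allI impI)
  fix \<nu> :: "(('v \<Rightarrow> 'k) \<times> nat) multiset"
  assume \<nu>: "set_mset \<nu> \<subseteq> dual_space scale UNIV \<times> UNIV" "mdeg \<nu> = p ^ n"
  define \<nu>' where "\<nu>' = image_mset (\<lambda>(\<phi>, b). (restrict \<phi> W, b)) \<nu>"
  have snd: "image_mset snd \<nu>' = image_mset snd \<nu>"
    by (simp add: \<nu>'_def image_mset.compositionality o_def case_prod_unfold)
  have deg: "mdeg \<nu>' = p ^ n"
    using \<nu>(2) by (simp add: mdeg_def snd)
  have sub: "set_mset \<nu>' \<subseteq> dual_space scale W \<times> UNIV"
    using \<nu>(1) W by (auto simp: \<nu>'_def dual_space_def subspace_add subspace_scale)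
  have T: "teich_monom v \<nu>' = teich_monom v \<nu>" if "v \<in> W" for v
    using that by (simp add: \<nu>'_def image_mset.compositionality o_def case_prod_unfold)
  have "(rel_sum UNIV (\<lambda>v. if v \<in> W then a v else 0) \<nu>)
     = (rel_sum W a \<nu>')"
    using fin by (intro sum.mono_neutral_cong_right) (auto simp: snd T)
  then show "of_nat (p ^ Suc n) dvd (rel_sum UNIV (\<lambda>v. if v \<in> W then a v else 0) \<nu>)"
    using rel[unfolded omega_rel_def, rule_format, OF sub deg] by simp
qed

end

lemma card_Gr:
  assumes "m \<le> b"
  shows "card (Gr TYPE('k::{field,finite}) m b) * qfact CARD('k) m * qfact CARD('k) (b - m) = qfact CARD('k) b"
proof -
  interpret F: finite_field_space "\<lambda>(c::'k) (x::nat \<Rightarrow> 'k) i. c * x i"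
    by unfold_locales (auto simp: fun_eq_iff algebra_simps)
  let ?U = "{x :: nat \<Rightarrow> 'k. \<forall>i\<ge>b. x i = 0}"
  have bij: "bij_betw (\<lambda>x. restrict x {..<b}) ?U ({..<b} \<rightarrow>\<^sub>E UNIV)"
    by (rule bij_betwI[of _ _ _ "\<lambda>f i. if i < b then f i else 0"])
      (auto simp: fun_eq_iff PiE_def extensional_def)
  have "card ?U = CARD('k) ^ b" "finite ?U"
    using bij_betw_same_card[OF bij] bij_betw_finite[OF bij] by (simp_all add: card_PiE finite_PiE)
  moreover have "F.subspace ?U"
    by (simp add: F.subspace_def)
  ultimately have "card {W. F.subspace W \<and> {} \<subseteq> W \<and> W \<subseteq> ?U \<and> F.dim W = card ({} :: (nat \<Rightarrow> 'k) set) + m} * qfact CARD('k) m * qfact CARD('k) (b - m) = qfact CARD('k) b"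
    using assms by (intro F.card_intermediate_subspaces) (auto simp: F.independent_empty)
  then show ?thesis
    by (simp add: Gr_def Grassmannian_def)
qed


section \<open>The Frobenius integral formula\<close>

text \<open>The degree is positive, so some exponent is; its functional vanishes at 0, and with it
  the whole monomial.\<close>

lemma omega_rel_delta_0:
  assumes "prime p" "finite V" "vector_space scale" "Modules.module.subspace scale V"
  shows "omega_rel p n scale V (\<lambda>v. c * delta 0 v)"
  unfolding omega_rel_def
proof (intro allI impI)
  interpret vector_space scale by fact
  fix \<nu> assume \<nu>: "set_mset \<nu> \<subseteq> dual_space scale V \<times> UNIV" "mdeg \<nu> = p ^ n"
  have "mdeg \<nu> > 0"
    using \<nu>(2) prime_gt_0_nat[OF assms(1)] by simp
  then obtain \<phi> b where b: "(\<phi>, b) \<in># \<nu>" "b > 0"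
    using mdeg_pos_ex by blast
  have 0: "0 \<in> V"
    using assms(4) by (rule subspace_0)
  have "\<phi> \<in> dual_space scale V"
    using \<nu>(1) b by auto
  then have "\<phi> (scale 0 0) = 0 * \<phi> 0"
    using 0 unfolding dual_space_def by blast
  then have "\<phi> 0 = 0"
    by simp
  then have "teich (\<phi> 0) ^ b = 0"
    using b(2) by (simp add: teich_def zero_wv_def[symmetric] power_0_left)
  then have "teich_monom 0 \<nu> = 0"
    using b(1) by (auto dest!: multi_member_split)
  then have "(rel_sum V (\<lambda>v. c * delta 0 v) \<nu>) = 0"
    by (intro sum.neutral) (auto simp: delta_def)
  then show "of_nat (p ^ Suc n) dvd (rel_sum V (\<lambda>v. c * delta 0 v) \<nu>)"
    by simp
qed

lemma presented_abelian_monoid: "presented S V \<Theta> r \<Longrightarrow> abelian_monoid S"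
  by (rule abelian_monoidI) (auto simp: presentedD(2,3,4) add_ac)

lemma presented_finsum:
  assumes S: "presented S V \<Theta> r" and X: "finite X"
  shows "(\<Oplus>\<^bsub>S\<^esub>W\<in>X. \<Theta> (f W)) = \<Theta> (\<lambda>v. \<Sum>W\<in>X. f W v)"
proof -
  note P = presentedD[OF S]
  interpret abelian_monoid S
    by (rule presented_abelian_monoid[OF S])
  show ?thesis
    using X
  proof (induction X rule: finite_induct)
    case (insert W X)
    then have "(\<Oplus>\<^bsub>S\<^esub>W\<in>insert W X. \<Theta> (f W)) = \<Theta> (f W) \<oplus>\<^bsub>S\<^esub> (\<Oplus>\<^bsub>S\<^esub>W\<in>X. \<Theta> (f W))"
      by (intro finsum_insert) (auto simp: P(2))
    then show ?case
      using insert by (simp add: P(4))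
  qed (simp add: P(3))
qed

theorem proposition13p11:
  fixes p r n m :: nat
    and scale :: "'k::{field,finite} \<Rightarrow> 'v::ab_group_add \<Rightarrow> 'v"
    and B V :: "'v set"
    and \<delta> :: nat
  assumes p: "prime p"
    and k: "CARD('k) = p ^ r"
    and n: "n > 0"
    and V: "finite_dimensional_vector_space scale B" "V = UNIV" "V \<noteq> {0}"
    and \<delta>: "\<delta> = vector_space.dim scale V"
    and m: "1 \<le> m" "m \<le> \<delta> - 1"
  shows "(\<lambda>x\<in>carrier (Omega_small p (n + m * r) scale V).
            inv\<^bsub>witt p\<^esub> (add_pow (witt p) (card (Gr TYPE('k) m (\<delta> - 1))) \<one>\<^bsub>witt p\<^esub>) \<odot>\<^bsub>Omega_small p n scale V\<^esub>
            (\<Oplus>\<^bsub>Omega_small p n scale V\<^esub> W \<in> Grassmannian scale (\<delta> - m) V.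
               omega_map p n scale scale W V (\<lambda>w. w) (descending_transfer p n (m * r) scale V W x)))
         = omega_frob p n (m * r) scale V"
proof -
  interpret fdvs: finite_dimensional_vector_space scale B by (rule V(1))
  interpret F: finite_field_space scale ..
  have "CHAR('k) dvd p ^ r"
  proof -
    \<comment> \<open>Translation by 1 permutes \<open>k\<close>; comparing the two sums gives
      \<open>|k| = 0\<close> in \<open>k\<close>.\<close>
    have "(\<Sum>x\<in>UNIV. x + 1 :: 'k) = (\<Sum>x\<in>UNIV. x)"
      by (rule sum.reindex_bij_witness[of _ "\<lambda>x. x - 1" "\<lambda>x. x + 1"]) auto
    then have "of_nat (CARD('k)) = (0 :: 'k)"
      by (simp add: sum.distrib)
    then have "CHAR('k) dvd CARD('k)"
      by (simp only: of_nat_eq_0_iff_char_dvd)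
    then show ?thesis
      by (simp add: k)
  qed
  then have char: "p = CHAR('k)"
    using p prime_CHAR_finite[where ?'k = 'k] by (metis prime_dvd_power primes_dvd_imp_eq)
  interpret K: witt_field p "TYPE('k)" r
    by unfold_locales (use char k in auto)
  have fin: "finite (UNIV :: 'v set)"
    using F.card_span[of B] fdvs.finite_Basis fdvs.independent_Basis fdvs.span_Basis by simp
  have dim: "card (UNIV :: 'v set) = CARD('k) ^ \<delta>"
    using F.card_subspace[of UNIV] fin \<delta> V(2) by simp
  let ?N = "card (Gr TYPE('k) m (\<delta> - 1))"
  let ?L = "Omega_small p (n + m * r) scale V" and ?S = "Omega_small p n scale V"
  let ?G = "Grassmannian scale (\<delta> - m) V"
  let ?T = "\<lambda>W x. omega_map p n scale scale W V (\<lambda>w. w) (descending_transfer p n (m * r) scale V W x)"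
  have N_eq: "?N * qfact CARD('k) m * qfact CARD('k) (\<delta> - 1 - m) = qfact CARD('k) (\<delta> - 1)"
    by (rule card_Gr) (rule m)
  have "coprime ?N p"
  proof -
    have "\<not> p dvd qfact CARD('k) (\<delta> - 1)"
      using K.r_pos by (intro prime_not_dvd_qfact p) (auto simp: k prime_gt_0_nat[OF p])
    then have "\<not> p dvd ?N"
      by (metis N_eq dvd_mult2)
    then show ?thesis
      using prime_imp_coprime[OF p] coprime_commute by blast
  qed
  then obtain y :: "'k wv" where y: "of_nat ?N * y = 1"
    using K.wv_coprime_unit by blast
  have inv_N: "inv\<^bsub>witt p\<^esub> (add_pow (witt p) ?N \<one>\<^bsub>witt p\<^esub>) = wcomp y"
  proof -
    interpret C: cring "witt p :: (nat \<Rightarrow> 'k) ring" by (rule K.witt_cring)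
    show ?thesis
      unfolding K.witt_add_pow
      by (rule C.inv_char) (simp_all only: K.witt_ops(1,3,5) y mult.commute[of y] UNIV_I)
  qed
  have sub: "fdvs.subspace W" "finite W" if "W \<in> ?G" for W
    using that fin by (auto simp: Grassmannian_def intro: finite_subset)
  have count: "card {W \<in> ?G. v \<in> W} = ?N" if "v \<noteq> 0" for v
  proof -
    \<comment> \<open>Containing \<open>v\<close> costs one dimension, so the count is that of
      \<open>a = \<delta> - 1 - m\<close> in \<open>e = \<delta> - 1\<close>. As
      \<open>e - a = m\<close>, the symmetry of the Gaussian binomial turns it into the cardinality
      for \<open>m\<close>.\<close>
    have e: "CARD('k) ^ \<delta> = CARD('k) ^ (card {v} + (\<delta> - 1))" "\<delta> - m = card {v} + (\<delta> - 1 - m)"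
      using m by auto
    have "card {W. fdvs.subspace W \<and> {v} \<subseteq> W \<and> W \<subseteq> UNIV \<and> fdvs.dim W = card {v} + (\<delta> - 1 - m)} *
        qfact CARD('k) (\<delta> - 1 - m) * qfact CARD('k) (\<delta> - 1 - (\<delta> - 1 - m)) = qfact CARD('k) (\<delta> - 1)"
      using that fin dim e(1) by (intro F.card_intermediate_subspaces) (auto simp: fdvs.independent_insert fdvs.independent_empty)
    moreover have "{W. fdvs.subspace W \<and> {v} \<subseteq> W \<and> W \<subseteq> UNIV \<and> fdvs.dim W = card {v} + (\<delta> - 1 - m)} = {W \<in> ?G. v \<in> W}"
      unfolding e(2)[symmetric] by (auto simp: Grassmannian_def V(2))
    moreover have "\<delta> - 1 - (\<delta> - 1 - m) = m"
      using m by simp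
    ultimately have "card {W \<in> ?G. v \<in> W} * qfact CARD('k) m * qfact CARD('k) (\<delta> - 1 - m)
        = ?N * qfact CARD('k) m * qfact CARD('k) (\<delta> - 1 - m)"
      unfolding N_eq by (simp add: mult_ac)
    then show ?thesis
      using qfact_pos[OF F.q_gt_1, of m] qfact_pos[OF F.q_gt_1, of "\<delta> - 1 - m"] by simp
  qed
  \<comment> \<open>\<open>A\<close> is the source, at level \<open>n + m r\<close>, and
    \<open>E\<close> the target, at level \<open>n\<close>; \<open>D\<close> below belongs to a
    subspace \<open>W\<close>.\<close>
  interpret A: omega_space p "TYPE('k)" scale "n + m * r" "Suc (n + m * r)" "p ^ (n + m * r)" V
    by unfold_locales (simp_all add: V(2) fin)
  interpret E: omega_space p "TYPE('k)" scale n "Suc n" "p ^ n" V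
    by unfold_locales (simp_all add: V(2) fin)
  note PA = A.Omega_small_presented and PE = E.Omega_small_presented
  have frob: "omega_frob p n (m * r) scale V \<in> linear_maps (witt p) ?L ?S"
      "omega_frob p n (m * r) scale V (A.Theta a) = E.Theta a" for a
    unfolding omega_frob_def
    by (rule presented_linear_map[OF PA PE, of "\<lambda>a. a"];
        auto simp: A.omega_elem_eq E.omega_elem_eq intro: K.omega_rel_frob)+
  have transfer: "?T W (A.Theta a) =
      E.Theta (\<lambda>v. if v \<in> W then a v else 0)" if W: "W \<in> ?G" for W and a :: "'v \<Rightarrow> 'k wv"
  proof -
    interpret D: omega_space p "TYPE('k)" scale n "Suc n" "p ^ n" W
      by unfold_locales (simp_all add: sub[OF W])
    note PD = D.Omega_small_presented
    have "descending_transfer p n (m * r) scale V W (A.Theta a) = D.Theta a"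
      unfolding descending_transfer_def
    \<comment> \<open>The transfer is the identity on coefficient functions, because
      \<open>D.Theta\<close> ignores values outside \<open>W\<close>. What has to be shown is that
      relations at the higher level stay relations after this truncation.\<close>
    proof (rule presented_linear_map(2)[OF PA PD, of "\<lambda>a. a"])
      fix b :: "'v \<Rightarrow> 'k wv" assume b: "omega_rel p (n + m * r) scale V b"
      obtain \<Psi> where \<Psi>: "finite \<Psi>" "\<Psi> \<subseteq> dual_space scale UNIV" "card \<Psi> = fdvs.dim UNIV - fdvs.dim W" "W = {v. \<forall>\<psi>\<in>\<Psi>. \<psi> v = 0}"
        using F.subspace_eq_common_kernel[OF sub(1)[OF W] fin] by blast
      have "card \<Psi> = m"
        using \<Psi>(3) W m by (simp add: Grassmannian_def \<delta> V(2))
      then have "omega_rel p n scale UNIV (\<lambda>v. if \<forall>\<psi>\<in>\<Psi>. \<psi> v = 0 then b v else 0)"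
        using b \<Psi>(1,2) by (intro K.omega_rel_transfer) (auto simp: V(2))
      then have "omega_rel p n scale UNIV (\<lambda>v. if v \<in> W then b v else 0)"
        by (simp add: \<Psi>(4))
      then show "omega_rel p n scale W b"
        by (rule F.omega_rel_restrict[OF sub(1)[OF W] fin])
    next
      fix v assume "v \<in> V"
      show "(if v \<in> W then omega_elem p n scale W v else \<zero>\<^bsub>Omega_small p n scale W\<^esub>) = D.Theta (delta v)"
      proof (cases "v \<in> W")
        case False
        then have "D.Theta (\<lambda>u. 0) = D.Theta (delta v)"
          by (intro D.Theta_cong) (auto simp: delta_def)
        then show ?thesis
          using False by (simp add: presentedD(3)[OF PD])
      qed (simp add: D.omega_elem_eq)
    qed (auto simp: A.omega_elem_eq)
    moreover have "omega_map p n scale scale W V (\<lambda>w. w) (D.Theta a) = E.Theta (\<lambda>v. if v \<in> W then a v else 0)"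
      unfolding omega_map_def
    \<comment> \<open>Extension by zero is explicit here, since \<open>E.Theta\<close> does read the
      values outside \<open>W\<close>.\<close>
    proof (rule presented_linear_map(2)[OF PD PE, of "\<lambda>a v. if v \<in> W then a v else 0"])
      show "omega_rel p n scale W b \<Longrightarrow> omega_rel p n scale V (\<lambda>v. if v \<in> W then b v else 0)" for b :: "'v \<Rightarrow> 'k wv"
        unfolding V(2) by (rule F.omega_rel_extend[OF sub(1)[OF W] fin])
      show "omega_elem p n scale V v = E.Theta (\<lambda>u. if u \<in> W then delta v u else 0)" if "v \<in> W" for v
      proof -
        have "(\<lambda>u. if u \<in> W then delta v u else 0) = (delta v :: 'v \<Rightarrow> 'k wv)"
          using that by (auto simp: delta_def fun_eq_iff)
        moreover have "v \<in> V"
          by (simp add: V(2))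
        ultimately show ?thesis
          by (simp only: E.omega_elem_eq)
      qed
    qed (auto simp: D.omega_elem_eq fun_eq_iff)
    ultimately show ?thesis
      by simp
  qed
  have finG: "finite ?G"
    by (rule finite_subset[OF _ iffD2[OF finite_Pow_iff fin]]) blast
  have main: "wcomp y \<odot>\<^bsub>?S\<^esub> (\<Oplus>\<^bsub>?S\<^esub> W \<in> ?G. ?T W (A.Theta a))
      = E.Theta a" for a
  proof -
    interpret S: abelian_monoid ?S
      by (rule presented_abelian_monoid[OF PE])
    let ?c = "\<lambda>v. \<Sum>W\<in>?G. if v \<in> W then a v else 0"
    have "(\<Oplus>\<^bsub>?S\<^esub> W \<in> ?G. ?T W (A.Theta a))
      = (\<Oplus>\<^bsub>?S\<^esub> W \<in> ?G. E.Theta (\<lambda>v. if v \<in> W then a v else 0))"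
      by (rule S.finsum_cong') (auto simp: transfer presentedD(2)[OF PE])
    also have "\<dots> = E.Theta ?c"
      by (rule presented_finsum[OF PE finG])
    finally have "wcomp y \<odot>\<^bsub>?S\<^esub> (\<Oplus>\<^bsub>?S\<^esub> W \<in> ?G. ?T W (A.Theta a))
      = E.Theta (\<lambda>v. y * ?c v)"
      by (simp add: presentedD(5)[OF PE])
    also have "\<dots> = E.Theta a"
      unfolding E.Theta_eq_iff
    proof -
      have c: "?c v = of_nat (card {W \<in> ?G. v \<in> W}) * a v" for v
        using finG by (simp add: sum.If_cases Int_def)
      \<comment> \<open>Every subspace contains 0, so at \<open>v = 0\<close> the count is the size
        of the whole Grassmannian instead of \<open>?N\<close>. The resulting error is a multiple of
        the generator of 0, which is a relation.\<close>
      have "y * ?c v - a v = (y * ?c 0 - a 0) * delta 0 v" for v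
      proof (cases "v = 0")
        case False
        have "y * ?c v = (of_nat ?N * y) * a v"
          unfolding c count[OF False] by (simp only: mult_ac)
        then have "y * ?c v = a v"
          by (simp only: y mult_1)
        then show ?thesis
          using False by (simp only: delta_def if_False mult_zero_right diff_self)
      next
        case True
        show ?thesis
          unfolding True by (simp add: delta_def)
      qed
      then have eq: "(\<lambda>v. y * ?c v - a v) = (\<lambda>v. (y * ?c 0 - a 0) * delta 0 v)"
        by (rule ext)
      show "omega_rel p n scale V (\<lambda>v. y * ?c v - a v)"
        unfolding eq by (rule omega_rel_delta_0[OF p]) (simp_all add: V(2) fin fdvs.vector_space_axioms)
    qed
    finally show ?thesis .
  qed
  show ?thesis
    unfolding inv_N
  proof (rule extensionalityI[of _ "carrier ?L"])
    show "omega_frob p n (m * r) scale V \<in> extensional (carrier ?L)"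
      using frob(1) by (auto simp: linear_maps_def PiE_def)
    fix x assume "x \<in> carrier ?L"
    then obtain a where x: "x = A.Theta a"
      using presentedD(2)[OF PA] by auto
    show "(\<lambda>x\<in>carrier ?L. wcomp y \<odot>\<^bsub>?S\<^esub> (\<Oplus>\<^bsub>?S\<^esub> W \<in> ?G. ?T W x)) x
        = omega_frob p n (m * r) scale V x"
      using \<open>x \<in> carrier ?L\<close> by (simp add: x main frob(2))
  qed simp
qed

end
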